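(* Let $c=\pi/\sqrt6$, fix $\gamma<1/4$ and let $k=[n^{\gamma}]$. Let $\Lambda$ be a uniformly random partition of $n$ with parts $\Lambda_1\ge\Lambda_2\ge\cdots$ and dual parts $\Lambda'_1\ge\Lambda'_2\ge\cdots$, and set $\vec\Lambda=(\Lambda_1,\dots,\Lambda_k)$, $\vec\Lambda'=(\Lambda'_1,\dots,\Lambda'_k)$. Let $E_1,\dots,E_k,E'_1,\dots,E'_k$ be independent with $\mathbb P(E_i>x)=\mathbb P(E'_i>x)=e^{-x}$, $x\ge0$; put $S_j=\sum_{i=1}^jE_i$, $S'_j=\sum_{i=1}^jE'_i$, \[ \varLambda_j=\left\lceil\frac{n^{1/2}}{c}\log\frac{n^{1/2}/c}{S_j}\right\rceil,\qquad \varLambda'_j=\left\lceil\frac{n^{1/2}}{c}\log\frac{n^{1/2}/c}{S'_j}\right\rceil, \] and $\vec\varLambda=(\varLambda_j)_{1\le j\le k}$, $\vec\varLambda'=(\varLambda'_j)_{1\le j\le k}$. Then the total variation distance between the distribution of $(\vec\Lambda,\vec\Lambda')$ and that of $(\vec\varLambda,\vec\varLambda')$ is $O(n^{2\gamma-1/2}\log^3n)$, i.e. \[ \max_A\bigl|\mathbb P((\vec\Lambda,\vec\Lambda')\in A)-\mathbb P((\vec\varLambda,\vec\varLambda')\in A)\bigr|=O(n^{2\gamma-1/2}\log^3 n), \] the maximum over all sets $A$ of pairs of weakly decreasing $k$-tuples of nonnegative integers, each tuple with sum at most $n$. Consequently, for any two sets $B_1,B_2$ of weakly decreasing $k$-tuples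 $(\lambda_j)_{1\le j\le k}$ with $\sum_j\lambda_j\le n$, \[ \mathbb P(\vec\Lambda\in B_1,\ \vec\Lambda'\in B_2)=\mathbb P(\vec\Lambda\in B_1)\,\mathbb P(\vec\Lambda'\in B_2)+O(n^{2\gamma-1/2}\log^3n). \]
   Context: A partition of $n$ is a weakly decreasing sequence of positive integers summing to $n$, viewed as a Young diagram whose column heights are the parts; $\Lambda$ is uniform over all partitions of $n$ (parts beyond the number of parts are taken to be $0$). The dual partition has parts $\Lambda'_i=|\{j:\Lambda_j\ge i\}|$ (row lengths of the diagram). *)

theory Defs
  imports "HOL-Probability.Probability" "HOL-Library.Landau_Symbols"
begin

definition partitions :: "nat \<Rightarrow> nat list set" where
  "partitions n = {xs. sorted_wrt (\<ge>) xs \<and> (\<forall>x\<in>set xs. 0 < x) \<and> sum_list xs = n}"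

text \<open>Parts are numbered from 1; the parts beyond the number of parts are 0.\<close>

definition part :: "nat list \<Rightarrow> nat \<Rightarrow> nat" where
  "part xs j = (if 1 \<le> j \<and> j \<le> length xs then xs ! (j - 1) else 0)"

text \<open>Only meaningful for \<open>i \<ge> 1\<close>, where the set of indices is finite.\<close>

definition dual_part :: "nat list \<Rightarrow> nat \<Rightarrow> nat" where
  "dual_part xs i = card {j. 1 \<le> j \<and> part xs j \<ge> i}"

definition random_partition :: "nat \<Rightarrow> nat list pmf" where
  "random_partition n = pmf_of_set (partitions n)"

definition num_parts :: "real \<Rightarrow> nat \<Rightarrow> nat" where
  "num_parts \<gamma> n = nat \<lfloor>real n powr \<gamma>\<rfloor>"

text \<open>Tuples \<open>(f 1, \<dots>, f k)\<close> are lists of length \<open>k\<close>. Their entries are integers, because the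
  rounded logarithms below can be negative.\<close>

definition tuple :: "nat \<Rightarrow> (nat \<Rightarrow> int) \<Rightarrow> int list" where
  "tuple k f = map f [1..<Suc k]"

definition part_tuple :: "nat \<Rightarrow> nat list \<Rightarrow> int list" where
  "part_tuple k xs = tuple k (\<lambda>j. int (part xs j))"

definition dual_tuple :: "nat \<Rightarrow> nat list \<Rightarrow> int list" where
  "dual_tuple k xs = tuple k (\<lambda>j. int (dual_part xs j))"

definition c_const :: real where
  "c_const = pi / sqrt 6"

definition model_part :: "nat \<Rightarrow> (nat \<Rightarrow> real) \<Rightarrow> nat \<Rightarrow> int" where
  "model_part n e j =
     \<lceil>sqrt (real n) / c_const * ln ((sqrt (real n) / c_const) / (\<Sum>i=1..j. e i))\<rceil>"

definition model_tuple :: "nat \<Rightarrow> nat \<Rightarrow> (nat \<Rightarrow> real) \<Rightarrow> int list" where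
  "model_tuple k n e = tuple k (model_part n e)"

definition decr_tuples :: "nat \<Rightarrow> nat \<Rightarrow> int list set" where
  "decr_tuples k n =
     {v. length v = k \<and> sorted_wrt (\<ge>) v \<and> (\<forall>x\<in>set v. 0 \<le> x) \<and> sum_list v \<le> int n}"

text \<open>Total variation distance of two probability measures on the same measurable space.\<close>

definition tv_dist :: "'a measure \<Rightarrow> 'a measure \<Rightarrow> real" where
  "tv_dist P Q = (SUP A\<in>sets P. \<bar>measure P A - measure Q A\<bar>)"

text \<open>The uniform distribution on the partitions of \<open>n\<close> and the maximum over all subsets of
  \<^term>\<open>decr_tuples k n \<times> decr_tuples k n\<close> are well defined:\<close>

lemma finite_partitions: "finite (partitions n)"
proof (rule finite_subset)
  show "partitions n \<subseteq> {xs. set xs \<subseteq> {0..n} \<and> length xs \<le> n}"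
  proof
    fix xs assume "xs \<in> partitions n"
    then have pos: "\<forall>x\<in>set xs. 0 < x" and s: "sum_list xs = n"
      by (auto simp: partitions_def)
    have "length xs \<le> sum_list xs"
      using pos by (induction xs) auto
    moreover have "set xs \<subseteq> {0..n}"
      using s member_le_sum_list by fastforce
    ultimately show "xs \<in> {xs. set xs \<subseteq> {0..n} \<and> length xs \<le> n}"
      using s by auto
  qed
  show "finite {xs. set xs \<subseteq> {0..n} \<and> length xs \<le> n}"
    by (rule finite_lists_length_le) simp
qed

lemma partitions_nonempty: "partitions n \<noteq> {}"
proof -
  have "replicate n 1 \<in> partitions n"
    by (auto simp: partitions_def sum_list_replicate sorted_wrt_iff_nth_less)
  then show ?thesis by blast
qed

lemma finite_decr_tuples: "finite (decr_tuples k n)"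
proof (rule finite_subset)
  have le: "x \<le> sum_list v" if "\<forall>y\<in>set v. 0 \<le> y" "x \<in> set v" for x :: int and v
    using that
  proof (induction v)
    case (Cons a v)
    then have "0 \<le> sum_list v" by (auto intro: sum_list_nonneg)
    with Cons show ?case by fastforce
  qed simp
  show "decr_tuples k n \<subseteq> {v. set v \<subseteq> {0..int n} \<and> length v = k}"
    using le by (fastforce simp: decr_tuples_def)
  show "finite {v. set v \<subseteq> {0..int n} \<and> length v = k}"
    by (rule finite_lists_length_eq) simp
qed

end

theory Submission
  imports Defs
begin

text \<open>
  The \<open>k\<close> largest parts and the \<open>k\<close> largest dual parts of a partition are given values \<open>(v, w)\<close> in as many
  ways as there are partitions of the remaining size \<open>n - r\<close> inside the remaining \<open>a \<times> b\<close> rectangle, so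
  the point probability is a ratio of two coefficients of Gaussian binomials. Both are Fourier
  integrals on the circle of radius \<open>q = exp (- x)\<close>, \<open>x = c / sqrt n\<close>; they differ from the integral of
  \<open>F t = (\<Prod>j\<le>n. (1 - q ^ j) / (1 - q ^ j * cis (j * t))) * cis (- n * t)\<close> by a factor \<open>\<psi>\<close> with
  \<open>\<psi> t = 1 + \<i> \<beta> t + O(A\<^sup>2 t\<^sup>2)\<close> and \<open>A = O(k sqrt n ln n)\<close>. The linear term contributes little because
  the integral of \<open>F'\<close> over a period vanishes and \<open>F' / F\<close> is nearly linear. Hence only absolute bounds
  for \<open>F\<close> and a lower bound for its integral are needed, and no asymptotic expansion.

  On the model side the cell of \<open>(S\<^sub>1, \<dots>, S\<^sub>k)\<close> belonging to \<open>v\<close> has probability at most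
  \<open>exp (k x - x * (\<Sum>v) - q ^ v\<^sub>k / x)\<close>, which matches the combinatorial weight. So every point
  probability of the partition is at least \<open>1 - O((k + S\<^sub>k + S'\<^sub>k)\<^sup>2 x ln\<^sup>2 n)\<close> times that of the model, up to
  an exceptional set of probability \<open>O(1 / n)\<close>. Such a one-sided bound between probability measures
  already bounds their total variation distance.
\<close>

section \<open>Partitions in a rectangle and prescribed frames\<close>

text \<open>\<open>F\<close> is the characteristic function, centred at n, of the size of a random
  partition with parts at most n and probability proportional to q^size. Its variance has order
  x^(-3), so under the integral t has size x^(3/2). This fixes the accuracy: a quadratic remainder
  A^2 t^2 changes the integral by a relative A^2 x^3, and A of order s ln(1/x) / x with s = k + S_k
  + S'_k makes this s^2 x ln^2(1/x). The number of partitions of n is itself a coefficient of the n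
  by n Gaussian binomial, so numerator and denominator are compared with the same integral.

  Two obstacles shape the estimates. The bound exp(A |t|) for the factor \<open>\<psi>\<close> is
  useless for t of order 1; beyond |t| = x it gives way to exp(1 / (400 x)), which the decay of
  \<open>F\<close> still outweighs. And the relative error depends on the last entries of the tuples
  and is unbounded. It is therefore averaged over the model, where s has second moment O(k^2); where
  it exceeds 1, the trivial bound 0 for the probability takes over.\<close>

definition box :: "nat \<Rightarrow> nat \<Rightarrow> nat list set" where
  "box a b = {xs. sorted_wrt (\<ge>) xs \<and> (\<forall>x\<in>set xs. 0 < x \<and> x \<le> a) \<and> length xs \<le> b}"

lemma box_0_left: "box 0 b = {[]}"
proof -
  have "xs = []" if "xs \<in> box 0 b" for xs
    using that by (cases xs) (auto simp: box_def)
  then show ?thesis by (auto simp: box_def)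
qed

lemma box_0_right: "box a 0 = {[]}"
  by (auto simp: box_def)

text \<open>Either no part reaches \<open>Suc a\<close>, or the first one does and is removed. This
  is the q-Pascal recurrence behind the product formula.\<close>

lemma box_Suc: "box (Suc a) (Suc b) = box a (Suc b) \<union> Cons (Suc a) ` box (Suc a) b"
proof (intro equalityI subsetI)
  fix xs assume xs: "xs \<in> box (Suc a) (Suc b)"
  show "xs \<in> box a (Suc b) \<union> Cons (Suc a) ` box (Suc a) b"
  proof (cases xs)
    case (Cons y ys)
    show ?thesis
    proof (cases "y = Suc a")
      case True
      with xs Cons show ?thesis by (auto simp: box_def)
    next
      case False
      with xs Cons show ?thesis by (fastforce simp: box_def)
    qed
  qed (auto simp: box_def)
next
  fix xs assume "xs \<in> box a (Suc b) \<union> Cons (Suc a) ` box (Suc a) b"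
  then show "xs \<in> box (Suc a) (Suc b)"
    by (auto simp: box_def)
qed

lemma finite_box: "finite (box a b)"
proof (rule finite_subset)
  show "box a b \<subseteq> {xs. set xs \<subseteq> {0..a} \<and> length xs \<le> b}"
    by (auto simp: box_def)
qed (simp add: finite_lists_length_le)

lemma sum_box_Suc:
  fixes z :: "'a :: comm_ring_1"
  shows "(\<Sum>xs\<in>box (Suc a) (Suc b). z ^ sum_list xs) =
    (\<Sum>xs\<in>box a (Suc b). z ^ sum_list xs) + z ^ Suc a * (\<Sum>xs\<in>box (Suc a) b. z ^ sum_list xs)"
proof -
  have disj: "box a (Suc b) \<inter> Cons (Suc a) ` box (Suc a) b = {}"
    by (auto simp: box_def)
  have "(\<Sum>xs\<in>box (Suc a) (Suc b). z ^ sum_list xs) = (\<Sum>xs\<in>box a (Suc b). z ^ sum_list xs)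
      + (\<Sum>xs\<in>Cons (Suc a) ` box (Suc a) b. z ^ sum_list xs)"
    unfolding box_Suc by (rule sum.union_disjoint) (use disj finite_box in auto)
  also have "(\<Sum>xs\<in>Cons (Suc a) ` box (Suc a) b. z ^ sum_list xs)
      = z ^ Suc a * (\<Sum>xs\<in>box (Suc a) b. z ^ sum_list xs)"
    by (subst sum.reindex) (auto simp: power_add sum_distrib_left mult_ac)
  finally show ?thesis .
qed

text \<open>The product formula is kept free of division so that it holds in every commutative ring;
  it is used at the real point q and at complex points of the circle of radius q.\<close>

lemma gaussian_binomial:
  fixes z :: "'a :: comm_ring_1"
  shows "(\<Sum>xs\<in>box a b. z ^ sum_list xs) * (\<Prod>j=1..a. 1 - z ^ j) * (\<Prod>j=1..b. 1 - z ^ j)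
    = (\<Prod>j=1..a+b. 1 - z ^ j)"
proof (induction "a + b" arbitrary: a b rule: less_induct)
  case less
  show ?case
  proof (cases a)
    case 0
    then show ?thesis by (simp add: box_0_left)
  next
    case (Suc a')
    note a = this
    show ?thesis
    proof (cases b)
      case 0
      then show ?thesis by (simp add: box_0_right)
    next
      case (Suc b')
      define S where "S = (\<lambda>a b. \<Sum>xs\<in>box a b. z ^ sum_list xs)"
      define P where "P = (\<lambda>a. \<Prod>j=1..a. 1 - z ^ j)"
      have P_Suc: "P (Suc m) = P m * (1 - z ^ Suc m)" for m
        by (simp add: P_def)
      have 1: "S a' b * P a' * P b = P (a' + b)" "S a b' * P a * P b' = P (a + b')"
        using less.hyps[of a' b] less.hyps[of a b'] a Suc by (simp_all add: S_def P_def)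
      have "S a b * P a * P b = (S a' b + z ^ a * S a b') * P a * P b"
        using sum_box_Suc[of z a' b'] by (simp add: a Suc S_def)
      \<comment> \<open>Both terms carry the product up to a + b - 1; what remains is (1 - z^a) +
        z^a (1 - z^b) = 1 - z^(a+b).\<close>
      also have "\<dots> = (1 - z ^ a) * (S a' b * P a' * P b) + z ^ a * (1 - z ^ b) * (S a b' * P a * P b')"
        by (simp only: a Suc P_Suc) (simp add: algebra_simps)
      also have "\<dots> = P (a' + b) * (1 - z ^ a) + P (a' + b) * (z ^ a * (1 - z ^ b))"
        unfolding 1 by (simp add: a Suc algebra_simps)
      also have "\<dots> = P (a' + b) * (1 - z ^ (a + b))"
        by (simp add: algebra_simps power_add)
      also have "\<dots> = P (a + b)"
        using P_Suc[of "a' + b"] by (simp add: a)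
      finally show ?thesis by (simp add: S_def P_def)
    qed
  qed
qed

text \<open>All parts and the number of parts are at most n. This writes the number of partitions as
  a coefficient of the same kind as the restricted counts, with a = b = N = n.\<close>

lemma partitions_eq_box: "partitions n = {xs \<in> box n n. sum_list xs = n}"
proof -
  have "length xs \<le> sum_list xs" if "\<forall>x\<in>set xs. 0 < x" for xs :: "nat list"
    using that by (induction xs) auto
  then show ?thesis
    using member_le_sum_list by (fastforce simp: partitions_def box_def)
qed

text \<open>Padding by 0 loses nothing because the entries are positive: the length is the last
  index with a nonzero part.\<close>

lemma part_inject:
  assumes "\<forall>x\<in>set xs. 0 < x" "\<forall>x\<in>set ys. 0 < x" and eq: "\<And>j. 1 \<le> j \<Longrightarrow> part xs j = part ys j"
  shows "xs = ys"
proof -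
  have le: "length xs \<le> length ys"
    if "\<forall>x\<in>set xs. 0 < x" "\<And>j. 1 \<le> j \<Longrightarrow> part xs j = part ys j" for xs ys
  proof (rule ccontr)
    assume "\<not> ?thesis"
    then have "part ys (length xs) = 0" "part xs (length xs) = xs ! (length xs - 1)" "length xs > 0"
      by (auto simp: part_def Suc_le_eq)
    moreover have "xs ! (length xs - 1) > 0"
      using that(1) \<open>length xs > 0\<close> by simp
    ultimately show False
      using that(2)[of "length xs"] by simp
  qed
  have len: "length xs = length ys"
    using le[of xs ys] le[of ys xs] assms by auto
  show ?thesis
  proof (rule nth_equalityI[OF len])
    fix i assume "i < length xs"
    with eq[of "Suc i"] len show "xs ! i = ys ! i"
      by (simp add: part_def)
  qed
qed

lemma sum_part: "length xs \<le> m \<Longrightarrow> (\<Sum>j=1..m. part xs j) = sum_list xs"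
proof -
  assume m: "length xs \<le> m"
  have "(\<Sum>j=1..m. part xs j) = (\<Sum>j=1..length xs. part xs j)"
    using m by (intro sum.mono_neutral_right) (auto simp: part_def)
  also have "\<dots> = (\<Sum>j<length xs. xs ! j)"
    by (rule sum.reindex_bij_witness[of _ "Suc" "\<lambda>j. j - 1"]) (auto simp: part_def)
  also have "\<dots> = sum_list xs"
    by (simp add: sum_list_sum_nth atLeast0LessThan)
  finally show ?thesis .
qed

text \<open>A partition whose \<open>k\<close> largest parts \<open>l\<close> and \<open>k\<close> largest dual parts \<open>l'\<close> are prescribed is
  obtained from these \<open>k\<close> columns and \<open>k\<close> rows by placing an arbitrary partition inside the remaining
  rectangle.\<close>

definition frame_part :: "nat \<Rightarrow> (nat \<Rightarrow> nat) \<Rightarrow> (nat \<Rightarrow> nat) \<Rightarrow> nat list \<Rightarrow> nat \<Rightarrow> nat" where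
  "frame_part k l l' xs j =
     (if j \<le> k then l j else card {i\<in>{1..k}. j \<le> l' i} + part xs (j - k))"

context
  fixes k :: nat and l l' :: "nat \<Rightarrow> nat"
  assumes k: "1 \<le> k"
    and l: "\<And>i j. 1 \<le> i \<Longrightarrow> i \<le> j \<Longrightarrow> j \<le> k \<Longrightarrow> l j \<le> l i" "k \<le> l k"
    and l': "\<And>i j. 1 \<le> i \<Longrightarrow> i \<le> j \<Longrightarrow> j \<le> k \<Longrightarrow> l' j \<le> l' i" "k \<le> l' k"
begin

lemma card_rows_eq:
  assumes "j \<le> l' k"
  shows "card {i\<in>{1..k}. j \<le> l' i} = k"
proof -
  have "{i\<in>{1..k}. j \<le> l' i} = {1..k}"
    using assms l'(1)[of _ k] by fastforce
  then show ?thesis by simp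
qed

text \<open>Since \<open>l'\<close> is weakly decreasing on 1..k, the rows that reach column j form
  an initial segment, so their number is at least i exactly if row i is among them.\<close>

lemma card_rows_ge_iff:
  assumes "i \<in> {1..k}"
  shows "i \<le> card {i\<in>{1..k}. j \<le> l' i} \<longleftrightarrow> j \<le> l' i"
proof
  assume j: "j \<le> l' i"
  have "{1..i} \<subseteq> {i\<in>{1..k}. j \<le> l' i}"
    using assms j l'(1)[of _ i] by fastforce
  from card_mono[OF _ this] show "i \<le> card {i\<in>{1..k}. j \<le> l' i}" by simp
next
  assume i: "i \<le> card {i\<in>{1..k}. j \<le> l' i}"
  show "j \<le> l' i"
  proof (rule ccontr)
    assume j: "\<not> ?thesis"
    have "{i\<in>{1..k}. j \<le> l' i} \<subseteq> {1..<i}"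
      using assms j l'(1)[of i] by (auto simp: not_le) (meson leI le_trans less_le_not_le)
    then have "card {i\<in>{1..k}. j \<le> l' i} \<le> i - 1"
      using card_mono[of "{1..<i}"] by fastforce
    with i assms show False by (simp del: Collect_mem_eq) linarith
  qed
qed

text \<open>The delicate place is the passage from column k to later ones: a later column has at
  most k cells in the prescribed rows and at most \<open>l k - k\<close> inside the rectangle, in
  total no more than \<open>l k\<close>.\<close>

lemma frame_part_mono:
  assumes xs: "xs \<in> box (l k - k) (l' k - k)" and ij: "1 \<le> i" "i \<le> j"
  shows "frame_part k l l' xs j \<le> frame_part k l l' xs i"
proof -
  have part_le: "part xs m \<le> l k - k" for m
    using xs by (auto simp: box_def part_def)
  have card_le: "card {i\<in>{1..k}. j \<le> l' i} \<le> k" for j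
  proof -
    have "card {i\<in>{1..k}. j \<le> l' i} \<le> card {1..k}" by (rule card_mono) auto
    then show ?thesis by simp
  qed
  have part_mono: "part xs m' \<le> part xs m" if "1 \<le> m" "m \<le> m'" for m m'
    using xs that sorted_wrt_nth_less[of "(\<ge>)" xs "m - 1" "m' - 1"]
    by (cases "m = m'") (auto simp: box_def part_def)
  have card_mono': "card {i\<in>{1..k}. j \<le> l' i} \<le> card {m\<in>{1..k}. i \<le> l' m}"
    using ij by (intro card_mono) auto
  consider "j \<le> k" | "i \<le> k" "k < j" | "k < i"
    using ij by linarith
  then show ?thesis
  proof cases
    case 1
    with ij l(1)[of i j] show ?thesis by (simp add: frame_part_def)
  next
    case 2
    then have "l k \<le> l i" using l(1)[of i k] ij by simp
    with 2 part_le[of "j - k"] card_le[of j] l(2) show ?thesis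
      by (simp add: frame_part_def)
  next
    case 3
    then have "part xs (j - k) \<le> part xs (i - k)" using ij by (intro part_mono) auto
    with 3 ij card_mono' show ?thesis
      by (simp add: frame_part_def add_mono)
  qed
qed

lemma l'_1: "k \<le> l' 1" "\<And>i. i \<in> {1..k} \<Longrightarrow> l' i \<le> l' 1" "l' k \<le> l' 1"
proof -
  show *: "l' i \<le> l' 1" if "i \<in> {1..k}" for i using l'(1)[of 1 i] that by simp
  show "l' k \<le> l' 1" using *[of k] k by simp
  with l'(2) show "k \<le> l' 1" by linarith
qed

text \<open>The number of parts of a partition is its first dual part, hence the length
  \<open>l' 1\<close>.\<close>

definition frame :: "nat list \<Rightarrow> nat list" where
  "frame xs = map (frame_part k l l' xs) [1..<Suc (l' 1)]"

lemma part_frame: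
  assumes xs: "xs \<in> box (l k - k) (l' k - k)" and j: "1 \<le> j"
  shows "part (frame xs) j = frame_part k l l' xs j"
proof (cases "j \<le> l' 1")
  case True
  with j show ?thesis by (auto simp: frame_def part_def nth_append simp del: upt_Suc)
next
  case False
  have "{i \<in> {1..k}. j \<le> l' i} = {}"
    using False l'_1(2) by fastforce
  moreover have "part xs (j - k) = 0"
    using xs False l'_1(3) by (auto simp: part_def box_def)
  moreover have "\<not> j \<le> k" using False l'_1(1) by simp
  ultimately have "frame_part k l l' xs j = 0"
    by (simp add: frame_part_def)
  with False show ?thesis by (simp add: frame_def part_def del: upt_Suc)
qed

text \<open>Row i reaches column j exactly if j <= \<open>l' i\<close>. For j <= \<open>l' k\<close>
  both sides hold, because such a column is at least k high. For larger j the rectangle contributes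
  nothing, and \<open>card_rows_ge_iff\<close> decides.\<close>

lemma dual_part_frame:
  assumes xs: "xs \<in> box (l k - k) (l' k - k)" and i: "i \<in> {1..k}"
  shows "dual_part (frame xs) i = l' i"
proof -
  have "{j. 1 \<le> j \<and> i \<le> part (frame xs) j} = {1..l' i}"
  proof -
    have "i \<le> frame_part k l l' xs j \<longleftrightarrow> j \<le> l' i" if "1 \<le> j" for j
    proof (cases "j \<le> k")
      case True
      have "k \<le> l j" using l(1)[of j k] that True l(2) by linarith
      moreover have "k \<le> l' i" using l'(1)[of i k] i l'(2) by auto
      ultimately show ?thesis using True i by (simp add: frame_part_def)
    next
      case False
      show ?thesis
      proof (cases "j \<le> l' k")
        case True
        moreover have "l' k \<le> l' i" using l'(1)[of i k] i by auto
        ultimately show ?thesis using False i card_rows_eq[OF True]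
          by (simp add: frame_part_def)
      next
        case False': False
        then have "part xs (j - k) = 0"
          using xs by (auto simp: part_def box_def)
        with False show ?thesis
          using card_rows_ge_iff[OF i, of j] by (simp add: frame_part_def)
      qed
    qed
    then show ?thesis using part_frame[OF xs] by auto
  qed
  then show ?thesis by (simp add: dual_part_def)
qed

text \<open>The k by k corner belongs to the prescribed columns and to the prescribed rows, so the
  right-hand side counts it twice.\<close>

lemma sum_list_frame:
  assumes xs: "xs \<in> box (l k - k) (l' k - k)"
  shows "sum_list (frame xs) + k\<^sup>2 = (\<Sum>j=1..k. l j) + (\<Sum>j=1..k. l' j) + sum_list xs"
proof -
  let ?J = "{Suc k..l' 1}"
  have "sum_list (frame xs) = (\<Sum>j=1..l' 1. frame_part k l l' xs j)"
    unfolding frame_def interv_sum_list_conv_sum_set_nat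
    by (simp only: set_upt atLeastLessThanSuc_atLeastAtMost)
  also have "{1..l' 1} = {1..k} \<union> ?J" using l'_1(1) by auto
  also have "(\<Sum>j\<in>{1..k} \<union> ?J. frame_part k l l' xs j)
      = (\<Sum>j=1..k. l j) + (\<Sum>j\<in>?J. card {i\<in>{1..k}. j \<le> l' i} + part xs (j - k))"
    by (subst sum.union_disjoint) (auto simp: frame_part_def)
  also have "(\<Sum>j\<in>?J. card {i\<in>{1..k}. j \<le> l' i} + part xs (j - k))
      = (\<Sum>j\<in>?J. card {i\<in>{1..k}. j \<le> l' i}) + (\<Sum>j\<in>?J. part xs (j - k))"
    by (rule sum.distrib)
  also have "(\<Sum>j\<in>?J. part xs (j - k)) = (\<Sum>j=1..l' 1 - k. part xs j)"
    by (rule sum.reindex_bij_witness[of _ "\<lambda>j. j + k" "\<lambda>j. j - k"]) auto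
  also have "\<dots> = sum_list xs"
    using xs l'_1(3) by (intro sum_part) (auto simp: box_def)
  \<comment> \<open>The cells beyond column k in the k prescribed rows, now counted by rows.\<close>
  also have "(\<Sum>j\<in>?J. card {i\<in>{1..k}. j \<le> l' i}) = (\<Sum>i=1..k. card {j\<in>?J. j \<le> l' i})"
    using sum.swap_restrict[of ?J "{1..k}" "\<lambda>_ _. 1::nat" "\<lambda>j i. j \<le> l' i"] by simp
  also have "\<dots> = (\<Sum>i=1..k. l' i - k)"
  proof (rule sum.cong)
    fix i assume i: "i \<in> {1..k}"
    have "{j\<in>?J. j \<le> l' i} = {Suc k..l' i}" using l'_1(2)[OF i] by auto
    then show "card {j\<in>?J. j \<le> l' i} = l' i - k" by simp
  qed simp
  finally have *: "sum_list (frame xs) = (\<Sum>j=1..k. l j) + ((\<Sum>i=1..k. l' i - k) + sum_list xs)" .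
  have "(\<Sum>i=1..k. l' i - k) + k\<^sup>2 = (\<Sum>i=1..k. (l' i - k) + k)"
    by (simp only: sum.distrib) (simp add: power2_eq_square)
  also have "\<dots> = (\<Sum>i=1..k. l' i)"
  proof (rule sum.cong)
    fix i assume i: "i \<in> {1..k}"
    then have "l' k \<le> l' i" using l'(1)[of i k] by auto
    with l'(2) show "l' i - k + k = l' i" by simp
  qed simp
  finally show ?thesis using * by simp
qed

text \<open>The comparison uses lower bounds for the point probabilities, so an injection from the
  fillings of the rectangle into the partitions with this frame is enough.\<close>

lemma card_frames_le:
  assumes N: "N + (\<Sum>j=1..k. l j) + (\<Sum>j=1..k. l' j) = n + k\<^sup>2"
  shows "card {xs \<in> box (l k - k) (l' k - k). sum_list xs = N} \<le>
    card {xs \<in> partitions n. \<forall>j\<in>{1..k}. part xs j = l j \<and> dual_part xs j = l' j}"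
proof (rule card_inj_on_le)
  let ?X = "{xs \<in> box (l k - k) (l' k - k). sum_list xs = N}"
  show "inj_on frame ?X"
  proof (rule inj_onI)
    fix xs ys assume xs: "xs \<in> ?X" and ys: "ys \<in> ?X" and eq: "frame xs = frame ys"
    show "xs = ys"
    proof (rule part_inject)
      \<comment> \<open>Beyond column k the frame adds the same row count to both fillings, so
        shifting the index by k recovers the parts of the filling.\<close>
      fix j :: nat assume j: "1 \<le> j"
      then have "frame_part k l l' xs (j + k) = frame_part k l l' ys (j + k)"
        using part_frame[of xs "j + k"] part_frame[of ys "j + k"] xs ys eq by simp
      then show "part xs j = part ys j" using j by (simp add: frame_part_def)
    qed (use xs ys in \<open>auto simp: box_def\<close>)
  qed
  show "finite {xs \<in> partitions n. \<forall>j\<in>{1..k}. part xs j = l j \<and> dual_part xs j = l' j}"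
    using finite_partitions by simp
  show "frame ` ?X \<subseteq> {xs \<in> partitions n. \<forall>j\<in>{1..k}. part xs j = l j \<and> dual_part xs j = l' j}"
  proof safe
    fix xs assume xs: "xs \<in> box (l k - k) (l' k - k)" "N = sum_list xs"
    have "0 < frame_part k l l' xs j" if j: "1 \<le> j" "j \<le> l' 1" for j
    proof (cases "j \<le> k")
      case True
      with l(1)[of j k] j l(2) k show ?thesis by (simp add: frame_part_def)
    next
      case False
      have "1 \<in> {i\<in>{1..k}. j \<le> l' i}" using j k by simp
      moreover have "finite {i\<in>{1..k}. j \<le> l' i}" by simp
      ultimately have "card {i\<in>{1..k}. j \<le> l' i} > 0"
        by (subst card_gt_0_iff) blast
      with False show ?thesis by (simp add: frame_part_def)
    qed
    moreover have "sorted_wrt (\<ge>) (frame xs)"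
      unfolding frame_def sorted_wrt_iff_nth_less
      using frame_part_mono[OF xs(1)] by (auto simp del: upt_Suc)
    moreover have "sum_list (frame xs) = n"
      using sum_list_frame[OF xs(1)] N xs(2) by simp
    ultimately show "frame xs \<in> partitions n"
      by (auto simp: partitions_def frame_def simp del: upt_Suc)
    fix j assume j: "j \<in> {1..k}"
    then show "part (frame xs) j = l j"
      using part_frame[OF xs(1), of j] by (simp add: frame_part_def)
    show "dual_part (frame xs) j = l' j"
      using dual_part_frame[OF xs(1) j] .
  qed
qed

end

section \<open>The generating function off the real axis\<close>

text \<open>A weak form of Jordan's inequality. Up to pi/3 the derivative cos u - 1/2 is
  nonnegative; from there to pi/2 the sine is at least sqrt 3 / 2 > 0.8, while u/2 <= pi/4 <
  0.8.\<close>

lemma half_le_sin: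
  fixes u :: real
  assumes "0 \<le> u" "u \<le> pi / 2"
  shows "u / 2 \<le> sin u"
proof (cases "u \<le> pi / 3")
  case True
  have "sin 0 - 0 / 2 \<le> sin u - u / 2"
  proof (rule DERIV_nonneg_imp_nondecreasing[of 0 u "\<lambda>u. sin u - u / 2"])
    fix y assume y: "0 \<le> y" "y \<le> u"
    have "cos (pi / 3) \<le> cos y"
      using y True by (intro cos_monotone_0_pi_le) auto
    then have "0 \<le> cos y - 1 / 2" by (simp add: cos_60)
    moreover have "((\<lambda>u. sin u - u / 2) has_real_derivative cos y - 1 / 2) (at y)"
      by (auto intro!: derivative_eq_intros)
    ultimately show "\<exists>d. ((\<lambda>u. sin u - u / 2) has_real_derivative d) (at y) \<and> 0 \<le> d"
      by blast
  qed (use assms in simp)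
  then show ?thesis by simp
next
  case False
  have "sin (pi / 3) \<le> sin u"
    using False assms by (intro sin_monotone_2pi_le) auto
  moreover have "sqrt 3 \<ge> 1.7" by (rule real_le_rsqrt) (simp add: power2_eq_square)
  moreover have "pi < 3.2" using pi_approx by simp
  ultimately show ?thesis using assms by (simp add: sin_60)
qed

lemma one_minus_cos_ge:
  fixes t :: real
  assumes "\<bar>t\<bar> \<le> pi"
  shows "t\<^sup>2 / 8 \<le> 1 - cos t"
proof -
  have "\<bar>t\<bar> / 2 / 2 \<le> sin (\<bar>t\<bar> / 2)"
    by (rule half_le_sin) (use assms in auto)
  then have "(\<bar>t\<bar> / 4)\<^sup>2 \<le> (sin (\<bar>t\<bar> / 2))\<^sup>2"
    by (intro power_mono) auto
  moreover have "cos t = 1 - 2 * (sin (\<bar>t\<bar> / 2))\<^sup>2"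
    using cos_double_sin[of "\<bar>t\<bar> / 2"] by simp
  ultimately show ?thesis by (simp add: power_divide)
qed

lemma norm_one_minus_cis:
  "(cmod (1 - complex_of_real p * cis \<theta>))\<^sup>2 = (1 - p)\<^sup>2 + 2 * p * (1 - cos \<theta>)"
proof -
  have "(cmod (1 - complex_of_real p * cis \<theta>))\<^sup>2 = (1 - p * cos \<theta>)\<^sup>2 + (p * sin \<theta>)\<^sup>2"
    by (simp add: cmod_power2)
  also have "\<dots> = 1 - 2 * p * cos \<theta> + p\<^sup>2 * ((sin \<theta>)\<^sup>2 + (cos \<theta>)\<^sup>2)"
    by (simp only: power2_eq_square) (simp only: algebra_simps)
  also have "\<dots> = (1 - p)\<^sup>2 + 2 * p * (1 - cos \<theta>)"
    by (simp add: power2_eq_square algebra_simps)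
  finally show ?thesis .
qed

lemma one_minus_cis_nonzero:
  assumes "0 < p" "p < 1"
  shows "1 - complex_of_real p * cis \<theta> \<noteq> 0"
proof -
  have "(1 - p)\<^sup>2 + 2 * p * (1 - cos \<theta>) > 0"
    using assms by (intro add_pos_nonneg) auto
  then show ?thesis using norm_one_minus_cis[of p \<theta>] by auto
qed

lemma norm_one_minus_cis_ge:
  assumes "0 \<le> p" "p \<le> 1"
  shows "1 - p \<le> cmod (1 - complex_of_real p * cis \<theta>)"
proof -
  have "cmod (complex_of_real p * cis \<theta>) = p" using assms by (simp add: norm_mult)
  with norm_triangle_ineq2[of 1 "complex_of_real p * cis \<theta>"] show ?thesis by simp
qed

text \<open>The square of the modulus is at most 1/(1 + y) with y = 2 p (1 - cos \<theta>), and y <=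
  4 allows exp(y/4) <= 1 + y. The exponent is linear in p (1 - cos \<theta>), so that a product of
  factors leads to the sum in \<open>sum_one_minus_cos_ge\<close>.\<close>

lemma norm_euler_factor_le:
  assumes p: "0 < p" "p < 1"
  shows "cmod ((1 - of_real p) / (1 - of_real p * cis \<theta>)) \<le> exp (- (p * (1 - cos \<theta>) / 4))"
proof (rule power2_le_imp_le)
  let ?y = "2 * p * (1 - cos \<theta>)"
  have y: "0 \<le> ?y" "?y \<le> 4"
  proof -
    have "p * (1 - cos \<theta>) \<le> 1 * 2"
      using p cos_ge_minus_one[of \<theta>] by (intro mult_mono) auto
    then show "?y \<le> 4" by simp
  qed (use p in auto)
  have "exp (?y / 4) \<le> 1 + ?y / 4 + (?y / 4)\<^sup>2"
    using y by (intro exp_bound) auto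
  also have "(?y / 4)\<^sup>2 \<le> ?y / 4"
    using y mult_right_mono[of "?y / 4" 1 "?y / 4"] by (simp add: power2_eq_square)
  finally have e: "exp (?y / 4) \<le> 1 + ?y" using y by simp
  have p2: "(1 - p)\<^sup>2 \<le> 1" using p by (simp add: power_le_one)
  have "(1 - p)\<^sup>2 * exp (?y / 4) \<le> (1 - p)\<^sup>2 * (1 + ?y)"
    using e by (intro mult_left_mono) auto
  also have "\<dots> \<le> (1 - p)\<^sup>2 + ?y"
    using mult_right_mono[OF p2 y(1)] by (simp add: algebra_simps)
  finally have *: "(1 - p)\<^sup>2 * exp (?y / 4) \<le> (1 - p)\<^sup>2 + ?y" .
  have pos: "(1 - p)\<^sup>2 + ?y > 0" using p y by (intro add_pos_nonneg) auto
  have "(cmod (1 - of_real p))\<^sup>2 = (1 - p)\<^sup>2"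
    using norm_one_minus_cis[of p 0] by simp
  then have "(cmod ((1 - of_real p) / (1 - of_real p * cis \<theta>)))\<^sup>2 = (1 - p)\<^sup>2 / ((1 - p)\<^sup>2 + ?y)"
    by (simp add: norm_divide power_divide norm_one_minus_cis)
  also have "\<dots> \<le> exp (- (?y / 4))"
    using * pos by (simp add: exp_minus field_simps)
  also have "exp (- (?y / 4)) = (exp (- (p * (1 - cos \<theta>) / 4)))\<^sup>2"
    by (simp add: exp_double[symmetric])
  finally show "(cmod ((1 - of_real p) / (1 - of_real p * cis \<theta>)))\<^sup>2
      \<le> (exp (- (p * (1 - cos \<theta>) / 4)))\<^sup>2" .
qed simp

definition qp :: "real \<Rightarrow> nat \<Rightarrow> real" where
  "qp x j = exp (- (x * real j))"

lemma qp_pos: "0 < qp x j"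
  and qp_lt_1: "0 < x \<Longrightarrow> 0 < j \<Longrightarrow> qp x j < 1"
  and qp_le_1: "0 \<le> x \<Longrightarrow> qp x j \<le> 1"
  and qp_0: "qp x 0 = 1"
  by (simp_all add: qp_def)

lemma qp_add: "qp x (i + j) = qp x i * qp x j"
  by (simp add: qp_def algebra_simps flip: exp_add)

lemma qp_mult: "qp x (i * j) = qp x i ^ j"
  by (simp add: qp_def flip: exp_of_nat_mult)

lemma qp_power: "qp x j = exp (- x) ^ j"
  by (simp add: qp_def flip: exp_of_nat_mult)

lemma qp_antimono: "0 \<le> x \<Longrightarrow> i \<le> j \<Longrightarrow> qp x j \<le> qp x i"
  by (simp add: qp_def mult_left_mono)

lemma qp_cis_power: "complex_of_real (qp x j) * cis (real j * t) = (of_real (exp (- x)) * cis t) ^ j"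
proof -
  have "cis (real j * t) = cis t ^ j" by (rule Complex.DeMoivre[symmetric])
  then show ?thesis by (simp only: qp_power power_mult_distrib of_real_power)
qed

lemma sum_powers_from_1:
  fixes z :: "'a :: field"
  assumes "z \<noteq> 1"
  shows "(\<Sum>j=1..n. z ^ j) = z * (1 - z ^ n) / (1 - z)"
proof -
  have "(1 - z) * (\<Sum>j=1..n. z ^ j) = z * (1 - z ^ n)"
  proof (induction n)
    case (Suc n)
    have "(1 - z) * (\<Sum>j=1..Suc n. z ^ j) = (1 - z) * (\<Sum>j=1..n. z ^ j) + (1 - z) * z ^ Suc n"
      by (simp add: distrib_left)
    also have "\<dots> = z * (1 - z ^ Suc n)"
      unfolding Suc by (simp add: algebra_simps)
    finally show ?case .
  qed simp
  then show ?thesis using assms by (simp add: eq_divide_eq mult.commute)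
qed

lemma exp_minus_bounds:
  fixes x :: real
  assumes "0 < x" "x \<le> 1 / 2"
  shows "1 / 2 \<le> exp (- x)" "1 - exp (- x) \<le> x" "x / 2 \<le> 1 - exp (- x)" "exp (- x) < 1"
proof -
  have "1 + - x \<le> exp (- x)" by (rule exp_ge_add_one_self)
  then show "1 / 2 \<le> exp (- x)" "1 - exp (- x) \<le> x" using assms by auto
  have "exp x \<ge> 1 + x" by (rule exp_ge_add_one_self)
  then have "exp (- x) \<le> 1 / (1 + x)" using assms
    by (simp add: exp_minus field_simps)
  also have "\<dots> \<le> 1 - x / 2" using assms by (simp add: field_simps)
  finally show "x / 2 \<le> 1 - exp (- x)" by simp
  show "exp (- x) < 1" using assms by simp
qed

text \<open>With z = q cis t, the sum is that of q^j minus the real part of that of z^j. Up to the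
  truncation at n the first is q/d with d = 1 - q and the second at most q/|1 - z|, and |1 - z|^2 >=
  d^2 (1 + y) makes the second smaller by a factor 1 - y/3. The subtracted 1 pays for the
  truncation.\<close>

lemma sum_one_minus_cos_ge:
  fixes x t :: real
  assumes x: "0 < x" "x \<le> 1 / 2" and t: "\<bar>t\<bar> \<le> pi"
    and n: "4 * qp x n \<le> x"
  shows "min 1 ((t / x)\<^sup>2) / (48 * x) - 1 \<le> (\<Sum>j=1..n. qp x j * (1 - cos (real j * t)))"
proof -
  define q where "q = exp (- x)"
  define z where "z = of_real q * cis t"
  define d where "d = 1 - q"
  define y where "y = min 1 ((t / x)\<^sup>2) / 8"
  note q = exp_minus_bounds[OF x, folded q_def]
  have d: "0 < d" "d \<le> x" "x / 2 \<le> d" using q x by (auto simp: d_def)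
  have y: "0 \<le> y" "y \<le> 1 / 8" by (auto simp: y_def)
  have q0: "0 < q" by (simp add: q_def)
  have z1: "z \<noteq> 1" using one_minus_cis_nonzero[of q t] q q0 by (auto simp: z_def)
  have "d\<^sup>2 * y \<le> x\<^sup>2 * ((t / x)\<^sup>2 / 8)"
    using d y by (intro mult_mono power_mono) (auto simp: y_def)
  also have "\<dots> = t\<^sup>2 / 8" using x by (simp add: power_divide)
  also have "\<dots> \<le> 1 - cos t" using one_minus_cos_ge[OF t] .
  also have "\<dots> \<le> 2 * q * (1 - cos t)"
    using mult_right_mono[of 1 "2 * q" "1 - cos t"] q by simp
  finally have "d\<^sup>2 * (1 + y) \<le> (cmod (1 - z))\<^sup>2"
    unfolding z_def norm_one_minus_cis by (simp add: d_def algebra_simps)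
  \<comment> \<open>This is 1/sqrt(1 + y) <= 1 - y/3, which the range y <= 1/8 permits.\<close>
  moreover have "1 \<le> (1 - y / 3)\<^sup>2 * (1 + y)"
  proof -
    have "(1 - y / 3)\<^sup>2 * (1 + y) = 1 + y * (1 / 3 - y * 5 / 9 + y * y / 9)"
      by (simp add: power2_eq_square field_simps)
    moreover have "0 \<le> y * (1 / 3 - y * 5 / 9 + y * y / 9)"
      using y by (intro mult_nonneg_nonneg add_nonneg_nonneg) auto
    ultimately show ?thesis by simp
  qed
  ultimately have "d\<^sup>2 \<le> (1 - y / 3)\<^sup>2 * (cmod (1 - z))\<^sup>2"
    using mult_left_mono[of 1 "(1 - y / 3)\<^sup>2 * (1 + y)" "d\<^sup>2"]
      mult_left_mono[of "d\<^sup>2 * (1 + y)" "(cmod (1 - z))\<^sup>2" "(1 - y / 3)\<^sup>2"]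
    by (simp add: algebra_simps)
  then have "d \<le> (1 - y / 3) * cmod (1 - z)"
    unfolding power_mult_distrib[symmetric]
    by (rule power2_le_imp_le) (use y in \<open>intro mult_nonneg_nonneg; simp\<close>)
  then have inv: "1 / cmod (1 - z) \<le> (1 - y / 3) / d"
    using d z1 by (simp add: field_simps)
  have split: "(\<Sum>j=1..n. qp x j * (1 - cos (real j * t)))
      = (\<Sum>j=1..n. q ^ j) - Re (\<Sum>j=1..n. z ^ j)"
  proof -
    have "qp x j * cos (real j * t) = Re (z ^ j)" for j
      unfolding z_def q_def qp_cis_power[symmetric] by simp
    then show ?thesis
      by (simp add: right_diff_distrib sum_subtractf qp_power q_def)
  qed
  have sum_q: "(\<Sum>j=1..n. q ^ j) = q * (1 - q ^ n) / d"
    unfolding d_def by (rule sum_powers_from_1) (use q in auto)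
  have "Re (\<Sum>j=1..n. z ^ j) \<le> cmod (z * (1 - z ^ n) / (1 - z))"
    unfolding sum_powers_from_1[OF z1] by (rule complex_Re_le_cmod)
  also have "\<dots> = q * cmod (1 - z ^ n) * (1 / cmod (1 - z))"
    using q0 by (simp add: norm_mult norm_divide z_def)
  also have "\<dots> \<le> q * (1 + q ^ n) * ((1 - y / 3) / d)"
  proof (intro mult_mono mult_left_mono inv)
    have "cmod (1 - z ^ n) \<le> 1 + cmod (z ^ n)"
      using norm_triangle_ineq4[of 1 "z ^ n"] by simp
    also have "cmod (z ^ n) = q ^ n"
      using q0 by (simp add: z_def norm_power norm_mult)
    finally show "cmod (1 - z ^ n) \<le> 1 + q ^ n" .
  qed (use q0 y d in auto)
  finally have "q * (1 - q ^ n) / d - q * (1 + q ^ n) * ((1 - y / 3) / d)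
      \<le> (\<Sum>j=1..n. qp x j * (1 - cos (real j * t)))"
    unfolding split sum_q by (rule diff_left_mono)
  moreover have "q * (1 - q ^ n) / d - q * (1 + q ^ n) * ((1 - y / 3) / d)
      = q / d * (y / 3) - q * q ^ n / d * (2 - y / 3)"
    using d by (simp add: field_simps)
  moreover have "q * q ^ n / d * (2 - y / 3) \<le> 1"
  proof -
    have "q * q ^ n / d * (2 - y / 3) \<le> 1 * q ^ n / (x / 2) * 2"
      using q0 q d y x by (intro mult_mono frac_le) auto
    also have "\<dots> \<le> 1" using n x by (simp add: qp_power q_def field_simps)
    finally show ?thesis .
  qed
  moreover have "(1 / 2) / x * (y / 3) \<le> q / d * (y / 3)"
    using q d y x by (intro mult_mono frac_le) auto
  ultimately show ?thesis by (simp add: y_def)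
qed

text \<open>The characteristic function of the sum of all j G_j for independent geometric G_j with
  P(G_j = m) = (1 - q^j) q^(j m), that is, of the size of a random partition with parts at most n
  and probability proportional to q^size.\<close>

definition euler_char :: "nat \<Rightarrow> real \<Rightarrow> real \<Rightarrow> complex" where
  "euler_char n x t =
     (\<Prod>j=1..n. (1 - of_real (qp x j)) / (1 - of_real (qp x j) * cis (real j * t)))"

text \<open>Two regimes: Gaussian decay at scale x^(3/2) for |t| <= x, and the constant exp(-1/(192
  x)) beyond. The factor 2 bounds exp(1/4), the price of the subtracted 1 in
  \<open>sum_one_minus_cos_ge\<close>.\<close>

lemma norm_euler_char_le:
  fixes x t :: real
  assumes x: "0 < x" "x \<le> 1 / 2" and t: "\<bar>t\<bar> \<le> pi" and n: "4 * qp x n \<le> x"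
  shows "cmod (euler_char n x t) \<le> 2 * exp (- (min 1 ((t / x)\<^sup>2) / (192 * x)))"
proof -
  have "cmod (euler_char n x t) \<le> (\<Prod>j=1..n. exp (- (qp x j * (1 - cos (real j * t)) / 4)))"
    unfolding euler_char_def prod_norm[symmetric]
    using x by (intro prod_mono conjI norm_euler_factor_le qp_pos qp_lt_1) auto
  also have "\<dots> = exp (- ((\<Sum>j=1..n. qp x j * (1 - cos (real j * t))) / 4))"
    by (simp add: exp_sum[symmetric] sum_negf sum_divide_distrib)
  also have "\<dots> \<le> exp (1 / 4 + - (min 1 ((t / x)\<^sup>2) / (192 * x)))"
    using sum_one_minus_cos_ge[OF assms] by simp
  also have "\<dots> = exp (1 / 4) * exp (- (min 1 ((t / x)\<^sup>2) / (192 * x)))"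
    by (rule exp_add)
  also have "\<dots> \<le> 2 * exp (- (min 1 ((t / x)\<^sup>2) / (192 * x)))"
    using exp_bound_half[of "1/4 :: real"] by (intro mult_right_mono) auto
  finally show ?thesis .
qed

section \<open>Saddle point estimates\<close>

lemma le_exp: "y \<le> exp (y :: real)"
  using exp_ge_add_one_self[of y] by linarith

text \<open>x = c / sqrt n, the parameter for which the expected size \<open>mean_size n x\<close>
  agrees with n up to O(1/x). The upper bound on x makes n large enough for the numerical
  estimates.\<close>

definition saddle :: "nat \<Rightarrow> real \<Rightarrow> bool" where
  "saddle n x \<longleftrightarrow> 0 < x \<and> x \<le> 1 / 100 \<and> real n * x\<^sup>2 = pi\<^sup>2 / 6"

lemma pi_squared_bounds: "9 \<le> pi\<^sup>2" "pi\<^sup>2 \<le> 10"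
proof -
  have "3\<^sup>2 \<le> pi\<^sup>2" using pi_gt3 by (intro power_mono) auto
  then show "9 \<le> pi\<^sup>2" by simp
  have "pi\<^sup>2 \<le> 3.15\<^sup>2" using pi_approx by (intro power_mono) auto
  then show "pi\<^sup>2 \<le> 10" by (simp add: power2_eq_square)
qed

lemma saddleD:
  assumes "saddle n x"
  shows "0 < x" "x \<le> 1 / 100" "x \<le> 1 / 2" "real n = pi\<^sup>2 / (6 * x\<^sup>2)" "1 / x \<le> x * real n"
    "real n \<le> 2 / x\<^sup>2" "1 / x\<^sup>2 \<le> real n"
proof -
  show x: "0 < x" "x \<le> 1 / 100" "x \<le> 1 / 2" using assms by (auto simp: saddle_def)
  show n: "real n = pi\<^sup>2 / (6 * x\<^sup>2)" using assms by (simp add: saddle_def field_simps)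
  show "1 / x \<le> x * real n"
    using x pi_squared_bounds unfolding n by (simp add: power2_eq_square field_simps)
  show "real n \<le> 2 / x\<^sup>2" "1 / x\<^sup>2 \<le> real n"
    using x pi_squared_bounds unfolding n by (simp_all add: field_simps)
qed

text \<open>n x >= 1/x, so q^n <= exp(-1/x) is below every power of x up to constants. A fourth
  power is enough against the polynomial factors that q^n meets later.\<close>

lemma saddle_qp_n_le:
  assumes "saddle n x"
  shows "qp x n \<le> 256 * x ^ 4"
proof -
  note x = saddleD[OF assms]
  have "qp x n \<le> exp (- (1 / x))"
    using x by (simp add: qp_def)
  moreover have "(1 / (4 * x)) ^ 4 \<le> exp (1 / x)"
  proof -
    have "1 / (4 * x) \<le> exp (1 / (4 * x))"
      by (rule le_exp)
    then have "(1 / (4 * x)) ^ 4 \<le> exp (1 / (4 * x)) ^ 4"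
      using x by (intro power_mono) auto
    also have "\<dots> = exp (1 / x)" by (simp flip: exp_of_nat_mult)
    finally show ?thesis .
  qed
  moreover have "inverse (exp (1 / x)) \<le> inverse ((1 / (4 * x)) ^ 4)"
    using calculation(2) x by (intro le_imp_inverse_le) auto
  ultimately show ?thesis
    by (simp add: exp_minus power_divide power_mult_distrib)
qed

lemma saddle_qp_n_le':
  assumes "saddle n x"
  shows "4 * qp x n \<le> x"
proof -
  note x = saddleD[OF assms]
  have "x ^ 3 \<le> (1 / 100) ^ 3" using x by (intro power_mono) auto
  then have "1024 * x ^ 3 \<le> 1" by (simp add: power3_eq_cube)
  then have "1024 * x ^ 3 * x \<le> 1 * x" using x by (intro mult_right_mono) auto
  then have "1024 * x ^ 4 \<le> x" by (simp add: power3_eq_cube power4_eq_xxxx mult.assoc)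
  with saddle_qp_n_le[OF assms] show ?thesis by linarith
qed

text \<open>The summands are the constants of \<open>euler_char_dom_near\<close> and
  \<open>euler_char_dom_far\<close>.\<close>

definition dom_const :: real where
  "dom_const = 2 * exp 96 * 768 ^ 2 + 242 * 2400 ^ 6"

lemma dom_const_pos: "0 < dom_const"
  by (simp add: dom_const_def add_pos_pos)

text \<open>The Gaussian exp(-w/192), w = t^2/x^3, is spent in two halves: one absorbs exp(A |t|),
  the growth of the perturbing factor, the other (1 + w)^2. The majorant is rational so that its
  integral, even after multiplication by t^2, reduces to an arctangent.\<close>

lemma euler_char_dom_near:
  assumes s: "saddle n x" and t: "\<bar>t\<bar> \<le> x" and A: "0 \<le> A" "A\<^sup>2 * x ^ 3 \<le> 1"
  shows "cmod (euler_char n x t) * exp (A * \<bar>t\<bar>) \<le> dom_const / (1 + t\<^sup>2 / x ^ 3)\<^sup>2"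
proof -
  note x = saddleD[OF s]
  define w where "w = t\<^sup>2 / x ^ 3"
  have w: "0 \<le> w" using x by (simp add: w_def)
  have "\<bar>t\<bar> \<le> pi" using t x pi_gt3 by linarith
  from norm_euler_char_le[OF x(1,3) this saddle_qp_n_le'[OF s]]
  have "cmod (euler_char n x t) \<le> 2 * exp (- (min 1 ((t / x)\<^sup>2) / (192 * x)))" .
  also have "min 1 ((t / x)\<^sup>2) = (t / x)\<^sup>2"
    using t x by (intro min_absorb2) (simp add: power2_le_iff_abs_le abs_square_le_1)
  also have "(t / x)\<^sup>2 / (192 * x) = w / 192"
    by (simp add: w_def power_divide power2_eq_square power3_eq_cube)
  finally have 1: "cmod (euler_char n x t) \<le> 2 * exp (- (w / 192))" .
  have "(A * \<bar>t\<bar>)\<^sup>2 \<le> w"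
    using mult_right_mono[OF A(2), of "t\<^sup>2"] x by (simp add: w_def power_mult_distrib field_simps)
  \<comment> \<open>Completing the square: 384 A |t| <= (A t)^2 + 192^2, and 192^2 / 384 =
    96.\<close>
  moreover have "0 \<le> (A * \<bar>t\<bar> - 192)\<^sup>2" by simp
  ultimately have 2: "A * \<bar>t\<bar> \<le> w / 384 + 96"
    by (simp add: power2_eq_square algebra_simps)
  have "1 + w \<le> 768 * (1 + w / 768)" by simp
  also have "\<dots> \<le> 768 * exp (w / 768)"
    by (intro mult_left_mono exp_ge_add_one_self) auto
  finally have "(1 + w)\<^sup>2 \<le> (768 * exp (w / 768))\<^sup>2"
    using w by (intro power_mono) auto
  also have "\<dots> = 768\<^sup>2 * exp (w / 384)"
    by (simp add: power_mult_distrib exp_double[symmetric])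
  finally have 3: "(1 + w)\<^sup>2 \<le> 768\<^sup>2 * exp (w / 384)" .
  have "cmod (euler_char n x t) * exp (A * \<bar>t\<bar>) * (1 + w)\<^sup>2
      \<le> 2 * exp (- (w / 192)) * exp (w / 384 + 96) * (768\<^sup>2 * exp (w / 384))"
    using 1 2 3 by (intro mult_mono) auto
  also have "\<dots> = 2 * 768\<^sup>2 * (exp (- (w / 192)) * exp (w / 384 + 96) * exp (w / 384))"
    by (simp only: mult_ac)
  also have "exp (- (w / 192)) * exp (w / 384 + 96) * exp (w / 384) = exp 96"
    unfolding exp_add[symmetric] by simp
  also have "2 * 768\<^sup>2 * exp 96 \<le> dom_const" by (simp add: dom_const_def)
  finally show ?thesis
    using w by (simp add: w_def[symmetric] pos_le_divide_eq add_pos_nonneg)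
qed

text \<open>1/192 exceeds 2/400: the decay pays once for the factor exp(1/(400 x)) allowed to the
  perturbation, and once more for (1 + w)^2 <= 121 x^(-6).\<close>

lemma euler_char_dom_far:
  assumes s: "saddle n x" and t: "x \<le> \<bar>t\<bar>" "\<bar>t\<bar> \<le> pi"
  shows "cmod (euler_char n x t) * exp (1 / (400 * x)) \<le> dom_const / (1 + t\<^sup>2 / x ^ 3)\<^sup>2"
proof -
  note x = saddleD[OF s]
  define w where "w = t\<^sup>2 / x ^ 3"
  have w: "0 \<le> w" using x by (simp add: w_def)
  have "1 \<le> (\<bar>t\<bar> / x)\<^sup>2" using t x by (intro one_le_power) simp
  then have "min 1 ((t / x)\<^sup>2) = 1" by (simp add: power_divide)
  with norm_euler_char_le[OF x(1,3) t(2) saddle_qp_n_le'[OF s]]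
  have 1: "cmod (euler_char n x t) \<le> 2 * exp (- (1 / (192 * x)))" by simp
  have "t\<^sup>2 \<le> pi\<^sup>2" using t by (simp add: abs_le_square_iff[symmetric])
  then have "t\<^sup>2 \<le> 10" using pi_squared_bounds by linarith
  then have "w \<le> 10 / x ^ 3" using x by (simp add: w_def divide_right_mono)
  moreover have "1 \<le> 1 / x ^ 3" using x by (simp add: power_le_one)
  ultimately have "1 + w \<le> 11 / x ^ 3" by simp
  then have "(1 + w)\<^sup>2 \<le> (11 / x ^ 3)\<^sup>2" using w by (intro power_mono) auto
  also have "\<dots> = 121 * (1 / x) ^ 6" by (simp add: power_divide flip: power_mult)
  also have "\<dots> \<le> 121 * (2400 ^ 6 * exp (1 / (400 * x)))"
  proof -
    have "1 / (2400 * x) \<le> exp (1 / (2400 * x))"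
      by (rule le_exp)
    then have "(1 / (2400 * x)) ^ 6 \<le> exp (1 / (2400 * x)) ^ 6"
      using x by (intro power_mono) auto
    also have "\<dots> = exp (1 / (400 * x))" by (simp flip: exp_of_nat_mult)
    finally show ?thesis by (simp add: power_divide power_mult_distrib field_simps)
  qed
  finally have 2: "(1 + w)\<^sup>2 \<le> 121 * (2400 ^ 6 * exp (1 / (400 * x)))" .
  have "cmod (euler_char n x t) * exp (1 / (400 * x)) * (1 + w)\<^sup>2
      \<le> 2 * exp (- (1 / (192 * x))) * exp (1 / (400 * x)) * (121 * (2400 ^ 6 * exp (1 / (400 * x))))"
    using 1 2 by (intro mult_mono) auto
  also have "\<dots> = 242 * 2400 ^ 6 * (exp (- (1 / (192 * x))) * exp (1 / (400 * x)) * exp (1 / (400 * x)))"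
    by (simp add: mult_ac)
  also have "exp (- (1 / (192 * x))) * exp (1 / (400 * x)) * exp (1 / (400 * x)) \<le> 1"
    unfolding exp_add[symmetric] using x by (simp add: field_simps)
  also have "242 * 2400 ^ 6 * 1 \<le> dom_const" by (simp add: dom_const_def)
  finally have "cmod (euler_char n x t) * exp (1 / (400 * x)) * (1 + w)\<^sup>2 \<le> dom_const"
    by simp
  then show ?thesis
    using w by (simp add: w_def[symmetric] pos_le_divide_eq add_pos_nonneg)
qed

lemma euler_char_dom:
  assumes s: "saddle n x" and t: "\<bar>t\<bar> \<le> pi"
  shows "cmod (euler_char n x t) \<le> dom_const / (1 + t\<^sup>2 / x ^ 3)\<^sup>2"
proof (cases "\<bar>t\<bar> \<le> x")
  case True
  from euler_char_dom_near[OF s True, of 0] show ?thesis by simp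
next
  case False
  have "cmod (euler_char n x t) * 1 \<le> cmod (euler_char n x t) * exp (1 / (400 * x))"
    using saddleD(1)[OF s] by (intro mult_left_mono) auto
  with euler_char_dom_far[OF s _ t] False show ?thesis by simp
qed

section \<open>Integrals against the dominating function\<close>

lemma lorentz_integral:
  assumes c: "0 < (c::real)" and "0 \<le> r"
  shows "((\<lambda>t. 1 / (1 + t\<^sup>2 / c\<^sup>2)) has_integral 2 * c * arctan (r / c)) {-r..r}"
proof -
  have "((\<lambda>t. 1 / (1 + t\<^sup>2 / c\<^sup>2)) has_integral c * arctan (r / c) - c * arctan (- r / c)) {-r..r}"
  proof (rule fundamental_theorem_of_calculus)
    fix t :: real
    have "((\<lambda>t. c * arctan (t / c)) has_real_derivative c * (inverse (1 + (t / c)\<^sup>2) * (1 / c)))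
        (at t within {-r..r})"
      using c by (auto intro!: derivative_eq_intros)
    then show "((\<lambda>t. c * arctan (t / c)) has_vector_derivative 1 / (1 + t\<^sup>2 / c\<^sup>2))
        (at t within {-r..r})"
      using c by (simp add: has_real_derivative_iff_has_vector_derivative power_divide inverse_eq_divide)
  qed (use assms in simp)
  then show ?thesis by (simp add: arctan_minus mult.assoc)
qed

lemma lorentz_integral_le:
  assumes "0 < x"
  shows "integral {-pi..pi} (\<lambda>t. 1 / (1 + t\<^sup>2 / x ^ 3)) \<le> 4 * sqrt (x ^ 3)"
    "(\<lambda>t. 1 / (1 + t\<^sup>2 / x ^ 3)) integrable_on {-pi..pi}"
proof -
  have "sqrt (x ^ 3) > 0" using assms by simp
  from lorentz_integral[OF this, of pi]
  have *: "((\<lambda>t. 1 / (1 + t\<^sup>2 / x ^ 3)) has_integral 2 * sqrt (x ^ 3) * arctan (pi / sqrt (x ^ 3))) {-pi..pi}"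
    using assms by simp
  then show "(\<lambda>t. 1 / (1 + t\<^sup>2 / x ^ 3)) integrable_on {-pi..pi}" by blast
  have "arctan (pi / sqrt (x ^ 3)) \<le> 2"
    using arctan_ubound[of "pi / sqrt (x ^ 3)"] pi_less_4 by linarith
  then have "2 * sqrt (x ^ 3) * arctan (pi / sqrt (x ^ 3)) \<le> 2 * sqrt (x ^ 3) * 2"
    using assms by (intro mult_left_mono) auto
  then show "integral {-pi..pi} (\<lambda>t. 1 / (1 + t\<^sup>2 / x ^ 3)) \<le> 4 * sqrt (x ^ 3)"
    using integral_unique[OF *] by simp
qed

lemma norm_integral_dom0:
  fixes f :: "real \<Rightarrow> complex"
  assumes x: "0 < x" and f: "f integrable_on {-pi..pi}"
    and le: "\<And>t. \<bar>t\<bar> \<le> pi \<Longrightarrow> cmod (f t) \<le> C * (dom_const / (1 + t\<^sup>2 / x ^ 3)\<^sup>2)"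
    and C: "0 \<le> C"
  shows "cmod (integral {-pi..pi} f) \<le> 4 * C * dom_const * sqrt (x ^ 3)"
proof -
  have "cmod (integral {-pi..pi} f) \<le> integral {-pi..pi} (\<lambda>t. C * dom_const * (1 / (1 + t\<^sup>2 / x ^ 3)))"
  proof (rule integral_norm_bound_integral[OF f])
    show "(\<lambda>t. C * dom_const * (1 / (1 + t\<^sup>2 / x ^ 3))) integrable_on {-pi..pi}"
      using lorentz_integral_le(2)[OF x] by (rule integrable_on_mult_right)
    fix t assume t: "t \<in> {-pi..pi}"
    define u where "u = 1 + t\<^sup>2 / x ^ 3"
    have u: "1 \<le> u" using x by (simp add: u_def)
    have "1 / u\<^sup>2 \<le> 1 / u" using u by (simp add: power2_eq_square field_simps)
    then have "C * dom_const * (1 / u\<^sup>2) \<le> C * dom_const * (1 / u)"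
      using C dom_const_pos by (intro mult_left_mono) auto
    moreover have "\<bar>t\<bar> \<le> pi" using t by auto
    ultimately show "cmod (f t) \<le> C * dom_const * (1 / (1 + t\<^sup>2 / x ^ 3))"
      using le[of t] by (simp add: u_def)
  qed
  also have "\<dots> = C * dom_const * integral {-pi..pi} (\<lambda>t. 1 / (1 + t\<^sup>2 / x ^ 3))"
    by (rule integral_mult_right)
  also have "\<dots> \<le> C * dom_const * (4 * sqrt (x ^ 3))"
    using lorentz_integral_le(1)[OF x] C dom_const_pos by (intro mult_left_mono) auto
  finally show ?thesis by (simp add: mult_ac)
qed

text \<open>t^2 <= x^3 (1 + t^2/x^3) trades a factor t^2 for x^3 and one power of the denominator:
  compared with \<open>norm_integral_dom0\<close>, a second moment contributes x^3.\<close>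

lemma norm_integral_dom2:
  fixes f :: "real \<Rightarrow> complex"
  assumes x: "0 < x" and f: "f integrable_on {-pi..pi}"
    and le: "\<And>t. \<bar>t\<bar> \<le> pi \<Longrightarrow> cmod (f t) \<le> C * t\<^sup>2 * (dom_const / (1 + t\<^sup>2 / x ^ 3)\<^sup>2)"
    and C: "0 \<le> C"
  shows "cmod (integral {-pi..pi} f) \<le> 4 * C * dom_const * x ^ 3 * sqrt (x ^ 3)"
proof -
  have "cmod (integral {-pi..pi} f) \<le> integral {-pi..pi} (\<lambda>t. C * dom_const * x ^ 3 * (1 / (1 + t\<^sup>2 / x ^ 3)))"
  proof (rule integral_norm_bound_integral[OF f])
    show "(\<lambda>t. C * dom_const * x ^ 3 * (1 / (1 + t\<^sup>2 / x ^ 3))) integrable_on {-pi..pi}"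
      using lorentz_integral_le(2)[OF x] by (rule integrable_on_mult_right)
    fix t assume t: "t \<in> {-pi..pi}"
    define u where "u = 1 + t\<^sup>2 / x ^ 3"
    have u: "1 \<le> u" using x by (simp add: u_def)
    have t2: "t\<^sup>2 \<le> x ^ 3 * u" using x by (simp add: u_def field_simps)
    have "t\<^sup>2 * (1 / u\<^sup>2) \<le> x ^ 3 * u * (1 / u\<^sup>2)"
      using t2 by (intro mult_right_mono) auto
    also have "\<dots> = x ^ 3 * (1 / u)" using u by (simp add: power2_eq_square)
    finally have "C * dom_const * (t\<^sup>2 * (1 / u\<^sup>2)) \<le> C * dom_const * (x ^ 3 * (1 / u))"
      using C dom_const_pos by (intro mult_left_mono) auto
    moreover have "\<bar>t\<bar> \<le> pi" using t by auto
    ultimately show "cmod (f t) \<le> C * dom_const * x ^ 3 * (1 / (1 + t\<^sup>2 / x ^ 3))"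
      using le[of t] by (simp add: u_def mult_ac)
  qed
  also have "\<dots> = C * dom_const * x ^ 3 * integral {-pi..pi} (\<lambda>t. 1 / (1 + t\<^sup>2 / x ^ 3))"
    by (rule integral_mult_right)
  also have "\<dots> \<le> C * dom_const * x ^ 3 * (4 * sqrt (x ^ 3))"
    using lorentz_integral_le(1)[OF x] C dom_const_pos x by (intro mult_left_mono) auto
  finally show ?thesis by (simp add: mult_ac)
qed

text \<open>The logarithmic derivative of \<open>euler_char n x\<close> divided by \<i>; at t = 0 it
  is the expected size.\<close>

definition logderiv :: "nat \<Rightarrow> real \<Rightarrow> real \<Rightarrow> complex" where
  "logderiv n x t = (\<Sum>j=1..n. of_nat j * (of_real (qp x j) * cis (real j * t) /
     (1 - of_real (qp x j) * cis (real j * t))))"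

definition mean_size :: "nat \<Rightarrow> real \<Rightarrow> real" where
  "mean_size n x = (\<Sum>j=1..n. real j * qp x j / (1 - qp x j))"

text \<open>The variance of the size whose characteristic function is \<open>euler_char n x\<close>,
  as \<open>mean_size\<close> is its mean.\<close>

definition var_size :: "nat \<Rightarrow> real \<Rightarrow> real" where
  "var_size n x = (\<Sum>j=1..n. (real j)\<^sup>2 * qp x j / (1 - qp x j)\<^sup>2)"

text \<open>The third cumulant without the factors 1 + q^j, which lie between 1 and 2; it bounds the
  quadratic remainder of \<open>logderiv\<close>.\<close>

definition third_size :: "nat \<Rightarrow> real \<Rightarrow> real" where
  "third_size n x = (\<Sum>j=1..n. (real j) ^ 3 * qp x j / (1 - qp x j) ^ 3)"

lemma has_vector_derivative_cis_mult:
  "((\<lambda>t. cis (a * t)) has_vector_derivative \<i> * of_real a * cis (a * t)) (at t within S)"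
proof -
  have "((\<lambda>t. cos (a * t)) has_real_derivative - (a * sin (a * t))) (at t within S)"
    "((\<lambda>t. sin (a * t)) has_real_derivative a * cos (a * t)) (at t within S)"
    by (auto intro!: derivative_eq_intros)
  then have "((\<lambda>t. of_real (cos (a * t)) + \<i> * of_real (sin (a * t))) has_vector_derivative
      of_real (- (a * sin (a * t))) + \<i> * of_real (a * cos (a * t))) (at t within S)"
    by (intro has_vector_derivative_add has_vector_derivative_mult_right
        has_vector_derivative_of_real) (simp_all add: has_real_derivative_iff_has_vector_derivative)
  moreover have "(\<lambda>t. of_real (cos (a * t)) + \<i> * of_real (sin (a * t))) = (\<lambda>t. cis (a * t))"
    by (auto simp: complex_eq_iff)
  moreover have "of_real (- (a * sin (a * t))) + \<i> * of_real (a * cos (a * t)) = \<i> * of_real a * cis (a * t)"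
    by (auto simp: complex_eq_iff)
  ultimately show ?thesis by simp
qed

lemma has_vector_derivative_euler_factor:
  assumes p: "0 < p" "p < 1"
  shows "((\<lambda>t. (1 - of_real p) / (1 - of_real p * cis (a * t))) has_vector_derivative
     \<i> * (of_real a * (of_real p * cis (a * t) / (1 - of_real p * cis (a * t)))) *
       ((1 - of_real p) / (1 - of_real p * cis (a * t)))) (at t)"
proof -
  let ?g = "\<lambda>t. 1 - of_real p * cis (a * t)"
  have g: "(?g has_vector_derivative - (of_real p * (\<i> * of_real a * cis (a * t)))) (at t)"
    by (rule has_vector_derivative_eq_rhs, rule has_vector_derivative_diff[OF has_vector_derivative_const
        has_vector_derivative_mult_right[OF has_vector_derivative_cis_mult]]) simp
  have nz: "?g t \<noteq> 0" using one_minus_cis_nonzero[OF p] by simp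
  have "((\<lambda>z. (1 - of_real p) / z) has_field_derivative - (1 - of_real p) / (?g t)\<^sup>2) (at (?g t))"
    using nz by (auto intro!: derivative_eq_intros simp: power2_eq_square)
  from field_vector_diff_chain_at[OF g this] nz show ?thesis
    by (simp add: o_def power2_eq_square field_simps)
qed

lemma has_vector_derivative_euler_char:
  assumes x: "0 < x"
  shows "(euler_char n x has_vector_derivative \<i> * logderiv n x t * euler_char n x t) (at t)"
proof (induction n)
  case 0
  then show ?case by (simp add: euler_char_def logderiv_def has_vector_derivative_const)
next
  case (Suc n)
  let ?f = "\<lambda>t. (1 - of_real (qp x (Suc n))) / (1 - of_real (qp x (Suc n)) * cis (real (Suc n) * t))"
  let ?h = "\<lambda>t. of_nat (Suc n) * (of_real (qp x (Suc n)) * cis (real (Suc n) * t) /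
     (1 - of_real (qp x (Suc n)) * cis (real (Suc n) * t)))"
  have f: "(?f has_vector_derivative \<i> * ?h t * ?f t) (at t)"
    using has_vector_derivative_euler_factor[OF qp_pos qp_lt_1[OF x], of "Suc n" "real (Suc n)" t]
    by simp
  have "euler_char (Suc n) x = (\<lambda>t. euler_char n x t * ?f t)"
    by (rule ext) (simp add: euler_char_def)
  moreover have "logderiv (Suc n) x t = logderiv n x t + ?h t"
    by (simp add: logderiv_def)
  moreover have "((\<lambda>t. euler_char n x t * ?f t) has_vector_derivative
      euler_char n x t * (\<i> * ?h t * ?f t) + (\<i> * logderiv n x t * euler_char n x t) * ?f t) (at t)"
    by (rule has_vector_derivative_mult[OF Suc f])
  ultimately show ?case by (simp add: algebra_simps)
qed

section \<open>The logarithmic derivative of the generating function\<close>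

lemma norm_cis_approx:
  "cmod (cis \<theta> - 1) \<le> \<bar>\<theta>\<bar>" "cmod (cis \<theta> - 1 - \<i> * of_real \<theta>) \<le> \<theta>\<^sup>2 / 2"
proof -
  show "cmod (cis \<theta> - 1) \<le> \<bar>\<theta>\<bar>"
    using iexp_approx1[of \<theta> 0] by (simp add: cis_conv_exp)
  have "(\<Sum>k\<le>1. (\<i> * complex_of_real \<theta>) ^ k / fact k) = 1 + \<i> * of_real \<theta>" by simp
  moreover have "\<bar>\<theta>\<bar> ^ Suc 1 / fact (Suc 1) = \<theta>\<^sup>2 / 2"
    by (simp add: power2_eq_square)
  ultimately show "cmod (cis \<theta> - 1 - \<i> * of_real \<theta>) \<le> \<theta>\<^sup>2 / 2"
    using iexp_approx1[of \<theta> 1] by (simp only: cis_conv_exp diff_diff_eq)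
qed

text \<open>The remainder is found by algebra in e = cis \<theta> - 1, without derivatives: 1/(1 -
  w) is replaced once by 1/(1 - p), and |1 - w| >= 1 - p keeps the estimate uniform in
  \<theta>.\<close>

lemma geometric_taylor:
  assumes p: "0 < p" "p < 1"
  shows "cmod (of_real p * cis \<theta> / (1 - of_real p * cis \<theta>) - of_real (p / (1 - p))
     - \<i> * of_real (\<theta> * (p / (1 - p)\<^sup>2))) \<le> \<theta>\<^sup>2 * (p / (1 - p) ^ 3)"
proof -
  define w where "w = of_real p * cis \<theta>"
  define e where "e = cis \<theta> - 1"
  define P where "P = complex_of_real p"
  have nz: "1 - w \<noteq> 0" "1 - P \<noteq> 0"
    using one_minus_cis_nonzero[OF p] p by (auto simp: w_def P_def complex_eq_iff)
  have w: "w = P + P * e" by (simp add: w_def e_def P_def algebra_simps)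
  have eq: "w / (1 - w) - P / (1 - P) - \<i> * of_real \<theta> * (P / (1 - P)\<^sup>2)
      = P * (e - \<i> * of_real \<theta>) / (1 - P)\<^sup>2 + (P * e)\<^sup>2 / ((1 - w) * (1 - P)\<^sup>2)"
  proof -
    have "w / (1 - w) - P / (1 - P) = P * e / ((1 - w) * (1 - P))"
      using nz by (simp add: field_simps w)
    also have "\<dots> = P * e / (1 - P)\<^sup>2 + (P * e)\<^sup>2 / ((1 - w) * (1 - P)\<^sup>2)"
    proof -
      have "P * e / (1 - P)\<^sup>2 + (P * e)\<^sup>2 / ((1 - w) * (1 - P)\<^sup>2)
          = (P * e * (1 - w) + (P * e)\<^sup>2) / ((1 - w) * (1 - P)\<^sup>2)"
        using nz by (simp add: add_divide_distrib)
      also have "P * e * (1 - w) + (P * e)\<^sup>2 = P * e * (1 - P)"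
        by (simp add: w power2_eq_square algebra_simps)
      finally show ?thesis using nz by (simp add: power2_eq_square)
    qed
    finally show ?thesis by (simp add: diff_divide_distrib right_diff_distrib mult_ac)
  qed
  have "cmod (P * (e - \<i> * of_real \<theta>) / (1 - P)\<^sup>2) \<le> p * (\<theta>\<^sup>2 / 2) / (1 - p)\<^sup>2"
  proof -
    have "cmod (1 - P) = 1 - p" using p norm_of_real[of "1 - p", where 'a = complex] by (simp add: P_def)
    then have "cmod (P * (e - \<i> * of_real \<theta>) / (1 - P)\<^sup>2) = p * cmod (e - \<i> * of_real \<theta>) / (1 - p)\<^sup>2"
      using p by (simp add: norm_mult norm_divide norm_power P_def)
    also have "\<dots> \<le> p * (\<theta>\<^sup>2 / 2) / (1 - p)\<^sup>2"
      using norm_cis_approx(2)[of \<theta>] p by (intro divide_right_mono mult_left_mono) (auto simp: e_def)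
    finally show ?thesis .
  qed
  moreover have "cmod ((P * e)\<^sup>2 / ((1 - w) * (1 - P)\<^sup>2)) \<le> p\<^sup>2 * \<theta>\<^sup>2 / ((1 - p) * (1 - p)\<^sup>2)"
  proof -
    have P: "cmod (1 - P) = 1 - p" using p norm_of_real[of "1 - p", where 'a = complex] by (simp add: P_def)
    have "cmod ((P * e)\<^sup>2 / ((1 - w) * (1 - P)\<^sup>2)) = p\<^sup>2 * (cmod e)\<^sup>2 / (cmod (1 - w) * (1 - p)\<^sup>2)"
      using p P by (simp add: norm_mult norm_divide norm_power P_def power_mult_distrib)
    also have "\<dots> \<le> p\<^sup>2 * \<theta>\<^sup>2 / ((1 - p) * (1 - p)\<^sup>2)"
    proof (intro frac_le mult_mono)
      have "(cmod e)\<^sup>2 \<le> \<bar>\<theta>\<bar>\<^sup>2"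
        using norm_cis_approx(1)[of \<theta>] by (intro power_mono) (auto simp: e_def)
      then show "(cmod e)\<^sup>2 \<le> \<theta>\<^sup>2" by simp
      show "1 - p \<le> cmod (1 - w)" unfolding w_def by (rule norm_one_minus_cis_ge) (use p in auto)
    qed (use p in auto)
    finally show ?thesis .
  qed
  moreover have "p * (\<theta>\<^sup>2 / 2) / (1 - p)\<^sup>2 + p\<^sup>2 * \<theta>\<^sup>2 / ((1 - p) * (1 - p)\<^sup>2) \<le> \<theta>\<^sup>2 * (p / (1 - p) ^ 3)"
  proof -
    define r where "r = 1 - p"
    have "p * (\<theta>\<^sup>2 / 2) / r\<^sup>2 = \<theta>\<^sup>2 * (p / r ^ 3) * (r / 2)"
      by (simp add: power2_eq_square power3_eq_cube)
    moreover have "p\<^sup>2 * \<theta>\<^sup>2 / (r * r\<^sup>2) = \<theta>\<^sup>2 * (p / r ^ 3) * p"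
      by (simp add: power2_eq_square power3_eq_cube mult_ac)
    ultimately have "p * (\<theta>\<^sup>2 / 2) / (1 - p)\<^sup>2 + p\<^sup>2 * \<theta>\<^sup>2 / ((1 - p) * (1 - p)\<^sup>2)
        = \<theta>\<^sup>2 * (p / (1 - p) ^ 3) * ((1 - p) / 2 + p)"
      by (simp only: r_def distrib_left)
    also have "\<dots> \<le> \<theta>\<^sup>2 * (p / (1 - p) ^ 3) * 1"
      using p by (intro mult_left_mono) (simp_all add: field_simps)
    finally show ?thesis by simp
  qed
  ultimately have "cmod (w / (1 - w) - P / (1 - P) - \<i> * of_real \<theta> * (P / (1 - P)\<^sup>2)) \<le> \<theta>\<^sup>2 * (p / (1 - p) ^ 3)"
    unfolding eq using norm_triangle_ineq[of "P * (e - \<i> * of_real \<theta>) / (1 - P)\<^sup>2" "(P * e)\<^sup>2 / ((1 - w) * (1 - P)\<^sup>2)"]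
    by linarith
  then show ?thesis by (simp add: w_def P_def mult.assoc)
qed

lemma sum_third_size: "(\<Sum>j=1..n. real j * ((real j * t)\<^sup>2 * (qp x j / (1 - qp x j) ^ 3))) = third_size n x * t\<^sup>2"
proof -
  have "real j * ((real j * t)\<^sup>2 * (qp x j / (1 - qp x j) ^ 3)) = real j ^ 3 * qp x j / (1 - qp x j) ^ 3 * t\<^sup>2" for j
  proof -
    have "a * ((a * t)\<^sup>2 * c) = a ^ 3 * c * t\<^sup>2" for a c :: real
      by algebra
    from this[of "real j" "qp x j / (1 - qp x j) ^ 3"] show ?thesis
      by (simp only: times_divide_eq_right)
  qed
  then show ?thesis by (simp only: third_size_def sum_distrib_right)
qed

lemma logderiv_taylor:
  assumes x: "0 < x"
  shows "cmod (logderiv n x t - of_real (mean_size n x) - \<i> * of_real (var_size n x * t)) \<le> third_size n x * t\<^sup>2"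
proof -
  let ?p = "qp x"
  have eq: "logderiv n x t - of_real (mean_size n x) - \<i> * of_real (var_size n x * t)
     = (\<Sum>j=1..n. of_nat j * (of_real (?p j) * cis (real j * t) / (1 - of_real (?p j) * cis (real j * t))
         - of_real (?p j / (1 - ?p j)) - \<i> * of_real (real j * t * (?p j / (1 - ?p j)\<^sup>2))))"
  proof -
    have "of_real (mean_size n x) = (\<Sum>j=1..n. of_nat j * complex_of_real (?p j / (1 - ?p j)))"
      by (simp add: mean_size_def)
    moreover have "\<i> * of_real (var_size n x * t) =
       (\<Sum>j=1..n. of_nat j * (\<i> * complex_of_real (real j * t * (?p j / (1 - ?p j)\<^sup>2))))"
      by (simp add: var_size_def sum_distrib_left sum_distrib_right power2_eq_square mult_ac)
    ultimately show ?thesis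
      by (simp only: logderiv_def right_diff_distrib sum_subtractf)
  qed
  have "cmod (logderiv n x t - of_real (mean_size n x) - \<i> * of_real (var_size n x * t))
      \<le> (\<Sum>j=1..n. real j * ((real j * t)\<^sup>2 * (?p j / (1 - ?p j) ^ 3)))"
  unfolding eq
  proof (rule sum_norm_le)
    fix j assume j: "j \<in> {1..n}"
    have "0 < ?p j" "?p j < 1" using x j qp_pos qp_lt_1 by auto
    from mult_left_mono[OF geometric_taylor[OF this, of "real j * t"], of "real j"]
    show "cmod (of_nat j * (of_real (?p j) * cis (real j * t) / (1 - of_real (?p j) * cis (real j * t))
         - of_real (?p j / (1 - ?p j)) - \<i> * of_real (real j * t * (?p j / (1 - ?p j)\<^sup>2))))
       \<le> real j * ((real j * t)\<^sup>2 * (?p j / (1 - ?p j) ^ 3))"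
      by (simp only: norm_mult norm_of_nat)
  qed
  also have "\<dots> = third_size n x * t\<^sup>2" by (rule sum_third_size)
  finally show ?thesis .
qed

text \<open>A telescoping form of the comparison with an integral: e^x >= 1 + x gives x q^(j+1) <=
  q^j - q^(j+1).\<close>

lemma sum_qp_tail_le:
  assumes "0 < x" "a \<le> b"
  shows "(\<Sum>j=Suc a..b. qp x j) \<le> qp x a / x"
proof -
  have "x * (\<Sum>j=Suc a..b. qp x j) \<le> qp x a - qp x b"
    using assms(2)
  proof (induction b rule: dec_induct)
    case (step b)
    have "qp x b = qp x (Suc b) * exp x"
      by (simp add: qp_def exp_add[symmetric] algebra_simps)
    moreover have "qp x (Suc b) * (1 + x) \<le> qp x (Suc b) * exp x"
      using qp_pos[of x "Suc b"] by (intro mult_left_mono exp_ge_add_one_self) auto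
    ultimately have "x * qp x (Suc b) \<le> qp x b - qp x (Suc b)"
      by (simp add: algebra_simps)
    with step show ?case by (simp add: distrib_left)
  qed simp
  also have "\<dots> \<le> qp x a" using qp_pos[of x b] by simp
  finally show ?thesis using assms by (simp add: field_simps)
qed

lemma div_one_minus_exp_le:
  fixes y :: real
  assumes "0 < y"
  shows "y / (1 - exp (- y)) \<le> 1 + y"
proof -
  have "exp y \<ge> 1 + y" by (rule exp_ge_add_one_self)
  then have "exp (- y) * (1 + y) \<le> 1" by (simp add: exp_minus field_simps)
  moreover have "exp (- y) < 1" using assms by simp
  ultimately show ?thesis using assms by (simp add: pos_divide_le_eq algebra_simps)
qed

lemma one_plus_le_exp: "1 + y \<le> 4 * exp (y / 4)" for y :: real
proof -
  have "1 + y \<le> 4 * (1 + y / 4)" by simp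
  also have "\<dots> \<le> 4 * exp (y / 4)"
    by (intro mult_left_mono exp_ge_add_one_self) auto
  finally show ?thesis .
qed

text \<open>Each factor costs exp(x j / 4), so that for k = 2 and k = 3 the weight q^j keeps a
  summable part, exp(-x j / 2) and exp(-x j / 4).\<close>

lemma power_div_one_minus_le:
  assumes x: "0 < x" "0 < j"
  shows "(real j / (1 - qp x j)) ^ k \<le> (4 / x) ^ k * exp (real k * (x * real j) / 4)"
proof -
  let ?y = "x * real j"
  have y: "0 < ?y" using x by simp
  have q: "exp (- ?y) < 1" using y by simp
  have "?y / (1 - exp (- ?y)) \<le> 4 * exp (?y / 4)"
    using div_one_minus_exp_le[OF y] one_plus_le_exp[of ?y] by linarith
  then have "real j / (1 - qp x j) \<le> 4 / x * exp (?y / 4)"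
    using x by (simp add: qp_def field_simps)
  then have "(real j / (1 - qp x j)) ^ k \<le> (4 / x * exp (?y / 4)) ^ k"
    using q by (intro power_mono) (auto simp: qp_def)
  also have "\<dots> = (4 / x) ^ k * exp (real k * (?y / 4))"
    by (simp only: power_mult_distrib exp_of_nat_mult)
  finally show ?thesis by simp
qed

lemma var_size_le:
  assumes x: "0 < x"
  shows "var_size n x \<le> 32 / x ^ 3"
proof -
  have "var_size n x \<le> (\<Sum>j=Suc 0..n. 16 / x\<^sup>2 * qp (x / 2) j)"
    unfolding var_size_def One_nat_def
  proof (intro sum_mono)
    fix j assume j: "j \<in> {Suc 0..n}"
    have "(real j)\<^sup>2 * qp x j / (1 - qp x j)\<^sup>2 = (real j / (1 - qp x j))\<^sup>2 * qp x j"
      by (simp add: power_divide)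
    also have "\<dots> \<le> (4 / x)\<^sup>2 * exp (real 2 * (x * real j) / 4) * qp x j"
      using power_div_one_minus_le[OF x, of j 2] j qp_pos[of x j] by (intro mult_right_mono) auto
    also have "\<dots> = 16 / x\<^sup>2 * qp (x / 2) j"
      by (simp add: power_divide qp_def flip: exp_add)
    finally show "(real j)\<^sup>2 * qp x j / (1 - qp x j)\<^sup>2 \<le> 16 / x\<^sup>2 * qp (x / 2) j" .
  qed
  also have "\<dots> = 16 / x\<^sup>2 * (\<Sum>j=Suc 0..n. qp (x / 2) j)" by (rule sum_distrib_left[symmetric])
  also have "\<dots> \<le> 16 / x\<^sup>2 * (qp (x / 2) 0 / (x / 2))"
    using x by (intro mult_left_mono sum_qp_tail_le) auto
  also have "\<dots> = 32 / x ^ 3" using x by (simp add: qp_0 power2_eq_square power3_eq_cube)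
  finally show ?thesis .
qed

lemma third_size_le:
  assumes x: "0 < x"
  shows "third_size n x \<le> 256 / x ^ 4"
proof -
  have "third_size n x \<le> (\<Sum>j=Suc 0..n. 64 / x ^ 3 * qp (x / 4) j)"
    unfolding third_size_def One_nat_def
  proof (intro sum_mono)
    fix j assume j: "j \<in> {Suc 0..n}"
    have "(real j) ^ 3 * qp x j / (1 - qp x j) ^ 3 = (real j / (1 - qp x j)) ^ 3 * qp x j"
      by (simp add: power_divide)
    also have "\<dots> \<le> (4 / x) ^ 3 * exp (real 3 * (x * real j) / 4) * qp x j"
      using power_div_one_minus_le[OF x, of j 3] j qp_pos[of x j] by (intro mult_right_mono) auto
    also have "\<dots> = 64 / x ^ 3 * qp (x / 4) j"
      by (simp add: power_divide qp_def flip: exp_add)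
    finally show "(real j) ^ 3 * qp x j / (1 - qp x j) ^ 3 \<le> 64 / x ^ 3 * qp (x / 4) j" .
  qed
  also have "\<dots> = 64 / x ^ 3 * (\<Sum>j=Suc 0..n. qp (x / 4) j)" by (rule sum_distrib_left[symmetric])
  also have "\<dots> \<le> 64 / x ^ 3 * (qp (x / 4) 0 / (x / 4))"
    using x by (intro mult_left_mono sum_qp_tail_le) auto
  also have "\<dots> = 256 / x ^ 4" using x by (simp add: qp_0 power3_eq_cube power4_eq_xxxx)
  finally show ?thesis .
qed

lemma floor_inverse:
  assumes "0 < x" "x \<le> 1 / 100"
  shows "real (nat \<lfloor>1 / x\<rfloor>) \<le> 1 / x" "1 / (2 * x) \<le> real (nat \<lfloor>1 / x\<rfloor>)" "1 \<le> nat \<lfloor>1 / x\<rfloor>"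
proof -
  have "100 \<le> 1 / x" using assms by (simp add: field_simps)
  then have "1 \<le> 1 / x" by simp
  have *: "real (nat \<lfloor>1 / x\<rfloor>) = of_int \<lfloor>1 / x\<rfloor>" using assms by simp
  show "real (nat \<lfloor>1 / x\<rfloor>) \<le> 1 / x" unfolding * by simp
  have "1 / x < of_int \<lfloor>1 / x\<rfloor> + 1" by linarith
  moreover have "1 / (2 * x) = 1 / x / 2" by simp
  ultimately show "1 / (2 * x) \<le> real (nat \<lfloor>1 / x\<rfloor>)"
    unfolding * using \<open>100 \<le> 1 / x\<close> by linarith
  show "1 \<le> nat \<lfloor>1 / x\<rfloor>" using \<open>1 \<le> 1 / x\<close> by linarith
qed

text \<open>The terms with j <= 1/x suffice: there q^j >= 1/e >= 1/3 and 1 - q^j <= x j, so each is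
  at least 1/(3 x^2), and there are at least 1/(2 x) of them.\<close>

lemma var_size_ge:
  assumes s: "saddle n x"
  shows "1 / (6 * x ^ 3) \<le> var_size n x"
proof -
  note x = saddleD[OF s]
  let ?M = "nat \<lfloor>1 / x\<rfloor>"
  note M = floor_inverse[OF x(1,2)]
  have "1 / x \<le> 1 / x\<^sup>2" using x by (simp add: power2_eq_square field_simps)
  with M x have "?M \<le> n" by linarith
  have "1 / (6 * x ^ 3) \<le> 1 / (2 * x) * (1 / (3 * x\<^sup>2))"
    by (simp add: power2_eq_square power3_eq_cube)
  also have "\<dots> \<le> real ?M * (1 / (3 * x\<^sup>2))"
    using M by (intro mult_right_mono) auto
  also have "\<dots> = (\<Sum>j=1..?M. 1 / (3 * x\<^sup>2))" by simp
  also have "\<dots> \<le> (\<Sum>j=1..?M. (real j)\<^sup>2 * qp x j / (1 - qp x j)\<^sup>2)"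
  proof (intro sum_mono)
    fix j assume j: "j \<in> {1..?M}"
    then have "real j \<le> real ?M" by simp
    with M(1) have "real j \<le> 1 / x" by linarith
    then have "x * real j \<le> x * (1 / x)" using x(1) by (intro mult_left_mono) auto
    then have y: "x * real j \<le> 1" "0 < x * real j" using x j by auto
    have "exp (-1) \<le> qp x j" using y by (simp add: qp_def)
    moreover have "1 / 3 \<le> exp (-1 :: real)"
      using exp_le by (simp add: exp_minus field_simps)
    ultimately have p: "1 / 3 \<le> qp x j" by linarith
    have "1 - qp x j \<le> x * real j"
      using exp_ge_add_one_self[of "- (x * real j)"] by (simp add: qp_def)
    moreover have "0 < 1 - qp x j" using qp_lt_1[of x j] x j by simp
    ultimately have "(1 - qp x j)\<^sup>2 \<le> (x * real j)\<^sup>2" "0 < (1 - qp x j)\<^sup>2"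
      by (auto intro!: power_mono)
    then have "(real j)\<^sup>2 * (1 / 3) / (x * real j)\<^sup>2 \<le> (real j)\<^sup>2 * qp x j / (1 - qp x j)\<^sup>2"
      using p by (intro frac_le mult_left_mono mult_nonneg_nonneg) auto
    then show "1 / (3 * x\<^sup>2) \<le> (real j)\<^sup>2 * qp x j / (1 - qp x j)\<^sup>2"
      using j by (simp add: power_mult_distrib)
  qed
  also have "\<dots> \<le> var_size n x"
    unfolding var_size_def
    using \<open>?M \<le> n\<close> qp_pos[of x] by (intro sum_mono2) (auto intro!: divide_nonneg_nonneg mult_nonneg_nonneg simp: less_imp_le)
  finally show ?thesis .
qed

section \<open>The expected size at the saddle point\<close>

lemma sinh_bounds:
  fixes u :: real
  assumes u: "0 < u"
  shows "u \<le> sinh u" "sinh u \<le> u * cosh u"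
proof -
  have "sinh 0 - 0 \<le> sinh u - u"
  proof (rule DERIV_nonneg_imp_nondecreasing[of 0 u "\<lambda>u. sinh u - u"])
    fix y :: real
    have "((\<lambda>u. sinh u - u) has_real_derivative cosh y - 1) (at y)"
      by (auto intro!: derivative_eq_intros)
    moreover have "0 \<le> cosh y - 1" using cosh_real_ge_1[of y] by simp
    ultimately show "\<exists>d. ((\<lambda>u. sinh u - u) has_real_derivative d) (at y) \<and> 0 \<le> d" by blast
  qed (use u in simp)
  then show "u \<le> sinh u" by simp
  have "0 * cosh 0 - sinh 0 \<le> u * cosh u - sinh u"
  proof (rule DERIV_nonneg_imp_nondecreasing[of 0 u "\<lambda>u. u * cosh u - sinh u"])
    fix y :: real assume y: "0 \<le> y"
    have "((\<lambda>u. u * cosh u - sinh u) has_real_derivative y * sinh y) (at y)"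
      by (auto intro!: derivative_eq_intros)
    moreover have "0 \<le> y * sinh y" using y by simp
    ultimately show "\<exists>d. ((\<lambda>u. u * cosh u - sinh u) has_real_derivative d) (at y) \<and> 0 \<le> d" by blast
  qed (use u in simp)
  then show "sinh u \<le> u * cosh u" by simp
qed

text \<open>The quotient is 1 / (4 sinh^2(y/2)); u <= sinh u <= u cosh u and cosh^2 = 1 + sinh^2 do
  the rest.\<close>

lemma exp_div_square_bounds:
  fixes y :: real
  assumes y: "0 < y"
  shows "exp (- y) / (1 - exp (- y))\<^sup>2 \<le> 1 / y\<^sup>2" "1 / y\<^sup>2 - 1 / 4 \<le> exp (- y) / (1 - exp (- y))\<^sup>2"
proof -
  define S where "S = sinh (y / 2)"
  have S: "y / 2 \<le> S" "S \<le> y / 2 * cosh (y / 2)"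
    using sinh_bounds[of "y / 2"] y by (simp_all add: S_def)
  have "1 - exp (- y) = 2 * S * exp (- (y / 2))"
    by (simp add: S_def sinh_def field_simps flip: exp_add)
  then have eq: "exp (- y) / (1 - exp (- y))\<^sup>2 = 1 / (4 * S\<^sup>2)"
    using S y by (simp add: power_mult_distrib exp_double[symmetric])
  have "(y / 2)\<^sup>2 \<le> S\<^sup>2" using S y by (intro power_mono) auto
  then show "exp (- y) / (1 - exp (- y))\<^sup>2 \<le> 1 / y\<^sup>2"
    unfolding eq using y by (intro frac_le) (auto simp: power_divide)
  have "S\<^sup>2 \<le> (y / 2 * cosh (y / 2))\<^sup>2" using S y by (intro power_mono) auto
  also have "\<dots> = y\<^sup>2 / 4 * (1 + S\<^sup>2)"
    by (simp add: S_def power_mult_distrib power_divide cosh_square_eq add.commute)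
  finally have "4 * S\<^sup>2 \<le> y\<^sup>2 * (1 + S\<^sup>2)" by simp
  moreover have "0 < S\<^sup>2" using S y by simp
  ultimately show "1 / y\<^sup>2 - 1 / 4 \<le> exp (- y) / (1 - exp (- y))\<^sup>2"
    unfolding eq using y by (simp add: field_simps)
qed

lemma sum_mult_power:
  fixes \<rho> :: real
  shows "(1 - \<rho>)\<^sup>2 * (\<Sum>j=1..n. real j * \<rho> ^ j) = \<rho> - (real n + 1) * \<rho> ^ (n + 1) + real n * \<rho> ^ (n + 2)"
proof (induction n)
  case (Suc n)
  define P where "P = \<rho> ^ n"
  have P: "\<rho> ^ (n + 1) = \<rho> * P" "\<rho> ^ (n + 2) = \<rho> * \<rho> * P" "\<rho> ^ (Suc n + 1) = \<rho> * \<rho> * P"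
    "\<rho> ^ (Suc n + 2) = \<rho> * \<rho> * \<rho> * P" "\<rho> ^ Suc n = \<rho> * P"
    by (simp_all add: P_def)
  have "(1 - \<rho>)\<^sup>2 * (\<Sum>j=1..Suc n. real j * \<rho> ^ j)
      = (1 - \<rho>)\<^sup>2 * (\<Sum>j=1..n. real j * \<rho> ^ j) + (1 - \<rho>)\<^sup>2 * (real (Suc n) * \<rho> ^ Suc n)"
    by (simp add: distrib_left)
  also have "\<dots> = \<rho> - (real n + 1) * (\<rho> * P) + real n * (\<rho> * \<rho> * P)
      + (1 - \<rho>)\<^sup>2 * ((real n + 1) * (\<rho> * P))"
    unfolding Suc P by simp
  also have "\<dots> = \<rho> - (real n + 2) * (\<rho> * \<rho> * P) + (real n + 1) * (\<rho> * \<rho> * \<rho> * P)"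
    by (simp only: power2_eq_square) (simp only: algebra_simps)
  finally show ?case unfolding P by (simp only: of_nat_Suc) (simp only: algebra_simps)
qed simp

text \<open>Expanding q^j / (1 - q^j) and interchanging the sums turns the mean into a series whose
  terms are close to 1/(x m)^2 for m = 1, 2, ..., so that zeta(2) appears.\<close>

lemma mean_size_sums:
  assumes x: "0 < x"
  shows "(\<lambda>m. \<Sum>j=1..n. real j * qp x (Suc m) ^ j) sums mean_size n x"
proof -
  have "(\<lambda>m. \<Sum>j=1..n. real j * qp x (Suc m) ^ j) sums (\<Sum>j=1..n. real j * qp x j / (1 - qp x j))"
  proof (rule sums_sum)
    fix j assume j: "j \<in> {1..n}"
    have "norm (qp x j) < 1" using qp_lt_1[of x j] qp_pos[of x j] x j by simp
    then have "(\<lambda>m. real j * qp x j * qp x j ^ m) sums (real j * qp x j * (1 / (1 - qp x j)))"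
      by (intro sums_mult geometric_sums)
    moreover have "qp x j ^ Suc m = qp x (Suc m) ^ j" for m
      by (simp only: qp_mult[symmetric] mult.commute)
    ultimately show "(\<lambda>m. real j * qp x (Suc m) ^ j) sums (real j * qp x j / (1 - qp x j))"
      by (simp add: mult.assoc)
  qed
  then show ?thesis by (simp add: mean_size_def)
qed

lemma inverse_squares_partial:
  assumes M: "1 \<le> M"
  shows "pi\<^sup>2 / 6 - 1 / real M \<le> (\<Sum>m<M. 1 / real (Suc m) ^ 2)"
proof -
  have le: "(\<Sum>m<N. 1 / real (Suc m) ^ 2) \<le> (\<Sum>m<M. 1 / real (Suc m) ^ 2) + 1 / real M - 1 / real N"
    if "M \<le> N" for N
    using that
  proof (induction N rule: dec_induct)
    case (step N)
    have "1 / real (Suc N) ^ 2 \<le> 1 / real N - 1 / real (Suc N)"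
    proof -
      have N: "0 < real N" using M step by simp
      have "1 / real (Suc N) ^ 2 \<le> 1 / (real N * real (Suc N))"
        using N by (intro frac_le) (auto simp: power2_eq_square)
      also have "\<dots> = 1 / real N - 1 / real (Suc N)" using N by (simp add: field_simps)
      finally show ?thesis .
    qed
    with step show ?case by simp
  qed simp
  have lim: "(\<lambda>N. \<Sum>m<N. 1 / real (Suc m) ^ 2) \<longlonglongrightarrow> pi\<^sup>2 / 6"
    using inverse_squares_sums by (simp add: sums_def add.commute)
  have "pi\<^sup>2 / 6 \<le> (\<Sum>m<M. 1 / real (Suc m) ^ 2) + 1 / real M"
  proof (rule LIMSEQ_le_const2[OF lim], intro exI allI impI)
    fix N assume "M \<le> N"
    from le[OF this] show "(\<Sum>m<N. 1 / real (Suc m) ^ 2) \<le> (\<Sum>m<M. 1 / real (Suc m) ^ 2) + 1 / real M"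
      by (smt (verit) divide_nonneg_nonneg of_nat_0_le_iff)
  qed
  then show ?thesis by simp
qed

text \<open>The terms of the series never exceed 1/(x m)^2, and zeta(2)/x^2 = n by the choice of x.
  From below every term may fall short by a constant, so only the first 1/x of them are used; the
  shortfalls and the omitted part of zeta(2)/x^2 are both O(1/x).\<close>

lemma mean_size_bounds:
  assumes s: "saddle n x"
  shows "mean_size n x \<le> real n" "real n - 771 / x \<le> mean_size n x"
proof -
  note x = saddleD[OF s]
  define T where "T = (\<lambda>m. \<Sum>j=1..n. real j * qp x (Suc m) ^ j)"
  have sums: "T sums mean_size n x" unfolding T_def by (rule mean_size_sums[OF x(1)])
  \<comment> \<open>769 exceeds 768 + 1/4: 768 comes from cutting the inner sum at n, via q^n <= 256
    x^4 and n + 1 <= 3/x^2, and 1/4 from \<open>exp_div_square_bounds\<close>.\<close>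
  have T: "T m \<le> 1 / x\<^sup>2 * (1 / real (Suc m) ^ 2)"
    "1 / x\<^sup>2 * (1 / real (Suc m) ^ 2) - 769 \<le> T m" for m
  proof -
    define \<rho> where "\<rho> = qp x (Suc m)"
    define y where "y = x * real (Suc m)"
    have y: "0 < y" using x by (simp add: y_def)
    have \<rho>: "0 < \<rho>" "\<rho> < 1" "\<rho> = exp (- y)" using x qp_pos qp_lt_1 by (auto simp: \<rho>_def y_def qp_def)
    note b = exp_div_square_bounds[OF y, folded \<rho>(3)]
    have eq: "(1 - \<rho>)\<^sup>2 * T m = \<rho> - \<rho> ^ n * ((real n + 1) * \<rho> - real n * \<rho>\<^sup>2)"
      using sum_mult_power[of \<rho> n] by (simp add: T_def \<rho>_def power_add algebra_simps power2_eq_square)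
    have "real n * \<rho>\<^sup>2 \<le> (real n + 1) * \<rho>"
      using \<rho> by (intro mult_mono) (auto simp: power2_eq_square mult_left_le)
    then have "(1 - \<rho>)\<^sup>2 * T m \<le> \<rho>" using \<rho> unfolding eq by simp
    then have "T m \<le> \<rho> / (1 - \<rho>)\<^sup>2" using \<rho> by (simp add: pos_le_divide_eq mult.commute)
    also have "\<dots> \<le> 1 / y\<^sup>2" by (rule b)
    finally show "T m \<le> 1 / x\<^sup>2 * (1 / real (Suc m) ^ 2)" by (simp add: y_def power_mult_distrib)
    have "\<rho> ^ n * ((real n + 1) * \<rho> - real n * \<rho>\<^sup>2) \<le> \<rho> ^ n * ((real n + 1) * \<rho>)"
      using \<rho> by (intro mult_left_mono) auto
    also have "\<dots> \<le> 768 * x\<^sup>2 * \<rho>"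
    proof -
      have "\<rho> ^ n = qp x (Suc m * n)" by (simp only: \<rho>_def qp_mult)
      also have "\<dots> \<le> qp x n" using x by (intro qp_antimono) auto
      also have "\<dots> \<le> 256 * x ^ 4" by (rule saddle_qp_n_le[OF s])
      finally have "\<rho> ^ n \<le> 256 * x ^ 4" .
      moreover have "real n + 1 \<le> 3 / x\<^sup>2"
      proof -
        have "1 \<le> 1 / x\<^sup>2" using x by (simp add: power_le_one)
        with x(6) show ?thesis by simp
      qed
      ultimately have "\<rho> ^ n * ((real n + 1) * \<rho>) \<le> 256 * x ^ 4 * (3 / x\<^sup>2 * \<rho>)"
        using \<rho> by (intro mult_mono) auto
      also have "\<dots> = 768 * x\<^sup>2 * \<rho>" using x by (simp add: power2_eq_square power4_eq_xxxx)
      finally show ?thesis .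
    qed
    finally have "\<rho> - 768 * x\<^sup>2 * \<rho> \<le> (1 - \<rho>)\<^sup>2 * T m" unfolding eq by simp
    then have "(\<rho> - 768 * x\<^sup>2 * \<rho>) / (1 - \<rho>)\<^sup>2 \<le> T m"
      using \<rho> by (simp add: pos_divide_le_eq mult.commute)
    then have "\<rho> / (1 - \<rho>)\<^sup>2 - 768 * x\<^sup>2 * (\<rho> / (1 - \<rho>)\<^sup>2) \<le> T m"
      by (simp add: diff_divide_distrib)
    moreover have "768 * x\<^sup>2 * (\<rho> / (1 - \<rho>)\<^sup>2) \<le> 768 * x\<^sup>2 * (1 / y\<^sup>2)"
      using b by (intro mult_left_mono) auto
    moreover have "x\<^sup>2 * (1 / y\<^sup>2) \<le> 1"
    proof -
      have "x\<^sup>2 * (1 / y\<^sup>2) = 1 / (real (Suc m))\<^sup>2" using x(1) by (simp add: y_def power_mult_distrib)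
      also have "\<dots> \<le> 1" by (simp add: divide_le_eq_1 one_le_power del: of_nat_Suc)
      finally show ?thesis .
    qed
    moreover have "1 / y\<^sup>2 = 1 / x\<^sup>2 * (1 / real (Suc m) ^ 2)"
      by (simp add: y_def power_mult_distrib)
    ultimately show "1 / x\<^sup>2 * (1 / real (Suc m) ^ 2) - 769 \<le> T m"
      using b(2) by linarith
  qed
  have isq: "(\<lambda>m. 1 / real (Suc m) ^ 2) sums (pi\<^sup>2 / 6)"
    using inverse_squares_sums by (simp add: add.commute)
  have "mean_size n x \<le> 1 / x\<^sup>2 * (pi\<^sup>2 / 6)"
    by (rule sums_le[OF T(1) sums sums_mult[OF isq]])
  then show "mean_size n x \<le> real n" by (simp add: x(4))
  let ?M = "nat \<lfloor>1 / x\<rfloor>"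
  note M = floor_inverse[OF x(1,2)]
  \<comment> \<open>The tail of the series of inverse squares is at most 1/M <= 2 x, which adds 2 to
    the constant 769.\<close>
  have "1 / real ?M \<le> 1 / (1 / (2 * x))"
    using M x by (intro divide_left_mono) auto
  then have "pi\<^sup>2 / 6 - 2 * x \<le> (\<Sum>m<?M. 1 / real (Suc m) ^ 2)"
    using inverse_squares_partial[OF M(3)] by simp
  then have "1 / x\<^sup>2 * (pi\<^sup>2 / 6 - 2 * x) \<le> 1 / x\<^sup>2 * (\<Sum>m<?M. 1 / real (Suc m) ^ 2)"
    by (intro mult_left_mono) auto
  then have "1 / x\<^sup>2 * (pi\<^sup>2 / 6 - 2 * x) - 769 * (1 / x)
      \<le> 1 / x\<^sup>2 * (\<Sum>m<?M. 1 / real (Suc m) ^ 2) - 769 * real ?M"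
    using M(1) by linarith
  also have "\<dots> = (\<Sum>m<?M. 1 / x\<^sup>2 * (1 / real (Suc m) ^ 2) - 769)"
    by (simp add: sum_subtractf sum_distrib_left)
  also have "\<dots> \<le> (\<Sum>m<?M. T m)" by (intro sum_mono T)
  also have "\<dots> \<le> mean_size n x"
  proof -
    have "0 \<le> T m" for m unfolding T_def using qp_pos[of x] by (intro sum_nonneg) (auto intro!: mult_nonneg_nonneg less_imp_le)
    then show ?thesis using sums by (metis sums_iff sum_le_suminf finite_lessThan)
  qed
  also have "1 / x\<^sup>2 * (pi\<^sup>2 / 6 - 2 * x) - 769 * (1 / x) = real n - 771 / x"
    using x(1) unfolding x(4) by (simp add: field_simps power2_eq_square)
  finally show "real n - 771 / x \<le> mean_size n x" .
qed

section \<open>The saddle point integral\<close>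

definition tilted :: "nat \<Rightarrow> real \<Rightarrow> real \<Rightarrow> complex" where
  "tilted n x t = euler_char n x t * cis (- real n * t)"

lemma norm_tilted: "cmod (tilted n x t) = cmod (euler_char n x t)"
  by (simp add: tilted_def norm_mult)

lemma tilted_0: "0 < x \<Longrightarrow> tilted n x 0 = 1"
proof -
  assume x: "0 < x"
  have "(1 - complex_of_real (qp x j)) / (1 - complex_of_real (qp x j)) = 1" if "j \<in> {1..n}" for j
    using qp_lt_1[OF x, of j] that by (auto simp: complex_eq_iff)
  then have "(\<Prod>j=1..n. (1 - complex_of_real (qp x j)) / (1 - complex_of_real (qp x j))) = 1"
    by (rule prod.neutral[OF ballI])
  then show ?thesis by (simp add: tilted_def euler_char_def)
qed

lemma has_vector_derivative_tilted:
  assumes x: "0 < x"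
  shows "(tilted n x has_vector_derivative \<i> * (logderiv n x t - of_nat n) * tilted n x t) (at t within S)"
proof -
  have "((\<lambda>t. euler_char n x t * cis (- real n * t)) has_vector_derivative
     euler_char n x t * (\<i> * of_real (- real n) * cis (- real n * t)) +
     (\<i> * logderiv n x t * euler_char n x t) * cis (- real n * t)) (at t within S)"
    by (rule has_vector_derivative_mult[OF has_vector_derivative_at_within[OF has_vector_derivative_euler_char[OF x]]
          has_vector_derivative_cis_mult])
  moreover have "euler_char n x t * (\<i> * of_real (- real n) * cis (- real n * t)) +
     (\<i> * logderiv n x t * euler_char n x t) * cis (- real n * t)
     = \<i> * (logderiv n x t - of_nat n) * tilted n x t"
    by (simp add: tilted_def algebra_simps)
  moreover have "tilted n x = (\<lambda>t. euler_char n x t * cis (- real n * t))"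
    by (rule ext) (simp add: tilted_def)
  ultimately show ?thesis by simp
qed

lemma continuous_on_tilted: "0 < x \<Longrightarrow> continuous_on S (tilted n x)"
  using has_vector_derivative_tilted has_vector_derivative_continuous
  by (intro continuous_at_imp_continuous_on ballI) blast

lemma continuous_on_logderiv:
  assumes x: "0 < x"
  shows "continuous_on S (logderiv n x)"
proof -
  have "1 - complex_of_real (qp x j) * cis (real j * t) \<noteq> 0" if "j \<in> {1..n}" for j t
    using one_minus_cis_nonzero[of "qp x j"] qp_pos qp_lt_1[OF x, of j] that by auto
  then show ?thesis
    unfolding logderiv_def [abs_def]
    by (intro continuous_intros) auto
qed

lemma cis_int_pi: "cis (real j * (- pi)) = cis (real j * pi)"
proof -
  have "cis (real j * (- pi)) = cis (- pi) ^ j" "cis (real j * pi) = cis pi ^ j"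
    by (rule Complex.DeMoivre[symmetric])+
  moreover have "cis (- pi) = cis pi" by (simp add: complex_eq_iff)
  ultimately show ?thesis by simp
qed

lemma tilted_periodic: "tilted n x (- pi) = tilted n x pi"
proof -
  have "cis (- real n * (- pi)) = cis (- real n * pi)"
    using cis_int_pi[of n] by simp
  then show ?thesis by (simp only: tilted_def euler_char_def cis_int_pi)
qed

lemma integral_logderiv_tilted:
  assumes x: "0 < x"
  shows "integral {-pi..pi} (\<lambda>t. (logderiv n x t - of_nat n) * tilted n x t) = 0"
proof -
  have "((\<lambda>t. \<i> * (logderiv n x t - of_nat n) * tilted n x t) has_integral tilted n x pi - tilted n x (- pi)) {-pi..pi}"
    by (rule fundamental_theorem_of_calculus) (use has_vector_derivative_tilted[OF x] in auto)
  then have "((\<lambda>t. - \<i> * (\<i> * (logderiv n x t - of_nat n) * tilted n x t)) has_integral - \<i> * 0) {-pi..pi}"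
    unfolding tilted_periodic diff_self by (rule has_integral_mult_right)
  moreover have "- \<i> * (\<i> * (logderiv n x t - of_nat n) * tilted n x t) = (logderiv n x t - of_nat n) * tilted n x t" for t
    by (simp add: mult.assoc[symmetric])
  ultimately have "((\<lambda>t. (logderiv n x t - of_nat n) * tilted n x t) has_integral 0) {-pi..pi}"
    by (simp only: mult_zero_right)
  then show ?thesis by (rule integral_unique)
qed

text \<open>Integrating the derivative of \<^term>\<open>tilted n x\<close> over a period gives zero; as the logarithmic
  derivative is nearly linear, this shows that the mode is close to \<open>n\<close>.\<close>

lemma first_moment_tilted:
  assumes s: "saddle n x"
  shows "cmod (integral {-pi..pi} (\<lambda>t. of_real t * tilted n x t)) \<le> 25000 * dom_const * x\<^sup>2 * sqrt (x ^ 3)"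
proof -
  note x = saddleD[OF s]
  let ?F = "tilted n x" and ?\<mu> = "mean_size n x" and ?V = "var_size n x"
  let ?s = "sqrt (x ^ 3)"
  note [continuous_intros] = continuous_on_tilted[OF x(1)] continuous_on_logderiv[OF x(1)]
  let ?R = "\<lambda>t. logderiv n x t - of_real ?\<mu> - \<i> * of_real (?V * t)"
  have int: "(\<lambda>t. (logderiv n x t - of_nat n) * ?F t) integrable_on {-pi..pi}"
    "?F integrable_on {-pi..pi}" "(\<lambda>t. ?R t * ?F t) integrable_on {-pi..pi}"
    "(\<lambda>t. of_real t * ?F t) integrable_on {-pi..pi}"
    by (rule integrable_continuous_interval; intro continuous_intros)+
  \<comment> \<open>\<open>logderiv n x t - n\<close> is the constant
    \<open>mean_size n x - n\<close> plus the linear term plus the remainder \<open>?R\<close>. Both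
    errors are O(1/x) times the mass x^(3/2); division by the variance, at least 1/(6 x^3), gains a
    factor sqrt x over the trivial estimate of the first moment.\<close>
  have "\<i> * of_real ?V * integral {-pi..pi} (\<lambda>t. of_real t * ?F t)
      = integral {-pi..pi} (\<lambda>t. \<i> * of_real ?V * (of_real t * ?F t))"
    by (rule integral_mult_right[symmetric])
  also have "\<dots> = integral {-pi..pi} (\<lambda>t. (logderiv n x t - of_nat n) * ?F t
      - of_real (?\<mu> - real n) * ?F t - ?R t * ?F t)"
    by (rule integral_cong) (simp add: algebra_simps)
  also have "\<dots> = 0 - of_real (?\<mu> - real n) * integral {-pi..pi} ?F - integral {-pi..pi} (\<lambda>t. ?R t * ?F t)"
    using int integral_logderiv_tilted[OF x(1)]
    by (simp add: integral_diff integrable_diff integrable_on_mult_right)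
  finally have eq: "\<i> * of_real ?V * integral {-pi..pi} (\<lambda>t. of_real t * ?F t)
    = 0 - of_real (?\<mu> - real n) * integral {-pi..pi} ?F - integral {-pi..pi} (\<lambda>t. ?R t * ?F t)" .
  have 0: "cmod (integral {-pi..pi} ?F) \<le> 4 * 1 * dom_const * ?s"
    by (rule norm_integral_dom0[OF x(1) int(2)]) (use euler_char_dom[OF s] in \<open>auto simp: norm_tilted\<close>)
  have R: "cmod (integral {-pi..pi} (\<lambda>t. ?R t * ?F t)) \<le> 4 * (256 / x ^ 4) * dom_const * x ^ 3 * ?s"
  proof (rule norm_integral_dom2[OF x(1) int(3)])
    fix t :: real assume t: "\<bar>t\<bar> \<le> pi"
    have "cmod (?R t) \<le> third_size n x * t\<^sup>2" by (rule logderiv_taylor[OF x(1)])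
    also have "\<dots> \<le> 256 / x ^ 4 * t\<^sup>2"
      by (intro mult_right_mono third_size_le x) auto
    finally show "cmod (?R t * ?F t) \<le> 256 / x ^ 4 * t\<^sup>2 * (dom_const / (1 + t\<^sup>2 / x ^ 3)\<^sup>2)"
      unfolding norm_mult norm_tilted using euler_char_dom[OF s t] by (intro mult_mono) auto
  qed (use x in auto)
  have \<mu>: "\<bar>?\<mu> - real n\<bar> \<le> 771 / x"
    using mean_size_bounds[OF s] by linarith
  have V: "0 \<le> ?V" using var_size_ge[OF s] x by (smt (verit) divide_nonneg_nonneg zero_le_power)
  let ?T = "cmod (integral {-pi..pi} (\<lambda>t. of_real t * ?F t))"
  have "1 / (6 * x ^ 3) * ?T \<le> ?V * ?T"
    using var_size_ge[OF s] by (intro mult_right_mono) auto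
  also have "?V * ?T = cmod (\<i> * of_real ?V * integral {-pi..pi} (\<lambda>t. of_real t * ?F t))"
    using V by (simp add: norm_mult)
  also have "\<dots> \<le> cmod (of_real (?\<mu> - real n) * integral {-pi..pi} ?F) + cmod (integral {-pi..pi} (\<lambda>t. ?R t * ?F t))"
    unfolding eq using norm_triangle_ineq4[of "- (of_real (?\<mu> - real n) * integral {-pi..pi} ?F)"]
    by simp
  also have "\<dots> \<le> 771 / x * (4 * 1 * dom_const * ?s) + 4 * (256 / x ^ 4) * dom_const * x ^ 3 * ?s"
  proof (rule add_mono[OF _ R])
    have "cmod (of_real (?\<mu> - real n) * integral {-pi..pi} ?F) = \<bar>?\<mu> - real n\<bar> * cmod (integral {-pi..pi} ?F)"
      by (simp only: norm_mult norm_of_real)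
    also have "\<dots> \<le> 771 / x * (4 * 1 * dom_const * ?s)"
      using 0 \<mu> x by (intro mult_mono) auto
    finally show "cmod (of_real (?\<mu> - real n) * integral {-pi..pi} ?F) \<le> 771 / x * (4 * 1 * dom_const * ?s)" .
  qed
  also have "4 * (256 / x ^ 4) * dom_const * x ^ 3 * ?s = 1024 / x * (dom_const * ?s)"
    using x by (simp add: power3_eq_cube power4_eq_xxxx)
  also have "771 / x * (4 * 1 * dom_const * ?s) + 1024 / x * (dom_const * ?s) = 4108 * (dom_const * ?s) / x"
    using x by (simp add: field_simps)
  \<comment> \<open>The constant becomes 6 (4 * 771 + 1024) = 24648.\<close>
  finally have "?T \<le> 6 * x ^ 3 * (4108 * (dom_const * ?s) / x)"
    using x by (simp add: field_simps)
  also have "\<dots> = 24648 * dom_const * x\<^sup>2 * ?s"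
    using x by (simp add: power3_eq_cube power2_eq_square)
  also have "\<dots> \<le> 25000 * dom_const * x\<^sup>2 * ?s"
    using x dom_const_pos by (intro mult_right_mono) auto
  finally show ?thesis .
qed

text \<open>A Gronwall estimate by bootstrap: with m the maximum of |G|, the mean value inequality
  gives |G - 1| <= m/4, hence m <= 1 + m/4 and m <= 2.\<close>

lemma norm_diff_1_le_of_logderiv:
  fixes G E :: "real \<Rightarrow> complex"
  assumes T: "0 \<le> T" "T * \<delta> \<le> 1 / 4"
    and G: "\<And>t. t \<in> {-T..T} \<Longrightarrow> (G has_vector_derivative E t * G t) (at t within {-T..T})"
    and E: "\<And>t. t \<in> {-T..T} \<Longrightarrow> cmod (E t) \<le> \<delta>"
    and G0: "G 0 = 1" and t: "t \<in> {-T..T}"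
  shows "cmod (G t - 1) \<le> 1 / 2"
proof -
  have "continuous_on {-T..T} G"
    using G has_vector_derivative_continuous continuous_on_eq_continuous_within by blast
  then have "continuous_on {-T..T} (\<lambda>t. cmod (G t))" by (intro continuous_intros)
  moreover have "{-T..T} \<noteq> {}" using T by auto
  ultimately obtain t0 where t0: "t0 \<in> {-T..T}" "\<And>t. t \<in> {-T..T} \<Longrightarrow> cmod (G t) \<le> cmod (G t0)"
    using continuous_attains_sup[of "{-T..T}"] by (metis compact_Icc)
  define m where "m = cmod (G t0)"
  have \<delta>: "0 \<le> \<delta>" using E[OF t0(1)] norm_ge_zero order_trans by blast
  have bound: "cmod (G t - 1) \<le> m / 4" if t: "t \<in> {-T..T}" for t
  proof -
    have "norm (G t - G 0) \<le> (\<delta> * m) * norm (t - 0)"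
    proof (rule differentiable_bound[of "{-T..T}" G "\<lambda>t h. h *\<^sub>R (E t * G t)"])
      fix u assume u: "u \<in> {-T..T}"
      show "(G has_derivative (\<lambda>h. h *\<^sub>R (E u * G u))) (at u within {-T..T})"
        using G[OF u] by (simp add: has_vector_derivative_def)
      show "onorm (\<lambda>h. h *\<^sub>R (E u * G u)) \<le> \<delta> * m"
      proof (rule onorm_bound)
        fix h :: real
        have "cmod (E u * G u) \<le> \<delta> * m"
          unfolding norm_mult m_def using E[OF u] t0(2)[OF u] \<delta> by (intro mult_mono) auto
        then show "norm (h *\<^sub>R (E u * G u)) \<le> \<delta> * m * norm h"
          by (simp add: mult_left_mono mult.commute[of _ "\<bar>h\<bar>"])
      qed (use \<delta> in \<open>simp add: m_def\<close>)
    qed (use t T in auto)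
    also have "\<dots> \<le> \<delta> * m * T"
      using t \<delta> by (intro mult_left_mono) (auto simp: m_def)
    also have "\<dots> = T * \<delta> * m" by simp
    also have "\<dots> \<le> 1 / 4 * m"
      using T by (intro mult_right_mono) (auto simp: m_def)
    finally show ?thesis using G0 by simp
  qed
  have "m \<le> 1 + cmod (G t0 - 1)"
    unfolding m_def using norm_triangle_ineq[of 1 "G t0 - 1"] by simp
  with bound[OF t0(1)] have "m \<le> 2" by simp
  with bound[OF t] show ?thesis by linarith
qed

text \<open>On |t| <= L x^(3/2) the function stays close to a Gaussian and has positive real part.
  Beyond, it is dominated by a small multiple of a Lorentzian, which is added to make the integrand
  nonnegative and whose integral is subtracted at the end. The gain comes from |t| <=
  x^(3/2).\<close>

lemma Re_integral_tilted_ge: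
  "\<exists>x0>0. \<forall>n x. saddle n x \<longrightarrow> x \<le> x0 \<longrightarrow>
     exp (- 16) / 2 * sqrt (x ^ 3) \<le> Re (integral {-pi..pi} (tilted n x))"
proof -
  define D where "D = dom_const"
  have D: "0 < D" by (simp add: D_def dom_const_pos)
  \<comment> \<open>L is so large that the Lorentzian correction, with its factor D/(1 + L^2), takes
    away at most half of the gain exp(-16).\<close>
  define L where "L = 8 * D * exp 16 + 1"
  have L1: "1 \<le> L" using D by (simp add: L_def)
  then have "L \<le> L\<^sup>2" by (simp add: power2_eq_square)
  then have "8 * D * exp 16 \<le> 1 + L\<^sup>2" by (simp add: L_def)
  then have tail: "4 * (D / (1 + L\<^sup>2)) \<le> exp (- 16) / 2"
    using D by (simp add: exp_minus field_simps add_pos_nonneg)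
  \<comment> \<open>sqrt x <= \<eta> ensures T \<delta> <= 1/4 below, where T = L x^(3/2) is the
    half-length of the interval and \<delta> = O(L^2 / x) the error in the logarithmic
    derivative.\<close>
  define \<eta> where "\<eta> = 1 / (4 * L * (771 + 256 * L\<^sup>2))"
  have \<eta>: "0 < \<eta>" using L1 by (simp add: \<eta>_def add_pos_nonneg)
  show ?thesis
  proof (intro exI[of _ "\<eta>\<^sup>2"] conjI allI impI)
    show "0 < \<eta>\<^sup>2" using \<eta> by simp
    fix n x assume s: "saddle n x" and x\<eta>: "x \<le> \<eta>\<^sup>2"
    note x = saddleD[OF s]
    define c where "c = sqrt (x ^ 3)"
    have c: "0 < c" "c\<^sup>2 = x ^ 3" using x by (simp_all add: c_def)
    have c_eq: "c = x * sqrt x" using x by (simp add: c_def power3_eq_cube real_sqrt_mult)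
    have sx: "sqrt x \<le> \<eta>" using x\<eta> \<eta> by (simp add: real_le_lsqrt real_sqrt_le_iff x)
    define T where "T = L * c"
    define \<delta> where "\<delta> = 771 / x + 256 / x ^ 4 * T\<^sup>2"
    have T0: "0 \<le> T" using L1 c by (simp add: T_def)
    have T: "T * \<delta> \<le> 1 / 4"
    proof -
      have "\<delta> = (771 + 256 * L\<^sup>2) / x"
        using x by (simp add: \<delta>_def T_def power_mult_distrib c power3_eq_cube power4_eq_xxxx add_divide_distrib)
      then have "T * \<delta> = L * (771 + 256 * L\<^sup>2) * sqrt x"
        using x by (simp add: T_def c_eq)
      also have "\<dots> \<le> L * (771 + 256 * L\<^sup>2) * \<eta>"
        using sx L1 by (intro mult_left_mono) auto
      also have "\<dots> = 1 / 4"
      proof -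
        have "L * (771 + 256 * L\<^sup>2) \<noteq> 0" using L1 by (simp add: add_pos_nonneg less_imp_neq[symmetric])
        then show ?thesis by (simp add: \<eta>_def)
      qed
      finally show ?thesis .
    qed
    define V where "V = var_size n x"
    define F where "F = tilted n x"
    \<comment> \<open>Dividing by the Gaussian exp(-V t^2 / 2) removes the linear term of the
      logarithmic derivative; what is left, \<open>E\<close>, is bounded by \<open>\<delta>\<close>
      on the interval.\<close>
    define G where "G = (\<lambda>t. F t * complex_of_real (exp (V * t\<^sup>2 / 2)))"
    define E where "E = (\<lambda>t. \<i> * (logderiv n x t - of_nat n - \<i> * of_real (V * t)))"
    have dG: "(G has_vector_derivative E t * G t) (at t within S)" for t S
    proof -
      have "((\<lambda>t. exp (V * t\<^sup>2 / 2)) has_real_derivative V * t * exp (V * t\<^sup>2 / 2)) (at t within S)"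
        by (auto intro!: derivative_eq_intros)
      then have "((\<lambda>t. complex_of_real (exp (V * t\<^sup>2 / 2))) has_vector_derivative
          of_real (V * t * exp (V * t\<^sup>2 / 2))) (at t within S)"
        by (intro has_vector_derivative_of_real) (simp add: has_real_derivative_iff_has_vector_derivative)
      from has_vector_derivative_mult[OF has_vector_derivative_tilted[OF x(1), of n t S] this]
      have "(G has_vector_derivative F t * of_real (V * t * exp (V * t\<^sup>2 / 2))
         + \<i> * (logderiv n x t - of_nat n) * F t * complex_of_real (exp (V * t\<^sup>2 / 2))) (at t within S)"
        by (simp add: G_def F_def)
      moreover have "F t * of_real (V * t * exp (V * t\<^sup>2 / 2))
         + \<i> * (logderiv n x t - of_nat n) * F t * complex_of_real (exp (V * t\<^sup>2 / 2)) = E t * G t"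
        by (simp add: E_def G_def algebra_simps)
      ultimately show ?thesis by simp
    qed
    have E: "cmod (E t) \<le> \<delta>" if t: "t \<in> {-T..T}" for t
    proof -
      have "E t = \<i> * ((logderiv n x t - of_real (mean_size n x) - \<i> * of_real (V * t))
          + of_real (mean_size n x - real n))"
        by (simp add: E_def algebra_simps)
      then have "cmod (E t) \<le> cmod (logderiv n x t - of_real (mean_size n x) - \<i> * of_real (V * t))
          + \<bar>mean_size n x - real n\<bar>"
        using norm_triangle_ineq[of "logderiv n x t - of_real (mean_size n x) - \<i> * of_real (V * t)"
            "of_real (mean_size n x - real n)"] by (simp only: norm_mult norm_ii mult_1 norm_of_real)
      also have "\<dots> \<le> third_size n x * t\<^sup>2 + 771 / x"
        using logderiv_taylor[OF x(1), of n t] mean_size_bounds[OF s] by (intro add_mono) (auto simp: V_def)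
      also have "third_size n x * t\<^sup>2 \<le> 256 / x ^ 4 * T\<^sup>2"
      proof -
        have "\<bar>t\<bar> \<le> \<bar>T\<bar>" using t by auto
        then have "t\<^sup>2 \<le> T\<^sup>2" by (simp only: abs_le_square_iff)
        then show ?thesis using third_size_le[OF x(1), of n] x by (intro mult_mono) auto
      qed
      finally show ?thesis by (simp add: \<delta>_def)
    qed
    have F0: "F 0 = 1" using tilted_0[OF x(1)] by (simp add: F_def)
    have Re_F: "exp (- (V * t\<^sup>2 / 2)) / 2 \<le> Re (F t)" if t: "t \<in> {-T..T}" for t
    proof -
      have "cmod (G t - 1) \<le> 1 / 2"
        by (rule norm_diff_1_le_of_logderiv[OF T0 T dG E _ t]) (auto simp: G_def F0)
      then have "1 / 2 \<le> Re (G t)"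
        using abs_Re_le_cmod[of "G t - 1"] by simp
      also have "Re (G t) = Re (F t) * exp (V * t\<^sup>2 / 2)" by (simp add: G_def)
      finally show ?thesis by (simp add: exp_minus field_simps)
    qed
    \<comment> \<open>Outside the interval t^2/x^3 >= L^2, so one factor of the dominating function
      is at most 1/(1 + L^2) and the other is the Lorentzian.\<close>
    define h where "h = (\<lambda>t. Re (F t) + D / (1 + L\<^sup>2) * (1 / (1 + t\<^sup>2 / x ^ 3)))"
    have w_pos: "0 < 1 + t\<^sup>2 / x ^ 3" for t using x by (simp add: add_pos_nonneg)
    have L_pos: "0 < 1 + L\<^sup>2" by (simp add: add_pos_nonneg)
    have h_ge: "Re (F t) \<le> h t" for t
      using D w_pos[of t] L_pos by (simp add: h_def)
    have h_nonneg: "0 \<le> h t" if t: "t \<in> {-pi..pi}" for t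
    proof (cases "t \<in> {-T..T}")
      case True
      have "0 \<le> exp (- (V * t\<^sup>2 / 2)) / 2" by simp
      with Re_F[OF True] h_ge[of t] show ?thesis by linarith
    next
      case False
      define w where "w = t\<^sup>2 / x ^ 3"
      have "\<bar>T\<bar> \<le> \<bar>t\<bar>" using False T0 by auto
      then have "T\<^sup>2 \<le> t\<^sup>2" by (simp only: abs_le_square_iff)
      then have w: "L\<^sup>2 \<le> w" using x by (simp add: w_def T_def power_mult_distrib c field_simps)
      have "- Re (F t) \<le> cmod (F t)" using abs_Re_le_cmod[of "F t"] by linarith
      also have "\<dots> \<le> D / (1 + w)\<^sup>2"
        unfolding F_def norm_tilted D_def w_def using t by (intro euler_char_dom[OF s]) auto
      also have "\<dots> \<le> D / ((1 + L\<^sup>2) * (1 + w))"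
        using w D L_pos unfolding power2_eq_square[of "1 + w"]
        by (intro divide_left_mono mult_right_mono mult_pos_pos add_pos_nonneg) (auto intro: order_trans[OF zero_le_power2])
      finally show ?thesis by (simp add: h_def w_def)
    qed
    have contF: "continuous_on S F" for S unfolding F_def by (rule continuous_on_tilted[OF x(1)])
    have conth: "continuous_on S h" for S
      unfolding h_def using w_pos x(1) by (intro continuous_intros contF) (auto simp: less_imp_neq[symmetric])
    have "c \<le> 1" unfolding c_def using x by (simp add: power_le_one)
    then have c_pi: "c \<le> pi" using pi_gt3 by linarith
    \<comment> \<open>For |t| <= c the exponent V t^2 / 2 is at most 16, since V <= 32/x^3 and c^2 =
      x^3.\<close>
    have "2 * c * (exp (- 16) / 2) = integral {-c..c} (\<lambda>_. exp (- 16) / 2)" using c by simp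
    also have "\<dots> \<le> integral {-c..c} h"
    proof (rule integral_le)
      fix t assume t: "t \<in> {-c..c}"
      have "1 * c \<le> L * c" using L1 c by (intro mult_right_mono) auto
      then have tT: "t \<in> {-T..T}" using t by (auto simp: T_def)
      have "\<bar>t\<bar> \<le> \<bar>c\<bar>" using t by auto
      then have "t\<^sup>2 \<le> c\<^sup>2" by (simp only: abs_le_square_iff)
      then have "V * t\<^sup>2 \<le> 32 / x ^ 3 * x ^ 3"
        using var_size_le[OF x(1), of n] x unfolding V_def c(2) by (intro mult_mono) auto
      also have "\<dots> = 32" using x by simp
      finally have "exp (- 16) / 2 \<le> exp (- (V * t\<^sup>2 / 2)) / 2" by simp
      with Re_F[OF tT] h_ge[of t] show "exp (- 16) / 2 \<le> h t" by linarith
    qed (auto intro: integrable_continuous_interval conth)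
    also have "\<dots> \<le> integral {-pi..pi} h"
      using c_pi h_nonneg by (intro integral_subset_le integrable_continuous_interval conth) auto
    also have "integral {-pi..pi} h = Re (integral {-pi..pi} F)
        + D / (1 + L\<^sup>2) * integral {-pi..pi} (\<lambda>t. 1 / (1 + t\<^sup>2 / x ^ 3))"
    proof -
      have FI: "F integrable_on {-pi..pi}" by (rule integrable_continuous_interval[OF contF])
      have "integral {-pi..pi} (\<lambda>t. Re (F t)) = Re (integral {-pi..pi} F)"
        using integral_linear[OF FI bounded_linear_Re] by (simp add: o_def)
      moreover have "(\<lambda>t. Re (F t)) integrable_on {-pi..pi}"
        by (intro integrable_continuous_interval continuous_intros contF)
      ultimately show ?thesis
        unfolding h_def
        by (simp only: integral_add[OF _ integrable_on_mult_right[OF lorentz_integral_le(2)[OF x(1)]]]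
            integral_mult_right)
    qed
    also have "D / (1 + L\<^sup>2) * integral {-pi..pi} (\<lambda>t. 1 / (1 + t\<^sup>2 / x ^ 3)) \<le> D / (1 + L\<^sup>2) * (4 * c)"
      using lorentz_integral_le(1)[OF x(1)] D L_pos unfolding c_def by (intro mult_left_mono) auto
    also have "D / (1 + L\<^sup>2) * (4 * c) = 4 * (D / (1 + L\<^sup>2)) * c" by simp
    also have "\<dots> \<le> exp (- 16) / 2 * c" using tail c by (intro mult_right_mono) auto
    finally have "2 * c * (exp (- 16) / 2) \<le> Re (integral {-pi..pi} F) + exp (- 16) / 2 * c"
      by simp
    moreover have "2 * c * (exp (- 16) / 2) = exp (- 16) * c" "exp (- 16) / 2 * c = exp (- 16) * c / 2"
      by simp_all
    ultimately have "exp (- 16) / 2 * c \<le> Re (integral {-pi..pi} F)" by linarith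
    then show "exp (- 16) / 2 * sqrt (x ^ 3) \<le> Re (integral {-pi..pi} (tilted n x))"
      by (simp only: F_def c_def)
  qed
qed

section \<open>Perturbed saddle point integrals\<close>

text \<open>The pair of bounds is closed under products, with \<open>d\<close> and \<open>a\<close> adding up.\<close>

definition approx1 :: "complex \<Rightarrow> complex \<Rightarrow> real \<Rightarrow> bool" where
  "approx1 f d a \<longleftrightarrow> cmod (f - 1) \<le> exp a - 1 \<and> cmod (f - 1 - d) \<le> exp a - 1 - a"

text \<open>The cross terms fit exactly: (e^a - 1) + (e^b - 1) + (e^a - 1)(e^b - 1) = e^(a+b) -
  1.\<close>

lemma approx1_mult:
  assumes "approx1 f d a" "approx1 g e b"
  shows "approx1 (f * g) (d + e) (a + b)"
proof -
  have f: "cmod (f - 1) \<le> exp a - 1" "cmod (f - 1 - d) \<le> exp a - 1 - a"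
    and g: "cmod (g - 1) \<le> exp b - 1" "cmod (g - 1 - e) \<le> exp b - 1 - b"
    using assms by (auto simp: approx1_def)
  have fg: "cmod ((f - 1) * (g - 1)) \<le> (exp a - 1) * (exp b - 1)"
    unfolding norm_mult by (rule mult_mono) (use f(1) g(1) order_trans[OF norm_ge_zero f(1)] in auto)
  have eq: "f * g - 1 = (f - 1) + (g - 1) + (f - 1) * (g - 1)"
    "f * g - 1 - (d + e) = (f - 1 - d) + (g - 1 - e) + (f - 1) * (g - 1)"
    by (simp_all add: algebra_simps)
  have tri: "cmod (u + v + w) \<le> cmod u + cmod v + cmod w" for u v w
    by (intro norm_triangle_le add_right_mono norm_triangle_ineq)
  have "cmod (f * g - 1) \<le> exp a - 1 + (exp b - 1) + (exp a - 1) * (exp b - 1)"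
    unfolding eq(1) using tri[of "f - 1" "g - 1" "(f - 1) * (g - 1)"] f g fg by linarith
  moreover have "cmod (f * g - 1 - (d + e)) \<le> (exp a - 1 - a) + (exp b - 1 - b) + (exp a - 1) * (exp b - 1)"
    unfolding eq(2) using tri[of "f - 1 - d" "g - 1 - e" "(f - 1) * (g - 1)"] f g fg by linarith
  ultimately show ?thesis by (simp add: approx1_def exp_add algebra_simps)
qed

lemma approx1_one: "approx1 1 0 0"
  by (simp add: approx1_def)

lemma approx1_prod:
  assumes "finite J" "\<And>j. j \<in> J \<Longrightarrow> approx1 (f j) (d j) (a j)"
  shows "approx1 (\<Prod>j\<in>J. f j) (\<Sum>j\<in>J. d j) (\<Sum>j\<in>J. a j)"
  using assms by (induction J rule: finite_induct) (auto intro: approx1_mult approx1_one)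

lemma approx1_basic: "cmod d \<le> a \<Longrightarrow> approx1 (1 + d) d a"
proof -
  have "a \<le> exp a - 1" using exp_ge_add_one_self[of a] by linarith
  then show "cmod d \<le> a \<Longrightarrow> approx1 (1 + d) d a" by (auto simp: approx1_def)
qed

lemma exp_minus_linear_le:
  assumes "0 \<le> (a::real)"
  shows "exp a - 1 - a \<le> a\<^sup>2 * exp a"
proof -
  have "1 - a \<le> exp (- a)" using exp_ge_add_one_self[of "- a"] by simp
  then have "(1 - a) * exp a \<le> exp (- a) * exp a" by (intro mult_right_mono) auto
  then have 1: "exp a - 1 \<le> a * exp a" by (simp add: algebra_simps flip: exp_add)
  have "exp a - 1 - a \<le> a * exp a - a" using 1 by simp
  also have "\<dots> = a * (exp a - 1)" by (simp add: algebra_simps)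
  also have "\<dots> \<le> a * (a * exp a)" using assms 1 by (intro mult_left_mono) auto
  finally show ?thesis by (simp add: power2_eq_square)
qed

text \<open>The mean of the geometric variable with ratio q^j; it is also the weight with which
  cis(j t) - 1 enters \<open>qfactor x j t\<close>.\<close>

definition qw :: "real \<Rightarrow> nat \<Rightarrow> real" where
  "qw x j = qp x j / (1 - qp x j)"

text \<open>The reciprocal of a factor of \<open>euler_char\<close>.\<close>

definition qfactor :: "real \<Rightarrow> nat \<Rightarrow> real \<Rightarrow> complex" where
  "qfactor x j t = (1 - of_real (qp x j) * cis (real j * t)) / (1 - of_real (qp x j))"

text \<open>For \<open>J1 = {a+1..n}\<close>, \<open>J2 = {b+1..a+b}\<close> and \<open>r = n - N\<close>, the product of \<^term>\<open>tilted n x t\<close> and the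
  following factor is the Fourier integrand of the \<open>N\<close>-th coefficient of the Gaussian binomial.\<close>

definition perturb :: "real \<Rightarrow> nat set \<Rightarrow> nat set \<Rightarrow> real \<Rightarrow> real \<Rightarrow> complex" where
  "perturb x J1 J2 r t = cis (r * t) * ((\<Prod>j\<in>J1. qfactor x j t) * (\<Prod>j\<in>J2. qfactor x j t))"

text \<open>Order 1 enters the linear coefficient of the perturbing factor, order 2 its quadratic
  remainder, and order 0 bounds it at all t.\<close>

definition qmoment :: "real \<Rightarrow> nat set \<Rightarrow> nat set \<Rightarrow> nat \<Rightarrow> real" where
  "qmoment x J1 J2 k = (\<Sum>j\<in>J1. real j ^ k * qw x j) + (\<Sum>j\<in>J2. real j ^ k * qw x j)"

lemma qw_nonneg: "0 < x \<Longrightarrow> 0 \<le> qw x j"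
  using qp_pos[of x j] qp_le_1[of x j] by (simp add: qw_def)

lemma qmoment_nonneg: "0 < x \<Longrightarrow> 0 \<le> qmoment x J1 J2 k"
  by (auto simp: qmoment_def intro!: add_nonneg_nonneg sum_nonneg mult_nonneg_nonneg qw_nonneg)

lemma qfactor_eq:
  assumes "0 < x" "0 < j"
  shows "qfactor x j t = 1 + - (of_real (qw x j) * (cis (real j * t) - 1))"
proof -
  have "1 - complex_of_real (qp x j) \<noteq> 0" using qp_lt_1[OF assms] by (auto simp: complex_eq_iff)
  then show ?thesis by (simp add: qfactor_def qw_def field_simps)
qed

lemma perturb_approx:
  assumes x: "0 < x" and J: "finite J1" "finite J2" "0 \<notin> J1" "0 \<notin> J2" and r: "0 \<le> r"
    and A: "r + qmoment x J1 J2 1 \<le> A" "qmoment x J1 J2 2 \<le> A\<^sup>2"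
  shows "cmod (perturb x J1 J2 r t - 1 - \<i> * of_real ((r - qmoment x J1 J2 1) * t))
     \<le> 2 * A\<^sup>2 * t\<^sup>2 * exp (A * \<bar>t\<bar>)"
proof -
  define d where "d = (\<lambda>j. - (complex_of_real (qw x j) * (cis (real j * t) - 1)))"
  \<comment> \<open>Linearisation in two stages: \<Delta> is the sum of the deviations of the single
    factors from 1, each still a function of t; only afterwards is it expanded in t.\<close>
  define \<Delta> where "\<Delta> = (cis (r * t) - 1) + ((\<Sum>j\<in>J1. d j) + (\<Sum>j\<in>J2. d j))"
  define a where "a = (r + qmoment x J1 J2 1) * \<bar>t\<bar>"
  have a0: "0 \<le> a" using r qmoment_nonneg[OF x] by (simp add: a_def)
  have a_le: "a \<le> A * \<bar>t\<bar>" unfolding a_def using A by (intro mult_right_mono) auto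
  have A0: "0 \<le> A" using A(1) r qmoment_nonneg[OF x, of J1 J2 1] by linarith
  have f: "approx1 (qfactor x j t) (d j) (real j * qw x j * \<bar>t\<bar>)" if "0 < j" for j
    unfolding qfactor_eq[OF x that] d_def
  proof (rule approx1_basic)
    have "cmod (- (complex_of_real (qw x j) * (cis (real j * t) - 1))) = qw x j * cmod (cis (real j * t) - 1)"
      using qw_nonneg[OF x, of j] by (simp add: norm_mult)
    also have "\<dots> \<le> qw x j * \<bar>real j * t\<bar>"
      using qw_nonneg[OF x, of j] by (intro mult_left_mono norm_cis_approx)
    finally show "cmod (- (complex_of_real (qw x j) * (cis (real j * t) - 1))) \<le> real j * qw x j * \<bar>t\<bar>"
      by (simp add: abs_mult mult_ac)
  qed
  have "approx1 (cis (r * t)) (cis (r * t) - 1) (r * \<bar>t\<bar>)"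
    using approx1_basic[of "cis (r * t) - 1" "r * \<bar>t\<bar>"] norm_cis_approx(1)[of "r * t"] r
    by (simp add: abs_mult)
  moreover have "approx1 (\<Prod>j\<in>J1. qfactor x j t) (\<Sum>j\<in>J1. d j) (\<Sum>j\<in>J1. real j * qw x j * \<bar>t\<bar>)"
    "approx1 (\<Prod>j\<in>J2. qfactor x j t) (\<Sum>j\<in>J2. d j) (\<Sum>j\<in>J2. real j * qw x j * \<bar>t\<bar>)"
    using J f by (auto intro!: approx1_prod simp: gr0_conv_Suc) (metis gr0_conv_Suc not_gr_zero)+
  ultimately have "approx1 (perturb x J1 J2 r t) \<Delta>
      (r * \<bar>t\<bar> + ((\<Sum>j\<in>J1. real j * qw x j * \<bar>t\<bar>) + (\<Sum>j\<in>J2. real j * qw x j * \<bar>t\<bar>)))"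
    unfolding perturb_def \<Delta>_def by (intro approx1_mult)
  also have "r * \<bar>t\<bar> + ((\<Sum>j\<in>J1. real j * qw x j * \<bar>t\<bar>) + (\<Sum>j\<in>J2. real j * qw x j * \<bar>t\<bar>)) = a"
    by (simp add: a_def qmoment_def distrib_right sum_distrib_right)
  finally have "cmod (perturb x J1 J2 r t - 1 - \<Delta>) \<le> exp a - 1 - a"
    by (simp add: approx1_def)
  also have "\<dots> \<le> a\<^sup>2 * exp a" by (rule exp_minus_linear_le[OF a0])
  also have "\<dots> \<le> (A * \<bar>t\<bar>)\<^sup>2 * exp (A * \<bar>t\<bar>)"
    using a0 a_le by (intro mult_mono power_mono) auto
  finally have 1: "cmod (perturb x J1 J2 r t - 1 - \<Delta>) \<le> A\<^sup>2 * t\<^sup>2 * exp (A * \<bar>t\<bar>)"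
    by (simp add: power_mult_distrib)
  have lin: "cmod (d j - \<i> * of_real (- (real j * qw x j * t))) \<le> real j ^ 2 * qw x j * (t\<^sup>2 / 2)" for j
  proof -
    have "d j - \<i> * of_real (- (real j * qw x j * t)) = - (of_real (qw x j) * (cis (real j * t) - 1 - \<i> * of_real (real j * t)))"
      by (simp add: d_def algebra_simps)
    then have "cmod (d j - \<i> * of_real (- (real j * qw x j * t)))
        = qw x j * cmod (cis (real j * t) - 1 - \<i> * of_real (real j * t))"
      using qw_nonneg[OF x, of j] by (simp only: norm_minus_cancel norm_mult norm_of_real abs_of_nonneg)
    also have "\<dots> \<le> qw x j * ((real j * t)\<^sup>2 / 2)"
      using qw_nonneg[OF x, of j] by (intro mult_left_mono norm_cis_approx)
    finally show ?thesis by (simp add: power_mult_distrib mult_ac)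
  qed
  have sums: "cmod ((\<Sum>j\<in>J. d j) - \<i> * of_real (- (\<Sum>j\<in>J. real j * qw x j) * t))
      \<le> (\<Sum>j\<in>J. real j ^ 2 * qw x j) * (t\<^sup>2 / 2)" for J
  proof -
    have "(\<Sum>j\<in>J. d j) - \<i> * of_real (- (\<Sum>j\<in>J. real j * qw x j) * t)
        = (\<Sum>j\<in>J. d j - \<i> * of_real (- (real j * qw x j * t)))"
      by (simp add: sum_subtractf sum_distrib_left sum_distrib_right sum_negf sum.distrib mult_ac)
    then show ?thesis
      unfolding sum_distrib_right using lin by (auto intro!: sum_norm_le)
  qed
  have "\<Delta> - \<i> * of_real ((r - qmoment x J1 J2 1) * t)
      = (cis (r * t) - 1 - \<i> * of_real (r * t))
        + ((\<Sum>j\<in>J1. d j) - \<i> * of_real (- (\<Sum>j\<in>J1. real j * qw x j) * t))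
        + ((\<Sum>j\<in>J2. d j) - \<i> * of_real (- (\<Sum>j\<in>J2. real j * qw x j) * t))"
    by (simp add: \<Delta>_def qmoment_def algebra_simps)
  then have "cmod (\<Delta> - \<i> * of_real ((r - qmoment x J1 J2 1) * t))
      \<le> (r * t)\<^sup>2 / 2 + (\<Sum>j\<in>J1. real j ^ 2 * qw x j) * (t\<^sup>2 / 2) + (\<Sum>j\<in>J2. real j ^ 2 * qw x j) * (t\<^sup>2 / 2)"
    using norm_cis_approx(2)[of "r * t"] sums[of J1] sums[of J2]
    by (simp only:) (intro norm_triangle_le add_mono order_refl; assumption?)
  also have "\<dots> = (r\<^sup>2 + qmoment x J1 J2 2) * (t\<^sup>2 / 2)"
    by (simp add: qmoment_def power_mult_distrib algebra_simps)
  also have "\<dots> \<le> (A\<^sup>2 + A\<^sup>2) * (t\<^sup>2 / 2)"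
    using A r qmoment_nonneg[OF x, of J1 J2 1] by (intro mult_right_mono add_mono power_mono) auto
  also have "\<dots> = A\<^sup>2 * t\<^sup>2 * 1" by simp
  also have "\<dots> \<le> A\<^sup>2 * t\<^sup>2 * exp (A * \<bar>t\<bar>)"
    using A0 by (intro mult_left_mono) auto
  finally have 2: "cmod (\<Delta> - \<i> * of_real ((r - qmoment x J1 J2 1) * t)) \<le> A\<^sup>2 * t\<^sup>2 * exp (A * \<bar>t\<bar>)" .
  have "cmod ((perturb x J1 J2 r t - 1 - \<Delta>) + (\<Delta> - \<i> * of_real ((r - qmoment x J1 J2 1) * t)))
      \<le> A\<^sup>2 * t\<^sup>2 * exp (A * \<bar>t\<bar>) + A\<^sup>2 * t\<^sup>2 * exp (A * \<bar>t\<bar>)"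
    using 1 2 by (rule order_trans[OF norm_triangle_ineq add_mono])
  then show ?thesis by (simp only: diff_add_cancel add_diff_eq mult_2 distrib_right)
qed

text \<open>A bound without growth in t, for the range |t| >= x, where the exp(A |t|) of
  \<open>perturb_approx\<close> may exceed the decay of \<open>tilted\<close>.\<close>

lemma norm_perturb_le:
  assumes x: "0 < x" and J: "finite J1" "finite J2" "0 \<notin> J1" "0 \<notin> J2"
  shows "cmod (perturb x J1 J2 r t) \<le> exp (2 * qmoment x J1 J2 0)"
proof -
  have f: "cmod (qfactor x j t) \<le> exp (2 * qw x j)" if "0 < j" for j
  proof -
    have "cmod (cis (real j * t) - 1) \<le> 2"
      using norm_triangle_ineq4[of "cis (real j * t)" 1] by simp
    then have "cmod (- (of_real (qw x j) * (cis (real j * t) - 1))) \<le> qw x j * 2"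
      using qw_nonneg[OF x, of j] by (simp add: norm_mult mult_left_mono)
    then have "cmod (qfactor x j t) \<le> 1 + 2 * qw x j"
      unfolding qfactor_eq[OF x that]
      using norm_triangle_ineq[of 1 "- (of_real (qw x j) * (cis (real j * t) - 1))"] by simp
    also have "\<dots> \<le> exp (2 * qw x j)" by (rule exp_ge_add_one_self)
    finally show ?thesis .
  qed
  have p: "cmod (\<Prod>j\<in>J. qfactor x j t) \<le> exp (2 * (\<Sum>j\<in>J. qw x j))" if "finite J" "0 \<notin> J" for J
  proof -
    have "cmod (\<Prod>j\<in>J. qfactor x j t) \<le> (\<Prod>j\<in>J. exp (2 * qw x j))"
      unfolding prod_norm[symmetric] using f that by (intro prod_mono) (metis norm_ge_zero not_gr_zero)
    also have "\<dots> = exp (2 * (\<Sum>j\<in>J. qw x j))"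
      using that by (simp add: exp_sum sum_distrib_left)
    finally show ?thesis .
  qed
  have "cmod (perturb x J1 J2 r t) \<le> exp (2 * (\<Sum>j\<in>J1. qw x j)) * exp (2 * (\<Sum>j\<in>J2. qw x j))"
    unfolding perturb_def norm_mult norm_cis mult_1 using p J by (intro mult_mono) auto
  also have "\<dots> = exp (2 * qmoment x J1 J2 0)"
    by (simp add: qmoment_def distrib_left flip: exp_add)
  finally show ?thesis .
qed

lemma continuous_on_perturb: "continuous_on S (perturb x J1 J2 r)"
proof -
  have "continuous_on S (\<lambda>t. qfactor x j t)" for j
    unfolding qfactor_def divide_inverse by (intro continuous_intros)
  then show ?thesis
    unfolding perturb_def [abs_def] by (intro continuous_intros) auto
qed

text \<open>The linear term meets the small first moment, the remainder a second moment of order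
  x^3; both are O(A^2 x^3) relative to the mass x^(3/2).\<close>

lemma integral_perturb:
  assumes s: "saddle n x" and J: "finite J1" "finite J2" "0 \<notin> J1" "0 \<notin> J2" and r: "0 \<le> r"
    and A: "1 / x \<le> A" "A\<^sup>2 * x ^ 3 \<le> 1" "r + qmoment x J1 J2 1 \<le> A" "qmoment x J1 J2 2 \<le> A\<^sup>2"
    and W: "qmoment x J1 J2 0 \<le> 1 / (800 * x)"
  shows "cmod (integral {-pi..pi} (\<lambda>t. tilted n x t * perturb x J1 J2 r t) - integral {-pi..pi} (tilted n x))
     \<le> 25012 * dom_const * A\<^sup>2 * x ^ 3 * sqrt (x ^ 3)"
proof -
  note x = saddleD[OF s]
  let ?F = "tilted n x" and ?\<psi> = "perturb x J1 J2 r" and ?s = "sqrt (x ^ 3)"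
  define \<beta> where "\<beta> = r - qmoment x J1 J2 1"
  have A0: "0 < A" using A(1) x by (smt (verit) divide_pos_pos)
  have Ax: "1 \<le> A * x" using A(1) x by (simp add: field_simps)
  let ?R = "\<lambda>t. ?\<psi> t - 1 - \<i> * of_real (\<beta> * t)"
  note [continuous_intros] = continuous_on_tilted[OF x(1)] continuous_on_perturb
  have int: "?F integrable_on {-pi..pi}" "(\<lambda>t. ?F t * ?R t) integrable_on {-pi..pi}"
    "(\<lambda>t. of_real t * ?F t) integrable_on {-pi..pi}" "(\<lambda>t. ?F t * ?\<psi> t) integrable_on {-pi..pi}"
    by (rule integrable_continuous_interval; intro continuous_intros)+
  have "integral {-pi..pi} (\<lambda>t. ?F t * ?\<psi> t)
      = integral {-pi..pi} (\<lambda>t. ?F t + \<i> * of_real \<beta> * (of_real t * ?F t) + ?F t * ?R t)"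
    by (rule integral_cong) (simp add: algebra_simps)
  also have "\<dots> = integral {-pi..pi} ?F + \<i> * of_real \<beta> * integral {-pi..pi} (\<lambda>t. of_real t * ?F t)
      + integral {-pi..pi} (\<lambda>t. ?F t * ?R t)"
    using int by (simp add: integral_add integrable_add integrable_on_mult_right)
  finally have eq: "integral {-pi..pi} (\<lambda>t. ?F t * ?\<psi> t) - integral {-pi..pi} ?F
      = \<i> * of_real \<beta> * integral {-pi..pi} (\<lambda>t. of_real t * ?F t) + integral {-pi..pi} (\<lambda>t. ?F t * ?R t)"
    by simp
  have \<beta>: "\<bar>\<beta>\<bar> \<le> A" using A(3) r qmoment_nonneg[OF x(1), of J1 J2 1] by (simp add: \<beta>_def abs_le_iff)
  have R: "cmod (integral {-pi..pi} (\<lambda>t. ?F t * ?R t)) \<le> 4 * (3 * A\<^sup>2) * dom_const * x ^ 3 * ?s"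
  proof (rule norm_integral_dom2[OF x(1) int(2)])
    fix t :: real assume t: "\<bar>t\<bar> \<le> pi"
    let ?d = "dom_const / (1 + t\<^sup>2 / x ^ 3)\<^sup>2"
    have d: "0 \<le> ?d" using dom_const_pos by simp
    show "cmod (?F t * ?R t) \<le> 3 * A\<^sup>2 * t\<^sup>2 * ?d"
    proof (cases "\<bar>t\<bar> \<le> x")
      case True
      have "cmod (?F t * ?R t) \<le> cmod (?F t) * (2 * A\<^sup>2 * t\<^sup>2 * exp (A * \<bar>t\<bar>))"
        unfolding norm_mult \<beta>_def using perturb_approx[OF x(1) J r A(3,4)] by (intro mult_left_mono) auto
      also have "\<dots> = 2 * A\<^sup>2 * t\<^sup>2 * (cmod (euler_char n x t) * exp (A * \<bar>t\<bar>))"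
        by (simp add: norm_tilted)
      also have "\<dots> \<le> 2 * A\<^sup>2 * t\<^sup>2 * ?d"
        using euler_char_dom_near[OF s True _ A(2)] A0 by (intro mult_left_mono) auto
      also have "\<dots> \<le> 3 * A\<^sup>2 * t\<^sup>2 * ?d"
        using d by (intro mult_right_mono) auto
      finally show ?thesis .
    next
      case False
      then have "x \<le> \<bar>t\<bar>" by simp
      have "A * x \<le> A * \<bar>t\<bar>" using False A0 by (intro mult_left_mono) auto
      \<comment> \<open>Away from the centre A |t| >= 1, so constants and linear terms are bounded
        by multiples of (A t)^2, and the same moment bound serves for every t.\<close>
      then have At: "1 \<le> A * \<bar>t\<bar>" using Ax by linarith
      then have At2: "A * \<bar>t\<bar> \<le> (A * \<bar>t\<bar>)\<^sup>2"
        using mult_right_mono[OF At, of "A * \<bar>t\<bar>"] by (simp only: power2_eq_square mult_1)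
      let ?e = "exp (2 * qmoment x J1 J2 0)"
      have e1: "1 \<le> ?e" using qmoment_nonneg[OF x(1), of J1 J2 0] by simp
      have "cmod (?R t) \<le> cmod (?\<psi> t) + 1 + \<bar>\<beta> * t\<bar>"
        using norm_triangle_ineq4[of "?\<psi> t - 1" "\<i> * of_real (\<beta> * t)"] norm_triangle_ineq4[of "?\<psi> t" 1]
        by (simp only: norm_mult norm_ii norm_of_real norm_one mult_1)
      also have "\<dots> \<le> ?e + 1 + A * \<bar>t\<bar>"
        unfolding abs_mult using norm_perturb_le[OF x(1) J] \<beta> by (intro add_mono mult_right_mono) auto
      also have "\<dots> \<le> ?e * (1 + 1 + A * \<bar>t\<bar>)"
        using mult_right_mono[OF e1, of "1 + A * \<bar>t\<bar>"] At by (simp add: algebra_simps)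
      also have "\<dots> \<le> ?e * (3 * (A * \<bar>t\<bar>)\<^sup>2)"
        using At At2 by (intro mult_left_mono) auto
      also have "\<dots> \<le> exp (1 / (400 * x)) * (3 * (A * \<bar>t\<bar>)\<^sup>2)"
        using W by (intro mult_right_mono) auto
      finally have "cmod (?F t * ?R t) \<le> cmod (euler_char n x t) * (exp (1 / (400 * x)) * (3 * (A * \<bar>t\<bar>)\<^sup>2))"
        unfolding norm_mult norm_tilted by (intro mult_left_mono) auto
      also have "\<dots> = 3 * A\<^sup>2 * t\<^sup>2 * (cmod (euler_char n x t) * exp (1 / (400 * x)))"
        by (simp add: power_mult_distrib)
      also have "\<dots> \<le> 3 * A\<^sup>2 * t\<^sup>2 * ?d"
        using euler_char_dom_far[OF s \<open>x \<le> \<bar>t\<bar>\<close> t] by (intro mult_left_mono) auto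
      finally show ?thesis .
    qed
  qed simp
  have "cmod (\<i> * of_real \<beta> * integral {-pi..pi} (\<lambda>t. of_real t * ?F t))
      = \<bar>\<beta>\<bar> * cmod (integral {-pi..pi} (\<lambda>t. of_real t * ?F t))"
    by (simp add: norm_mult)
  also have "\<dots> \<le> A * (25000 * dom_const * x\<^sup>2 * ?s)"
    using first_moment_tilted[OF s] \<beta> A0 by (intro mult_mono) auto
  \<comment> \<open>The first moment yields A x^2; the condition 1 <= A x turns this into A^2
    x^3.\<close>
  also have "\<dots> \<le> (A * (A * x)) * (25000 * dom_const * x\<^sup>2 * ?s)"
    using mult_left_mono[OF Ax, of A] A0 dom_const_pos x by (intro mult_right_mono mult_nonneg_nonneg) auto
  also have "\<dots> = 25000 * dom_const * A\<^sup>2 * x ^ 3 * ?s"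
    by (simp add: power2_eq_square power3_eq_cube)
  finally have "cmod (\<i> * of_real \<beta> * integral {-pi..pi} (\<lambda>t. of_real t * ?F t))
      \<le> 25000 * dom_const * A\<^sup>2 * x ^ 3 * ?s" .
  from order_trans[OF norm_triangle_ineq add_mono[OF this R]]
  show ?thesis unfolding eq by (simp add: algebra_simps)
qed

section \<open>Counting partitions in a rectangle\<close>

lemma integral_cis:
  assumes "k \<noteq> N"
  shows "((\<lambda>t. cis ((real k - real N) * t)) has_integral 0) {-pi..pi}"
proof -
  define a where "a = real k - real N"
  have a: "a \<noteq> 0" using assms by (simp add: a_def)
  have "((\<lambda>t. \<i> * of_real a * cis (a * t)) has_integral cis (a * pi) - cis (a * (- pi))) {-pi..pi}"
    by (rule fundamental_theorem_of_calculus) (auto intro: has_vector_derivative_cis_mult)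
  moreover have "cis (a * pi) = cis (a * (- pi))"
  proof -
    have "cis (a * pi) = cis (real k * pi) * cis (real N * (- pi))"
      "cis (a * (- pi)) = cis (real k * (- pi)) * cis (real N * pi)"
      by (simp_all add: cis_mult a_def algebra_simps)
    then show ?thesis by (simp only: cis_int_pi)
  qed
  ultimately have "((\<lambda>t. inverse (\<i> * of_real a) * (\<i> * of_real a * cis (a * t))) has_integral
      inverse (\<i> * of_real a) * 0) {-pi..pi}"
    by (intro has_integral_mult_right) simp
  moreover have "inverse (\<i> * of_real a) * (\<i> * of_real a * cis (a * t)) = cis (a * t)" for t
    using a by (simp add: field_simps)
  ultimately show ?thesis by (simp only: a_def mult_zero_right)
qed

text \<open>Cauchy's coefficient formula on the circle of radius e^(-x), by orthogonality of the
  characters.\<close>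

lemma coefficient_integral:
  assumes S: "finite (S :: nat list set)"
  shows "((\<lambda>t. (\<Sum>xs\<in>S. (of_real (exp (- x)) * cis t) ^ sum_list xs) * cis (- real N * t)) has_integral
     of_real (2 * pi * qp x N * card {xs\<in>S. sum_list xs = N})) {-pi..pi}"
proof -
  have "((\<lambda>t. \<Sum>xs\<in>S. of_real (qp x (sum_list xs)) * cis ((real (sum_list xs) - real N) * t)) has_integral
      (\<Sum>xs\<in>S. of_real (qp x (sum_list xs)) * (if sum_list xs = N then of_real (2 * pi) else 0))) {-pi..pi}"
  proof (rule has_integral_sum[OF S])
    fix xs assume "xs \<in> S"
    show "((\<lambda>t. of_real (qp x (sum_list xs)) * cis ((real (sum_list xs) - real N) * t)) has_integral
       of_real (qp x (sum_list xs)) * (if sum_list xs = N then of_real (2 * pi) else 0)) {-pi..pi}"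
    proof (rule has_integral_mult_right, cases "sum_list xs = N")
      case True
      have "((\<lambda>t. 1 :: complex) has_integral of_real (2 * pi)) {-pi..pi}"
        using has_integral_const_real[of "1 :: complex" "- pi" pi] by (simp add: scaleR_conv_of_real)
      with True show "((\<lambda>t. cis ((real (sum_list xs) - real N) * t)) has_integral
          (if sum_list xs = N then of_real (2 * pi) else 0)) {-pi..pi}" by simp
    next
      case False
      with integral_cis[OF False] show "((\<lambda>t. cis ((real (sum_list xs) - real N) * t)) has_integral
          (if sum_list xs = N then of_real (2 * pi) else 0)) {-pi..pi}" by simp
    qed
  qed
  moreover have "(\<Sum>xs\<in>S. of_real (qp x (sum_list xs)) * (if sum_list xs = N then of_real (2 * pi) else 0))
      = complex_of_real (2 * pi * qp x N * card {xs\<in>S. sum_list xs = N})"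
  proof -
    have "(\<Sum>xs\<in>S. of_real (qp x (sum_list xs)) * (if sum_list xs = N then of_real (2 * pi) else 0))
        = (\<Sum>xs\<in>S. if sum_list xs = N then complex_of_real (2 * pi * qp x N) else 0)"
      by (rule sum.cong) auto
    also have "\<dots> = (\<Sum>xs\<in>{xs\<in>S. sum_list xs = N}. complex_of_real (2 * pi * qp x N))"
      by (rule sum.inter_filter[symmetric, OF S])
    finally show ?thesis by simp
  qed
  moreover have "(\<Sum>xs\<in>S. of_real (qp x (sum_list xs)) * cis ((real (sum_list xs) - real N) * t))
      = (\<Sum>xs\<in>S. (of_real (exp (- x)) * cis t) ^ sum_list xs) * cis (- real N * t)" for t
  proof -
    have "of_real (qp x k) * cis ((real k - real N) * t) = (of_real (exp (- x)) * cis t) ^ k * cis (- real N * t)" for k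
      unfolding qp_cis_power[symmetric] by (simp add: cis_mult algebra_simps)
    then show ?thesis by (simp only: sum_distrib_right)
  qed
  ultimately show ?thesis by simp
qed

definition qprod :: "real \<Rightarrow> nat \<Rightarrow> nat \<Rightarrow> real" where
  "qprod x a b = (\<Prod>j=Suc a..b. 1 - qp x j)"

lemma qprod_pos: "0 < x \<Longrightarrow> 0 < qprod x a b"
  unfolding qprod_def by (rule prod_pos) (auto simp: qp_lt_1)

lemma qprod_le_1: "0 < x \<Longrightarrow> qprod x a b \<le> 1"
  unfolding qprod_def by (rule prod_le_1) (auto simp: qp_le_1 less_imp_le[OF qp_pos])

lemma prod_split: "a \<le> b \<Longrightarrow> (\<Prod>j=1..b. f j) = (\<Prod>j=1..a. f j) * (\<Prod>j=Suc a..b. f j :: 'a :: comm_monoid_mult)"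
  using prod.ub_add_nat[of 1 a f "b - a"] by simp

lemma box_sum_real:
  assumes x: "0 < x"
  shows "(\<Sum>xs\<in>box a b. exp (- x) ^ sum_list xs) * (qprod x 0 a * qprod x 0 b) = qprod x 0 (a + b)"
  using gaussian_binomial[of "exp (- x)" a b] by (simp add: qprod_def qp_power mult.assoc)

lemma box_sum_pos: "0 < (\<Sum>xs\<in>box a b. exp (- x :: real) ^ sum_list xs)"
proof (rule sum_pos)
  have "[] \<in> box a b" by (simp add: box_def)
  then show "box a b \<noteq> {}" by blast
qed (simp_all add: finite_box)

text \<open>By the product formula, the value at z divided by the value at q is Q(a+b) / (Q(a)
  Q(b)), where Q(m) is the product of the first m factors \<open>qfactor\<close>. As
  \<open>euler_char n x t\<close> is 1/Q(n), it remains to write Q(n)/Q(a) and Q(a+b)/Q(b) as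
  products.\<close>

lemma box_sum_complex:
  assumes x: "0 < x" and an: "a \<le> n"
  shows "(\<Sum>xs\<in>box a b. (of_real (exp (- x)) * cis t) ^ sum_list xs)
    = of_real (\<Sum>xs\<in>box a b. exp (- x) ^ sum_list xs) * (euler_char n x t *
       ((\<Prod>j\<in>{Suc a..n}. qfactor x j t) * (\<Prod>j\<in>{Suc b..a+b}. qfactor x j t)))"
proof -
  define Q where "Q = (\<lambda>m. \<Prod>j=1..m. qfactor x j t)"
  define P where "P = (\<lambda>m. \<Prod>j=1..m. 1 - complex_of_real (qp x j))"
  define z where "z = of_real (exp (- x)) * cis t"
  have nz: "1 - complex_of_real (qp x j) \<noteq> 0" "1 - of_real (qp x j) * cis (real j * t) \<noteq> 0" if "0 < j" for j
    using qp_lt_1[OF x that] one_minus_cis_nonzero[OF qp_pos qp_lt_1[OF x that]] by (auto simp: complex_eq_iff)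
  then have Q: "Q m \<noteq> 0" and P: "P m \<noteq> 0" for m
    by (auto simp: Q_def P_def qfactor_def)
  have QP: "(\<Prod>j=1..m. 1 - z ^ j) = Q m * P m" for m
    unfolding Q_def P_def prod.distrib[symmetric] z_def qp_cis_power[symmetric] qfactor_def
    by (rule prod.cong) (use nz in auto)
  have euler: "euler_char n x t = 1 / Q n"
    unfolding euler_char_def Q_def qfactor_def by (simp add: prod_dividef)
  have Qs: "Q n = Q a * (\<Prod>j=Suc a..n. qfactor x j t)" "Q (a + b) = Q b * (\<Prod>j=Suc b..a+b. qfactor x j t)"
    unfolding Q_def by (rule prod_split, use an in simp)+
  define G where "G = complex_of_real (\<Sum>xs\<in>box a b. exp (- x) ^ sum_list xs)"
  have "G * P a * P b = P (a + b)"
    using gaussian_binomial[of "complex_of_real (exp (- x))" a b]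
    by (simp add: G_def P_def qp_power)
  moreover have "(\<Sum>xs\<in>box a b. z ^ sum_list xs) * (Q a * P a) * (Q b * P b) = Q (a + b) * P (a + b)"
    using gaussian_binomial[of z a b] unfolding QP .
  ultimately have "(\<Sum>xs\<in>box a b. z ^ sum_list xs) * (Q a * P a) * (Q b * P b) = Q (a + b) * (G * P a * P b)"
    by simp
  then have "(\<Sum>xs\<in>box a b. z ^ sum_list xs) * (Q a * Q b) * (P a * P b) = Q (a + b) * G * (P a * P b)"
    by (simp only: mult_ac)
  then have "(\<Sum>xs\<in>box a b. z ^ sum_list xs) * (Q a * Q b) = Q (a + b) * G"
    using P by simp
  then have "(\<Sum>xs\<in>box a b. z ^ sum_list xs) = Q (a + b) * G / (Q a * Q b)"
    using Q by (simp add: eq_divide_eq)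
  also have "\<dots> = G * (\<Prod>j=Suc b..a+b. qfactor x j t) / Q a"
    using Q[of b] by (simp add: Qs(2))
  also have "\<dots> = G * (euler_char n x t * ((\<Prod>j\<in>{Suc a..n}. qfactor x j t) * (\<Prod>j\<in>{Suc b..a+b}. qfactor x j t)))"
  proof -
    have "(\<Prod>j=Suc a..n. qfactor x j t) = Q n / Q a" using Q[of a] Qs(1) by simp
    then show ?thesis using Q[of n] Q[of a] by (simp add: euler)
  qed
  finally show ?thesis by (simp only: z_def G_def)
qed

lemma card_box_integral:
  assumes x: "0 < x" and an: "a \<le> n" and N: "N \<le> n"
  shows "2 * pi * qp x N * card {xs\<in>box a b. sum_list xs = N} = (\<Sum>xs\<in>box a b. exp (- x) ^ sum_list xs) *
     Re (integral {-pi..pi} (\<lambda>t. tilted n x t * perturb x {Suc a..n} {Suc b..a+b} (real (n - N)) t))"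
proof -
  let ?G = "\<Sum>xs\<in>box a b. exp (- x) ^ sum_list xs"
  let ?I = "integral {-pi..pi} (\<lambda>t. tilted n x t * perturb x {Suc a..n} {Suc b..a+b} (real (n - N)) t)"
  have "cis (- real N * t) = cis (- real n * t) * cis (real (n - N) * t)" for t
    using N by (simp add: cis_mult of_nat_diff algebra_simps)
  then have "(\<Sum>xs\<in>box a b. (of_real (exp (- x)) * cis t) ^ sum_list xs) * cis (- real N * t)
      = of_real ?G * (tilted n x t * perturb x {Suc a..n} {Suc b..a+b} (real (n - N)) t)" for t
    unfolding box_sum_complex[OF x an] tilted_def perturb_def by (simp only: mult_ac)
  then have "of_real (2 * pi * qp x N * card {xs\<in>box a b. sum_list xs = N}) =
      integral {-pi..pi} (\<lambda>t. of_real ?G * (tilted n x t * perturb x {Suc a..n} {Suc b..a+b} (real (n - N)) t))"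
    using integral_unique[OF coefficient_integral[OF finite_box[of a b], of x N]] by (simp only:)
  also have "\<dots> = of_real ?G * ?I" by (rule integral_mult_right)
  finally have "Re (of_real (2 * pi * qp x N * card {xs\<in>box a b. sum_list xs = N})) = Re (of_real ?G * ?I)"
    by (rule arg_cong)
  then show ?thesis by simp
qed

text \<open>A shift by a brings out q^a; half of the remaining exponential then absorbs the powers
  of the summation index.\<close>

lemma tail_sums:
  assumes x: "0 < x" and ab: "a \<le> b"
  shows "(\<Sum>j=Suc a..b. real j * qp x j) \<le> qp x a * (real a / x + 4 / x\<^sup>2)"
    "(\<Sum>j=Suc a..b. (real j)\<^sup>2 * qp x j) \<le> qp x a * (2 * (real a)\<^sup>2 / x + 64 / x ^ 3)"
proof -
  obtain m where b: "b = a + m" using ab le_Suc_ex by blast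
  have shift: "(\<Sum>j=Suc a..b. f j) = (\<Sum>i=Suc 0..m. f (a + i))" for f :: "nat \<Rightarrow> real"
    unfolding b by (rule sum.reindex_bij_witness[of _ "\<lambda>i. a + i" "\<lambda>j. j - a"]) auto
  have S0: "(\<Sum>i=Suc 0..m. qp x i) \<le> 1 / x" "(\<Sum>i=Suc 0..m. qp (x / 2) i) \<le> 2 / x"
    using sum_qp_tail_le[of x 0 m] sum_qp_tail_le[of "x / 2" 0 m] x by (simp_all add: qp_0)
  have half: "qp x i = qp (x / 2) i * exp (- (x / 2 * real i))" for i
    by (simp add: qp_def flip: exp_add)
  have S1: "(\<Sum>i=Suc 0..m. real i * qp x i) \<le> 4 / x\<^sup>2"
  proof -
    have "real i * qp x i \<le> 2 / x * qp (x / 2) i" for i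
    proof -
      have "x / 2 * real i \<le> exp (x / 2 * real i)" by (rule le_exp)
      then have "real i * exp (- (x / 2 * real i)) \<le> 2 / x"
        using x by (simp add: exp_minus field_simps)
      from mult_right_mono[OF this, of "qp (x / 2) i"] show ?thesis
        unfolding half[of i] using qp_pos[of "x / 2" i] by (simp add: mult_ac)
    qed
    then have "(\<Sum>i=Suc 0..m. real i * qp x i) \<le> (\<Sum>i=Suc 0..m. 2 / x * qp (x / 2) i)"
      by (intro sum_mono)
    also have "\<dots> \<le> 2 / x * (2 / x)"
      unfolding sum_distrib_left[symmetric] using S0 x by (intro mult_left_mono) auto
    finally show ?thesis by (simp add: power2_eq_square)
  qed
  have S2: "(\<Sum>i=Suc 0..m. (real i)\<^sup>2 * qp x i) \<le> 32 / x ^ 3"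
  proof -
    have "(real i)\<^sup>2 * qp x i \<le> 16 / x\<^sup>2 * qp (x / 2) i" for i
    proof -
      have "(x / 4 * real i)\<^sup>2 \<le> (exp (x / 4 * real i))\<^sup>2"
        using x le_exp[of "x / 4 * real i"] by (intro power_mono) auto
      also have "\<dots> = exp (x / 2 * real i)" by (simp flip: exp_double)
      finally have "(real i)\<^sup>2 * exp (- (x / 2 * real i)) \<le> 16 / x\<^sup>2"
        using x by (simp add: exp_minus field_simps power_mult_distrib)
      from mult_right_mono[OF this, of "qp (x / 2) i"] show ?thesis
        unfolding half[of i] using qp_pos[of "x / 2" i] by (simp add: mult_ac)
    qed
    then have "(\<Sum>i=Suc 0..m. (real i)\<^sup>2 * qp x i) \<le> (\<Sum>i=Suc 0..m. 16 / x\<^sup>2 * qp (x / 2) i)"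
      by (intro sum_mono)
    also have "\<dots> \<le> 16 / x\<^sup>2 * (2 / x)"
      unfolding sum_distrib_left[symmetric] using S0 x by (intro mult_left_mono) auto
    finally show ?thesis by (simp add: power2_eq_square power3_eq_cube)
  qed
  have "(\<Sum>j=Suc a..b. real j * qp x j)
      = qp x a * (real a * (\<Sum>i=Suc 0..m. qp x i) + (\<Sum>i=Suc 0..m. real i * qp x i))"
    unfolding shift by (simp add: qp_add sum_distrib_left sum.distrib[symmetric] algebra_simps)
  also have "\<dots> \<le> qp x a * (real a * (1 / x) + 4 / x\<^sup>2)"
    using S0 S1 qp_pos[of x a] by (intro mult_left_mono add_mono) auto
  finally show "(\<Sum>j=Suc a..b. real j * qp x j) \<le> qp x a * (real a / x + 4 / x\<^sup>2)" by simp
  have "(\<Sum>j=Suc a..b. (real j)\<^sup>2 * qp x j) = (\<Sum>i=Suc 0..m. (real a + real i)\<^sup>2 * (qp x a * qp x i))"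
    unfolding shift by (simp add: qp_add)
  also have "\<dots> \<le> (\<Sum>i=Suc 0..m. qp x a * (2 * (real a)\<^sup>2 * qp x i + 2 * ((real i)\<^sup>2 * qp x i)))"
  proof (rule sum_mono)
    fix i
    have "0 \<le> (real a - real i)\<^sup>2" by simp
    then have "(real a + real i)\<^sup>2 \<le> 2 * (real a)\<^sup>2 + 2 * (real i)\<^sup>2"
      by (simp add: power2_eq_square algebra_simps)
    then have "(real a + real i)\<^sup>2 * (qp x a * qp x i) \<le> (2 * (real a)\<^sup>2 + 2 * (real i)\<^sup>2) * (qp x a * qp x i)"
      using qp_pos by (intro mult_right_mono) (auto intro!: mult_nonneg_nonneg less_imp_le)
    then show "(real a + real i)\<^sup>2 * (qp x a * qp x i) \<le> qp x a * (2 * (real a)\<^sup>2 * qp x i + 2 * ((real i)\<^sup>2 * qp x i))"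
      by (simp add: algebra_simps)
  qed
  also have "\<dots> = qp x a * (2 * (real a)\<^sup>2 * (\<Sum>i=Suc 0..m. qp x i) + 2 * (\<Sum>i=Suc 0..m. (real i)\<^sup>2 * qp x i))"
    by (simp add: sum_distrib_left sum.distrib[symmetric])
  also have "\<dots> \<le> qp x a * (2 * (real a)\<^sup>2 * (1 / x) + 2 * (32 / x ^ 3))"
    using S0 S2 qp_pos[of x a] by (intro mult_left_mono add_mono) auto
  finally show "(\<Sum>j=Suc a..b. (real j)\<^sup>2 * qp x j) \<le> qp x a * (2 * (real a)\<^sup>2 / x + 64 / x ^ 3)" by simp
qed

lemma qw_tail_sums:
  assumes x: "0 < x" and ab: "a \<le> b" and a: "qp x a \<le> 1 / 2"
  shows "(\<Sum>j=Suc a..b. real j ^ 0 * qw x j) \<le> 2 * qp x a / x"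
    "(\<Sum>j=Suc a..b. real j ^ 1 * qw x j) \<le> 2 * qp x a * (real a / x + 4 / x\<^sup>2)"
    "(\<Sum>j=Suc a..b. real j ^ 2 * qw x j) \<le> 2 * qp x a * (2 * (real a)\<^sup>2 / x + 64 / x ^ 3)"
proof -
  have qw: "qw x j \<le> 2 * qp x j" if "j \<in> {Suc a..b}" for j
  proof -
    have "qp x j \<le> 1 / 2" using qp_antimono[of x a j] that x a by simp
    then have "qp x j / (1 - qp x j) \<le> qp x j / (1 / 2)"
      using qp_pos[of x j] by (intro divide_left_mono) auto
    then show ?thesis by (simp add: qw_def)
  qed
  have *: "(\<Sum>j=Suc a..b. real j ^ k * qw x j) \<le> 2 * (\<Sum>j=Suc a..b. real j ^ k * qp x j)" for k
  proof -
    have "(\<Sum>j=Suc a..b. real j ^ k * qw x j) \<le> (\<Sum>j=Suc a..b. real j ^ k * (2 * qp x j))"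
      using qw by (intro sum_mono mult_left_mono) auto
    then show ?thesis by (simp add: sum_distrib_left mult_ac)
  qed
  show "(\<Sum>j=Suc a..b. real j ^ 0 * qw x j) \<le> 2 * qp x a / x"
    using *[of 0] sum_qp_tail_le[OF x ab] by simp
  show "(\<Sum>j=Suc a..b. real j ^ 1 * qw x j) \<le> 2 * qp x a * (real a / x + 4 / x\<^sup>2)"
    using *[of 1] tail_sums(1)[OF x ab] by simp
  show "(\<Sum>j=Suc a..b. real j ^ 2 * qw x j) \<le> 2 * qp x a * (2 * (real a)\<^sup>2 / x + 64 / x ^ 3)"
    using *[of 2] tail_sums(2)[OF x ab] by simp
qed

text \<open>The count in the box and the number of partitions are generating function values times
  integrals I1 and I2, whose distances from the unperturbed I0 are at most \<epsilon> Re I0; hence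
  Re I1 >= (1 - 2 \<epsilon>) Re I2 when the left factor is positive. The factors
  \<open>qprod\<close> come from the ratio of the generating functions at q.\<close>

lemma card_box_ge:
  "\<exists>x0 C. 0 < x0 \<and> 0 < C \<and> (\<forall>n x a b N A. saddle n x \<longrightarrow> x \<le> x0 \<longrightarrow> a \<le> n \<longrightarrow> N \<le> n \<longrightarrow>
     1 / x \<le> A \<longrightarrow> A\<^sup>2 * x ^ 3 \<le> 1 \<longrightarrow>
     real (n - N) + qmoment x {Suc a..n} {Suc b..a+b} 1 \<le> A \<longrightarrow>
     qmoment x {Suc a..n} {Suc b..a+b} 2 \<le> A\<^sup>2 \<longrightarrow>
     qmoment x {Suc a..n} {Suc b..a+b} 0 \<le> 1 / (800 * x) \<longrightarrow>
     (1 - C * (A\<^sup>2 * x ^ 3)) * (qp x (n - N) * qprod x a n * qprod x b (a + b) * card (partitions n))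
       \<le> card {xs\<in>box a b. sum_list xs = N})"
proof -
  obtain x1 where x1: "0 < x1" "\<And>n x. saddle n x \<Longrightarrow> x \<le> x1 \<Longrightarrow>
     exp (- 16) / 2 * sqrt (x ^ 3) \<le> Re (integral {-pi..pi} (tilted n x))"
    using Re_integral_tilted_ge by blast
  define c0 :: real where "c0 = exp (- 16) / 2"
  define K where "K = 25012 * dom_const / c0"
  have c0: "0 < c0" by (simp add: c0_def)
  have K: "0 < K" using dom_const_pos c0 by (simp add: K_def)
  show ?thesis
  proof (rule exI[of _ "min x1 (1 / 10000)"], rule exI[of _ "2 * K"], intro conjI allI impI)
    show "0 < min x1 (1 / 10000)" "0 < 2 * K" using x1 K by auto
    fix n x a b N A
    assume s: "saddle n x" and xle: "x \<le> min x1 (1 / 10000)" and an: "a \<le> n" and N: "N \<le> n"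
      and A: "1 / x \<le> A" "A\<^sup>2 * x ^ 3 \<le> 1"
        "real (n - N) + qmoment x {Suc a..n} {Suc b..a+b} 1 \<le> A"
        "qmoment x {Suc a..n} {Suc b..a+b} 2 \<le> A\<^sup>2"
        "qmoment x {Suc a..n} {Suc b..a+b} 0 \<le> 1 / (800 * x)"
    note x = saddleD[OF s]
    have x4: "x \<le> 1 / 10000" using xle by simp
    define \<epsilon> where "\<epsilon> = K * (A\<^sup>2 * x ^ 3)"
    let ?s = "sqrt (x ^ 3)"
    have \<epsilon>0: "0 \<le> \<epsilon>" using K x by (simp add: \<epsilon>_def)
    define I0 where "I0 = integral {-pi..pi} (tilted n x)"
    define I1 where "I1 = integral {-pi..pi} (\<lambda>t. tilted n x t * perturb x {Suc a..n} {Suc b..a+b} (real (n - N)) t)"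
    define I2 where "I2 = integral {-pi..pi} (\<lambda>t. tilted n x t * perturb x {Suc n..n} {Suc n..n+n} (real (n - n)) t)"
    have I0: "c0 * ?s \<le> Re I0" using x1(2)[OF s] xle by (simp add: c0_def I0_def)
    have K_eq: "25012 * dom_const * A\<^sup>2 * x ^ 3 * ?s \<le> \<epsilon> * Re I0"
    proof -
      have "25012 * dom_const * A\<^sup>2 * x ^ 3 * ?s = \<epsilon> * (c0 * ?s)"
        using c0 by (simp add: \<epsilon>_def K_def)
      also have "\<dots> \<le> \<epsilon> * Re I0" using I0 \<epsilon>0 by (rule mult_left_mono)
      finally show ?thesis .
    qed
    have I0_pos: "0 < Re I0"
    proof -
      have "0 < c0 * ?s" using c0 x by simp
      with I0 show ?thesis by linarith
    qed
    have "cmod (I1 - I0) \<le> 25012 * dom_const * A\<^sup>2 * x ^ 3 * ?s"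
      unfolding I1_def I0_def by (rule integral_perturb[OF s]) (use A in auto)
    with K_eq have I1: "(1 - \<epsilon>) * Re I0 \<le> Re I1"
      using abs_Re_le_cmod[of "I1 - I0"] by (simp add: algebra_simps)
    \<comment> \<open>The number of partitions is the case a = b = N = n: no shift, an empty first
      product, and only factors with index above n. So A = 1/x, the smallest admissible value,
      does.\<close>
    have "cmod (I2 - I0) \<le> 25012 * dom_const * (1 / x)\<^sup>2 * x ^ 3 * ?s"
      unfolding I2_def I0_def
    proof (rule integral_perturb[OF s])
      have q: "qp x n \<le> 256 * x ^ 4" by (rule saddle_qp_n_le[OF s])
      have "x ^ 4 \<le> (1 / 10000) ^ 4" using x x4 by (intro power_mono) auto
      then have half: "qp x n \<le> 1 / 2" using q by (simp add: power_divide)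
      note t = qw_tail_sums[OF x(1) _ half, of "n + n"]
      have xs: "x\<^sup>2 \<le> x / 10000" "x ^ 3 \<le> x / 10000" "x ^ 4 \<le> 1 / 1000000"
      proof -
        show x2: "x\<^sup>2 \<le> x / 10000" using x x4 mult_left_mono[OF x4, of x] by (simp add: power2_eq_square)
        have "x * x\<^sup>2 \<le> 1 * (x / 10000)" using x x2 by (intro mult_mono) auto
        then show "x ^ 3 \<le> x / 10000" by (simp add: power2_eq_square power3_eq_cube)
        show "x ^ 4 \<le> 1 / 1000000" using \<open>x ^ 4 \<le> (1 / 10000) ^ 4\<close> by (simp add: power_divide)
      qed
      have "qmoment x {Suc n..n} {Suc n..n+n} 0 \<le> 2 * qp x n / x"
        using t(1) by (simp add: qmoment_def)
      also have "\<dots> \<le> 2 * (256 * x ^ 4) / x" using q x by (intro divide_right_mono mult_left_mono) auto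
      also have "\<dots> \<le> 1 / (800 * x)" using xs x by (simp add: divide_right_mono field_simps)
      finally show "qmoment x {Suc n..n} {Suc n..n+n} 0 \<le> 1 / (800 * x)" .
      have "qmoment x {Suc n..n} {Suc n..n+n} 1 \<le> 2 * qp x n * (real n / x + 4 / x\<^sup>2)"
        using t(2) by (simp add: qmoment_def)
      also have "\<dots> \<le> 2 * (256 * x ^ 4) * ((2 / x\<^sup>2) / x + 4 / x\<^sup>2)"
        using q x qp_pos[of x n] by (intro mult_mono add_mono divide_right_mono) auto
      also have "\<dots> = (1024 * x\<^sup>2 + 2048 * x ^ 3) / x"
        using x by (simp add: field_simps power2_eq_square power3_eq_cube power4_eq_xxxx)
      also have "\<dots> \<le> 1 / x" using xs x x4 by (intro divide_right_mono) auto
      finally show "real (n - n) + qmoment x {Suc n..n} {Suc n..n+n} 1 \<le> 1 / x" by simp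
      have "qmoment x {Suc n..n} {Suc n..n+n} 2 \<le> 2 * qp x n * (2 * (real n)\<^sup>2 / x + 64 / x ^ 3)"
        using t(3) by (simp add: qmoment_def)
      also have "\<dots> \<le> 2 * (256 * x ^ 4) * (2 * (2 / x\<^sup>2)\<^sup>2 / x + 64 / x ^ 3)"
        using q x qp_pos[of x n] by (intro mult_mono add_mono divide_right_mono mult_left_mono power_mono) auto
      also have "\<dots> = (4096 * x + 32768 * x ^ 3) / x\<^sup>2"
        using x by (simp add: field_simps power2_eq_square power3_eq_cube power4_eq_xxxx)
      also have "\<dots> \<le> 1 / x\<^sup>2" using xs x x4 by (intro divide_right_mono) auto
      finally show "qmoment x {Suc n..n} {Suc n..n+n} 2 \<le> (1 / x)\<^sup>2" by (simp add: power_divide)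
      show "(1 / x)\<^sup>2 * x ^ 3 \<le> 1" using x by (simp add: power2_eq_square power3_eq_cube)
    qed auto
    also have "\<dots> \<le> 25012 * dom_const * A\<^sup>2 * x ^ 3 * ?s"
      using A(1) x dom_const_pos by (intro mult_right_mono mult_left_mono power_mono) auto
    finally have I2: "Re I2 \<le> (1 + \<epsilon>) * Re I0"
      using K_eq abs_Re_le_cmod[of "I2 - I0"] by (simp add: algebra_simps)
    define G1 where "G1 = (\<Sum>xs\<in>box a b. exp (- x) ^ sum_list xs)"
    define G2 where "G2 = (\<Sum>xs\<in>box n n. exp (- x) ^ sum_list xs)"
    have G: "0 < G1" "0 < G2" unfolding G1_def G2_def by (rule box_sum_pos)+
    define c1 where "c1 = real (card {xs\<in>box a b. sum_list xs = N})"
    define c2 where "c2 = real (card (partitions n))"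
    have c1: "2 * pi * qp x N * c1 = G1 * Re I1"
      unfolding c1_def G1_def I1_def by (rule card_box_integral[OF x(1) an N])
    have c2: "2 * pi * qp x n * c2 = G2 * Re I2"
      unfolding c2_def G2_def I2_def partitions_eq_box by (rule card_box_integral[OF x(1)]) auto
    \<comment> \<open>G1 is evaluated exactly, while G2 is bounded by 1 /
      \<open>qprod x 0 n\<close>, the generating function of all partitions with parts at most
      n.\<close>
    have G12: "qprod x a n * qprod x b (a + b) * G2 \<le> G1"
    proof -
      have p: "0 < qprod x i j" for i j by (rule qprod_pos[OF x(1)])
      have sp': "qprod x 0 v = qprod x 0 u * qprod x u v" if "u \<le> v" for u v
        unfolding qprod_def One_nat_def[symmetric] by (rule prod_split[OF that])
      have sp: "qprod x 0 n = qprod x 0 a * qprod x a n" "qprod x 0 (a + b) = qprod x 0 b * qprod x b (a + b)"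
        "qprod x 0 (n + n) = qprod x 0 n * qprod x n (n + n)"
        by (rule sp', use an in simp)+
      have "G1 * (qprod x 0 a * qprod x 0 b) = qprod x 0 b * qprod x b (a + b)"
        using box_sum_real[OF x(1), of a b] by (simp add: G1_def sp(2))
      then have 1: "G1 * qprod x 0 a = qprod x b (a + b)" using p[of 0 b] by simp
      have "G2 * (qprod x 0 n * qprod x 0 n) = qprod x 0 n * qprod x n (n + n)"
        using box_sum_real[OF x(1), of n n] by (simp add: G2_def sp(3))
      then have "G2 * qprod x 0 n = qprod x n (n + n)" using p[of 0 n] by simp
      then have 2: "G2 * (qprod x 0 a * qprod x a n) \<le> 1"
        using qprod_le_1[OF x(1), of n "n + n"] by (simp add: sp(1))
      have "qprod x a n * qprod x b (a + b) * G2 = G1 * (G2 * (qprod x 0 a * qprod x a n))"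
        unfolding 1[symmetric] by simp
      also have "\<dots> \<le> G1 * 1" using 2 G by (intro mult_left_mono) auto
      finally show ?thesis by simp
    qed
    show "(1 - 2 * K * (A\<^sup>2 * x ^ 3)) * (qp x (n - N) * qprod x a n * qprod x b (a + b) * card (partitions n))
       \<le> card {xs\<in>box a b. sum_list xs = N}"
    proof (cases "1 - 2 * \<epsilon> \<le> 0")
      case True
      have "(1 - 2 * \<epsilon>) * (qp x (n - N) * qprod x a n * qprod x b (a + b) * card (partitions n)) \<le> 0"
        using True qp_pos qprod_pos[OF x(1)] by (intro mult_nonpos_nonneg mult_nonneg_nonneg) (auto intro: less_imp_le)
      also have "0 \<le> real (card {xs\<in>box a b. sum_list xs = N})" by simp
      finally show ?thesis by (simp add: \<epsilon>_def mult.assoc)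
    next
      case False
      have "(1 - 2 * \<epsilon>) * Re I2 \<le> (1 - 2 * \<epsilon>) * ((1 + \<epsilon>) * Re I0)"
        using I2 False by (intro mult_left_mono) auto
      also have "\<dots> = (1 - \<epsilon> - 2 * \<epsilon> * \<epsilon>) * Re I0" by (simp add: algebra_simps)
      also have "\<dots> \<le> (1 - \<epsilon>) * Re I0" using I0_pos \<epsilon>0 by (intro mult_right_mono) auto
      finally have I12: "(1 - 2 * \<epsilon>) * Re I2 \<le> Re I1" using I1 by simp
      have c20: "0 \<le> c2" by (simp add: c2_def)
      have I20: "0 \<le> Re I2"
      proof -
        have "0 \<le> G2 * Re I2" unfolding c2[symmetric] using c20 qp_pos[of x n] by simp
        then show ?thesis using G by (simp add: zero_le_mult_iff)
      qed
      have "2 * pi * qp x N * ((1 - 2 * \<epsilon>) * (qp x (n - N) * (qprod x a n * qprod x b (a + b)) * c2))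
          = (1 - 2 * \<epsilon>) * (qprod x a n * qprod x b (a + b)) * (2 * pi * (qp x N * qp x (n - N)) * c2)"
        by (simp only: mult_ac)
      also have "qp x N * qp x (n - N) = qp x n" using N by (simp flip: qp_add)
      also have "(1 - 2 * \<epsilon>) * (qprod x a n * qprod x b (a + b)) * (2 * pi * qp x n * c2)
          = (qprod x a n * qprod x b (a + b) * G2) * ((1 - 2 * \<epsilon>) * Re I2)"
        unfolding c2 by (simp only: mult_ac)
      also have "\<dots> \<le> G1 * Re I1"
        using G12 I12 I20 False G by (intro mult_mono) auto
      also have "\<dots> = 2 * pi * qp x N * c1" by (rule c1[symmetric])
      finally have "(1 - 2 * \<epsilon>) * (qp x (n - N) * (qprod x a n * qprod x b (a + b)) * c2) \<le> c1"
        using qp_pos[of x N] by (simp add: mult_le_cancel_left_pos)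
      then show ?thesis by (simp add: c1_def c2_def \<epsilon>_def mult.assoc)
    qed
  qed
qed

section \<open>Counting partitions with a prescribed frame\<close>

text \<open>1 - p >= exp(-p/(1 - p)), and p/(1 - p) <= p (1 + 2 u) for p <= u <= 1/2; then the
  geometric tail is summed.\<close>

lemma qprod_ge:
  assumes x: "0 < x" and ab: "a \<le> b" and a: "qp x a \<le> 1 / 2"
  shows "exp (- (qp x a / x * (1 + 2 * qp x a))) \<le> qprod x a b"
proof -
  have "(\<Sum>j=Suc a..b. qp x j / (1 - qp x j)) \<le> (\<Sum>j=Suc a..b. qp x j * (1 + 2 * qp x a))"
  proof (rule sum_mono)
    fix j assume j: "j \<in> {Suc a..b}"
    have p: "qp x j \<le> qp x a" using qp_antimono[of x a j] j x by simp
    define u where "u = qp x a"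
    have u: "0 < u" "u \<le> 1 / 2" using a qp_pos by (auto simp: u_def)
    have "1 / (1 - qp x j) \<le> 1 / (1 - u)" using p u by (intro divide_left_mono) (auto simp: u_def)
    also have "\<dots> \<le> 1 + 2 * u"
    proof -
      have "1 \<le> 1 + u * (1 - 2 * u)" using u by simp
      also have "\<dots> = (1 + 2 * u) * (1 - u)" by (simp add: algebra_simps)
      finally show ?thesis using u by (simp add: pos_divide_le_eq)
    qed
    finally have "qp x j * (1 / (1 - qp x j)) \<le> qp x j * (1 + 2 * u)"
      using qp_pos[of x j] by (intro mult_left_mono) auto
    then show "qp x j / (1 - qp x j) \<le> qp x j * (1 + 2 * qp x a)" by (simp add: u_def)
  qed
  also have "\<dots> = (\<Sum>j=Suc a..b. qp x j) * (1 + 2 * qp x a)" by (rule sum_distrib_right[symmetric])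
  also have "\<dots> \<le> qp x a / x * (1 + 2 * qp x a)"
    using sum_qp_tail_le[OF x ab] qp_pos[of x a] by (intro mult_right_mono) auto
  finally have "exp (- (qp x a / x * (1 + 2 * qp x a))) \<le> exp (- (\<Sum>j=Suc a..b. qp x j / (1 - qp x j)))"
    by simp
  also have "\<dots> = (\<Prod>j=Suc a..b. exp (- (qp x j / (1 - qp x j))))"
    by (simp add: exp_sum sum_negf[symmetric])
  also have "\<dots> \<le> qprod x a b"
    unfolding qprod_def
  proof (rule prod_mono, intro conjI)
    fix j assume j: "j \<in> {Suc a..b}"
    have p: "0 < 1 - qp x j" using qp_lt_1[OF x, of j] j by simp
    have "1 + qp x j / (1 - qp x j) \<le> exp (qp x j / (1 - qp x j))" by (rule exp_ge_add_one_self)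
    moreover have "1 + qp x j / (1 - qp x j) = 1 / (1 - qp x j)" using p by (simp add: field_simps)
    ultimately have "1 / (1 - qp x j) \<le> exp (qp x j / (1 - qp x j))" by simp
    then have "1 / exp (qp x j / (1 - qp x j)) \<le> 1 - qp x j" using p by (simp add: field_simps)
    then show "exp (- (qp x j / (1 - qp x j))) \<le> 1 - qp x j" by (simp add: exp_minus inverse_eq_divide)
  qed simp
  finally show ?thesis .
qed

definition frames :: "nat \<Rightarrow> nat \<Rightarrow> (nat \<Rightarrow> nat) \<Rightarrow> (nat \<Rightarrow> nat) \<Rightarrow> nat list set" where
  "frames n k l l' = {xs \<in> partitions n. \<forall>j\<in>{1..k}. part xs j = l j \<and> dual_part xs j = l' j}"

text \<open>The error \<eta> = \<sigma>^2 x L^2, with \<sigma> = k + q^(l_k)/x + q^(l'_k)/x and L =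
  ln(1/x), governs everything. If K \<eta> >= 1 the claim is trivial. Otherwise the smallness of
  \<eta> yields all side conditions: that k is at most \<open>l k\<close> and \<open>l' k\<close>,
  that the prescribed parts sum to at most n, and the moment bounds of \<open>card_box_ge\<close>
  with A = 200 \<sigma> L / x.\<close>

lemma card_frames_ge:
  "\<exists>x0 K. 0 < x0 \<and> 0 < K \<and> (\<forall>n x k l l'. saddle n x \<longrightarrow> x \<le> x0 \<longrightarrow> 1 \<le> k \<longrightarrow>
     (\<forall>i j. 1 \<le> i \<longrightarrow> i \<le> j \<longrightarrow> j \<le> k \<longrightarrow> l j \<le> l i \<and> l' j \<le> l' i) \<longrightarrow>
     real (l 1) \<le> 3 * ln (1 / x) / x \<longrightarrow> real (l' 1) \<le> 3 * ln (1 / x) / x \<longrightarrow>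
     (1 - K * ((real k + qp x (l k) / x + qp x (l' k) / x)\<^sup>2 * x * (ln (1 / x))\<^sup>2)) *
       (exp (2 * real k * x) * qp x ((\<Sum>j=1..k. l j) + (\<Sum>j=1..k. l' j))
         * exp (- (qp x (l k) / x)) * exp (- (qp x (l' k) / x)) * card (partitions n))
     \<le> card (frames n k l l'))"
proof -
  obtain x1 C where x1: "0 < x1" and C: "0 < C" and ge: "\<And>n x a b N A. saddle n x \<Longrightarrow> x \<le> x1 \<Longrightarrow> a \<le> n \<Longrightarrow> N \<le> n \<Longrightarrow>
     1 / x \<le> A \<Longrightarrow> A\<^sup>2 * x ^ 3 \<le> 1 \<Longrightarrow>
     real (n - N) + qmoment x {Suc a..n} {Suc b..a+b} 1 \<le> A \<Longrightarrow>
     qmoment x {Suc a..n} {Suc b..a+b} 2 \<le> A\<^sup>2 \<Longrightarrow>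
     qmoment x {Suc a..n} {Suc b..a+b} 0 \<le> 1 / (800 * x) \<Longrightarrow>
     (1 - C * (A\<^sup>2 * x ^ 3)) * (qp x (n - N) * qprod x a n * qprod x b (a + b) * card (partitions n))
       \<le> card {xs\<in>box a b. sum_list xs = N}"
    using card_box_ge by blast
  \<comment> \<open>40000 C is the error of \<open>card_box_ge\<close>, since A^2 x^3 = 40000
    \<eta>; 30 is the loss in passing to the weights of the statement; another 40000 ensures A^2 x^3
    <= 1 whenever K \<eta> < 1.\<close>
  define K where "K = 40000 * C + 40030"
  have K: "0 < K" "40000 * C \<le> K" "40000 \<le> K" using C by (simp_all add: K_def)
  show ?thesis
  proof (rule exI[of _ "min x1 (1 / 10 ^ 8)"], rule exI[of _ K], intro conjI allI impI)
    show "0 < min x1 (1 / 10 ^ 8)" "0 < K" using x1 K by auto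
    fix n k :: nat and x :: real and l l' :: "nat \<Rightarrow> nat"
    assume s: "saddle n x" and xle: "x \<le> min x1 (1 / 10 ^ 8)" and k: "1 \<le> k"
      and mono: "\<forall>i j. 1 \<le> i \<longrightarrow> i \<le> j \<longrightarrow> j \<le> k \<longrightarrow> l j \<le> l i \<and> l' j \<le> l' i"
      and top: "real (l 1) \<le> 3 * ln (1 / x) / x" "real (l' 1) \<le> 3 * ln (1 / x) / x"
    note x = saddleD[OF s]
    have x8: "x \<le> 1 / 10 ^ 8" and xx1: "x \<le> x1" using xle by auto
    define \<sigma> where "\<sigma> = real k + qp x (l k) / x + qp x (l' k) / x"
    define L where "L = ln (1 / x)"
    define \<eta> where "\<eta> = \<sigma>\<^sup>2 * x * L\<^sup>2"
    define \<Sigma> where "\<Sigma> = (\<Sum>j=1..k. l j) + (\<Sum>j=1..k. l' j)"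
    define W where "W = exp (2 * real k * x) * qp x \<Sigma> * exp (- (qp x (l k) / x)) * exp (- (qp x (l' k) / x)) * card (partitions n)"
    have W0: "0 \<le> W" using qp_pos[of x \<Sigma>] by (simp add: W_def)
    have "(1 - K * \<eta>) * W \<le> card (frames n k l l')"
    proof (cases "1 - K * \<eta> \<le> 0")
      case True
      then have "(1 - K * \<eta>) * W \<le> 0" using W0 by (rule mult_nonpos_nonneg)
      then show ?thesis by simp
    next
      case False
      then have \<eta>1: "K * \<eta> < 1" by simp
      have y8: "100000000 \<le> 1 / x" using x8 x(1) by (simp add: field_simps)
      have L1: "1 \<le> L"
      proof -
        have "exp 1 \<le> 1 / x" using exp_le y8 by linarith
        then show ?thesis unfolding L_def using x(1) by (simp add: ln_ge_iff)
      qed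
      have sx: "sqrt x \<le> 1 / 10 ^ 4"
      proof (rule real_le_lsqrt)
        show "x \<le> (1 / 10 ^ 4)\<^sup>2" using x8 by (simp add: power_divide)
      qed (use x in auto)
      have sx0: "0 < sqrt x" "sqrt x * sqrt x = x" using x(1) by auto
      have L_le: "L \<le> 2 / sqrt x"
      proof -
        have "L = 2 * ln (1 / sqrt x)" using x(1) by (simp add: L_def ln_div ln_sqrt)
        moreover have "ln (1 / sqrt x) \<le> 1 / sqrt x"
          using ln_le_minus_one[of "1 / sqrt x"] sx0 by simp
        ultimately show ?thesis by simp
      qed
      have q0: "0 \<le> qp x j / x" for j using qp_pos[of x j] x(1) by simp
      have \<sigma>: "1 \<le> \<sigma>" "real k \<le> \<sigma>" "qp x (l k) / x + qp x (l' k) / x \<le> \<sigma>"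
        using k q0[of "l k"] q0[of "l' k"] by (auto simp: \<sigma>_def)
      have \<sigma>2: "\<sigma> \<le> \<sigma>\<^sup>2" using \<sigma>(1) by (simp add: power2_eq_square)
      have \<eta>0: "0 \<le> \<eta>" using x(1) by (simp add: \<eta>_def)
      have \<eta>_small: "40000 * \<eta> \<le> 1"
        using mult_right_mono[OF K(3) \<eta>0] \<eta>1 by linarith
      have "(200 * (\<sigma> * L * sqrt x))\<^sup>2 \<le> 1\<^sup>2"
        using \<eta>_small sx0 by (simp add: \<eta>_def power_mult_distrib power2_eq_square[of "sqrt x"] mult_ac)
      then have sL: "\<sigma> * L * sqrt x \<le> 1 / 200"
        using power2_le_imp_le[of "200 * (\<sigma> * L * sqrt x)" 1] by simp
      have "\<sigma> * 1 * sqrt x \<le> \<sigma> * L * sqrt x"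
        using L1 \<sigma> sx0 by (intro mult_right_mono mult_left_mono) auto
      with sL have s1: "\<sigma> * sqrt x \<le> 1 / 200" by simp
      have \<sigma>x: "\<sigma> * x \<le> 1 / 200 * sqrt x"
        using mult_right_mono[OF s1, of "sqrt x"] sx0 by (simp add: mult.assoc)
      have \<sigma>x2: "\<sigma> * x \<le> 1 / 200" using \<sigma>x sx by simp
      have qx: "qp x (l k) \<le> \<sigma> * x" "qp x (l' k) \<le> \<sigma> * x"
        using \<sigma>(3) q0[of "l k"] q0[of "l' k"] x(1) by (auto simp: pos_divide_le_eq[symmetric])
      have kx: "real k * x \<le> \<sigma> * x" using \<sigma> x by (intro mult_right_mono) auto
      \<comment> \<open>q^j <= \<sigma> x <= sqrt x forces x j >= L/2 >= 1/2, far above x k <=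
        1/200. Applied to \<open>l k\<close> and \<open>l' k\<close> this shows that the frame
        contains a k by k square.\<close>
      have big: "k \<le> j" if "qp x j \<le> \<sigma> * x" for j
      proof -
        have "real k * x \<le> 1 / 200" using kx \<sigma>x2 by linarith
        have "qp x j \<le> sqrt x" using that \<sigma>x sx0 by linarith
        also have "\<dots> = exp (- (L / 2))"
          using x(1) by (simp add: L_def ln_div flip: ln_sqrt)
        finally have "L / 2 \<le> x * real j" by (simp add: qp_def)
        with L1 have "1 / 2 \<le> x * real j" by linarith
        with \<open>real k * x \<le> 1 / 200\<close> have "x * real k \<le> x * real j" by (simp add: mult.commute)
        then show ?thesis using x(1) by simp
      qed
      define a where "a = l k - k"
      define b where "b = l' k - k"
      have lk: "k \<le> l k" "k \<le> l' k" using big qx by auto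
      have la: "l k = a + k" "l' k = b + k" using lk by (auto simp: a_def b_def)
      have e1: "exp (real k * x) \<le> 1 + 2 * (\<sigma> * x)"
      proof -
        have "0 \<le> real k * x" using x(1) by simp
        moreover have "real k * x \<le> 1 / 2" using kx \<sigma>x2 by linarith
        ultimately have "exp (real k * x) \<le> 1 + 2 * (real k * x)" by (rule real_exp_bound_lemma)
        with kx show ?thesis by linarith
      qed
      have e2: "exp (real k * x) \<le> 2" using e1 \<sigma>x2 by linarith
      have qa: "qp x j = qp x (j + k) * exp (real k * x)" for j
        by (simp add: qp_def algebra_simps flip: exp_add)
      have qa2: "qp x a \<le> 2 * qp x (l k)" "qp x b \<le> 2 * qp x (l' k)"
        unfolding la using qa[of a] qa[of b] e2 qp_pos[of x] mult_left_mono[OF e2, of "qp x (a + k)"] mult_left_mono[OF e2, of "qp x (b + k)"]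
        by (auto simp: less_imp_le)
      then have qa3: "qp x a \<le> 2 * (\<sigma> * x)" "qp x b \<le> 2 * (\<sigma> * x)" using qx by linarith+
      then have half: "qp x a \<le> 1 / 2" "qp x b \<le> 1 / 2" using \<sigma>x2 by linarith+
      have l_le: "l j \<le> l 1" "l' j \<le> l' 1" if "j \<in> {1..k}" for j using mono that by auto
      have ab_le: "real a \<le> 3 * L / x" "real b \<le> 3 * L / x"
        using top l_le[of k] k la by (auto simp: L_def)
      have Lx: "3 * L / x \<le> 1 / x\<^sup>2"
      proof -
        have "3 * L * x \<le> 6 / sqrt x * x" using L_le x(1) by (intro mult_right_mono) auto
        also have "\<dots> = 6 * sqrt x" using sx0 by (simp add: field_simps)
        also have "\<dots> \<le> 1" using sx by simp
        finally show ?thesis using x(1) by (simp add: power2_eq_square field_simps)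
      qed
      have an: "a \<le> n" using ab_le(1) Lx x(7) by linarith
      have \<Sigma>_le: "real \<Sigma> \<le> 6 * \<sigma> * L / x"
      proof -
        have "real \<Sigma> = (\<Sum>j=1..k. real (l j)) + (\<Sum>j=1..k. real (l' j))" by (simp add: \<Sigma>_def)
        also have "\<dots> \<le> (\<Sum>j=1..k. 3 * L / x) + (\<Sum>j=1..k. 3 * L / x)"
          using top l_le by (intro add_mono sum_mono) (fastforce simp: L_def intro: order_trans)+
        also have "\<dots> = real k * (6 * L / x)" by simp
        also have "\<dots> \<le> \<sigma> * (6 * L / x)"
          using \<sigma> L1 x(1) by (intro mult_right_mono) auto
        finally show ?thesis by (simp add: mult_ac)
      qed
      have \<Sigma>n: "\<Sigma> \<le> n"
      proof -
        have "6 * \<sigma> * L * x = 6 * (\<sigma> * L * sqrt x) * sqrt x" using sx0 by simp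
        also have "\<dots> \<le> 6 * (1 / 200) * 1"
          using sL sx sx0 \<sigma> L1 x(1,3) by (intro mult_mono) auto
        finally have "6 * \<sigma> * L / x \<le> 1 / x\<^sup>2" using x(1) by (simp add: power2_eq_square field_simps)
        with \<Sigma>_le x(7) have "real \<Sigma> \<le> real n" by linarith
        then show ?thesis by simp
      qed
      have k2: "k\<^sup>2 \<le> \<Sigma>"
      proof -
        have "k \<le> l j" if "j \<in> {1..k}" for j
        proof -
          have "l k \<le> l j" using mono that by auto
          with lk show ?thesis by linarith
        qed
        then have "(\<Sum>j=1..k. k) \<le> (\<Sum>j=1..k. l j)" by (rule sum_mono)
        then show ?thesis by (simp add: \<Sigma>_def power2_eq_square)
      qed
      define N where "N = n + k\<^sup>2 - \<Sigma>"
      have N: "N \<le> n" "N + (\<Sum>j=1..k. l j) + (\<Sum>j=1..k. l' j) = n + k\<^sup>2" "n - N + k\<^sup>2 = \<Sigma>"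
        using \<Sigma>n k2 by (auto simp: N_def \<Sigma>_def)
      \<comment> \<open>Room is needed for (6 + 28) \<sigma> L / x from the shift n - N and the
        first moments, and for 328 \<sigma> L^2 / x^2 <= A^2 from the second moments.\<close>
      define A where "A = 200 * \<sigma> * L / x"
      have A1: "1 / x \<le> A"
      proof -
        have "1 * 1 \<le> \<sigma> * L" using \<sigma> L1 by (intro mult_mono) auto
        then show ?thesis using x(1) by (simp add: A_def divide_right_mono)
      qed
      have A2: "A\<^sup>2 * x ^ 3 = 40000 * \<eta>"
        using x(1) by (simp add: A_def \<eta>_def power_divide power_mult_distrib power2_eq_square[of x] power3_eq_cube)
      note ta = qw_tail_sums[OF x(1) an half(1)]
      note tb = qw_tail_sums[OF x(1) le_add2[of b a] half(2)]
      define u where "u = qp x (l k) / x + qp x (l' k) / x"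
      have qu: "qp x a + qp x b \<le> 2 * (u * x)"
      proof -
        have "u * x = qp x (l k) + qp x (l' k)" using x(1) by (simp add: u_def distrib_right)
        with qa2 show ?thesis by linarith
      qed
      have u: "u \<le> \<sigma>" using \<sigma>(3) by (simp add: u_def)
      have qs: "qp x a + qp x b \<le> 2 * (\<sigma> * x)" using qu mult_right_mono[OF u, of x] x(1) by linarith
      have m0: "qmoment x {Suc a..n} {Suc b..a+b} 0 \<le> 1 / (800 * x)"
      proof -
        have "qmoment x {Suc a..n} {Suc b..a+b} 0 \<le> 2 * qp x a / x + 2 * qp x b / x"
          unfolding qmoment_def by (rule add_mono[OF ta(1) tb(1)])
        also have "\<dots> = 2 * (qp x a + qp x b) / x" by (simp add: add_divide_distrib)
        also have "\<dots> \<le> 2 * (2 * (\<sigma> * x)) / x"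
          using qs x(1) by (intro divide_right_mono mult_left_mono) auto
        also have "\<dots> = 4 * (\<sigma> * sqrt x) * sqrt x / x"
          using x(1) sx0(2) by (simp add: mult.assoc)
        also have "\<dots> \<le> 4 * (1 / 200) * (1 / 10 ^ 4) / x"
          using s1 sx sx0 \<sigma> x(1) by (intro divide_right_mono mult_mono) auto
        also have "\<dots> \<le> 1 / (800 * x)" using x(1) by (simp add: field_simps)
        finally show ?thesis .
      qed
      have m1: "real (n - N) + qmoment x {Suc a..n} {Suc b..a+b} 1 \<le> A"
      proof -
        have c: "real j / x + 4 / x\<^sup>2 \<le> 7 * L / x\<^sup>2" if "real j \<le> 3 * L / x" for j
        proof -
          have "real j / x \<le> 3 * L / x / x" using that x(1) by (intro divide_right_mono) auto
          moreover have "4 / x\<^sup>2 \<le> 4 * L / x\<^sup>2" using L1 by (intro divide_right_mono) auto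
          moreover have "3 * L / x / x + 4 * L / x\<^sup>2 = 7 * L / x\<^sup>2"
            using x(1) by (simp add: power2_eq_square field_simps)
          ultimately show ?thesis by linarith
        qed
        have "qmoment x {Suc a..n} {Suc b..a+b} 1 \<le>
            2 * qp x a * (real a / x + 4 / x\<^sup>2) + 2 * qp x b * (real b / x + 4 / x\<^sup>2)"
          unfolding qmoment_def by (rule add_mono[OF ta(2) tb(2)])
        also have "\<dots> \<le> 2 * qp x a * (7 * L / x\<^sup>2) + 2 * qp x b * (7 * L / x\<^sup>2)"
          using c ab_le qp_pos[of x a] qp_pos[of x b] by (intro add_mono mult_left_mono) auto
        also have "\<dots> = 2 * (qp x a + qp x b) * (7 * L / x\<^sup>2)" by (simp only: distrib_left distrib_right)
        also have "\<dots> \<le> 2 * (2 * (\<sigma> * x)) * (7 * L / x\<^sup>2)"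
          using qs L1 by (intro mult_right_mono mult_left_mono) auto
        also have "\<dots> = 28 * \<sigma> * L / x" using x(1) by (simp add: power2_eq_square)
        finally have "qmoment x {Suc a..n} {Suc b..a+b} 1 \<le> 28 * \<sigma> * L / x" .
        moreover have "real (n - N) \<le> real \<Sigma>" using N(3) by simp
        moreover have "6 * \<sigma> * L / x + 28 * \<sigma> * L / x \<le> A"
          using \<sigma> L1 x(1) by (simp add: A_def add_divide_distrib[symmetric] divide_right_mono)
        ultimately show ?thesis using \<Sigma>_le by linarith
      qed
      have m2: "qmoment x {Suc a..n} {Suc b..a+b} 2 \<le> A\<^sup>2"
      proof -
        have LL: "1 \<le> L\<^sup>2" using L1 by (rule one_le_power)
        have c: "2 * (real j)\<^sup>2 / x + 64 / x ^ 3 \<le> 82 * L\<^sup>2 / x ^ 3" if "real j \<le> 3 * L / x" for j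
        proof -
          have "(real j)\<^sup>2 \<le> (3 * L / x)\<^sup>2" using that by (intro power_mono) auto
          then have "2 * (real j)\<^sup>2 / x \<le> 2 * (3 * L / x)\<^sup>2 / x" using x(1) by (intro divide_right_mono) auto
          moreover have "64 / x ^ 3 \<le> 64 * L\<^sup>2 / x ^ 3" using LL x(1) by (intro divide_right_mono) auto
          moreover have "2 * (3 * L / x)\<^sup>2 / x + 64 * L\<^sup>2 / x ^ 3 = 82 * L\<^sup>2 / x ^ 3"
            using x(1) by (simp add: power2_eq_square power3_eq_cube field_simps)
          ultimately show ?thesis by linarith
        qed
        have "qmoment x {Suc a..n} {Suc b..a+b} 2 \<le>
            2 * qp x a * (2 * (real a)\<^sup>2 / x + 64 / x ^ 3) + 2 * qp x b * (2 * (real b)\<^sup>2 / x + 64 / x ^ 3)"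
          unfolding qmoment_def by (rule add_mono[OF ta(3) tb(3)])
        also have "\<dots> \<le> 2 * qp x a * (82 * L\<^sup>2 / x ^ 3) + 2 * qp x b * (82 * L\<^sup>2 / x ^ 3)"
          using c ab_le qp_pos[of x a] qp_pos[of x b] by (intro add_mono mult_left_mono) auto
        also have "\<dots> = 2 * (qp x a + qp x b) * (82 * L\<^sup>2 / x ^ 3)" by (simp only: distrib_left distrib_right)
        also have "\<dots> \<le> 2 * (2 * (\<sigma> * x)) * (82 * L\<^sup>2 / x ^ 3)"
          using qs x(1) by (intro mult_right_mono mult_left_mono) auto
        also have "\<dots> = 328 * \<sigma> * (L\<^sup>2 / x\<^sup>2)" using x(1) by (simp add: power2_eq_square power3_eq_cube)
        also have "\<dots> \<le> 40000 * \<sigma>\<^sup>2 * (L\<^sup>2 / x\<^sup>2)"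
          using \<sigma>2 \<sigma>(1) by (intro mult_right_mono mult_mono) auto
        also have "\<dots> = A\<^sup>2" by (simp add: A_def power_divide power_mult_distrib)
        finally show ?thesis .
      qed
      have main: "(1 - C * (A\<^sup>2 * x ^ 3)) * (qp x (n - N) * qprod x a n * qprod x b (a + b) * card (partitions n))
         \<le> card {xs\<in>box a b. sum_list xs = N}"
        by (rule ge[OF s xx1 an N(1) A1 _ m1 m2 m0]) (use A2 \<eta>_small in simp)
      have "card {xs\<in>box a b. sum_list xs = N} \<le> card (frames n k l l')"
        unfolding frames_def a_def b_def
        by (rule card_frames_le) (use k mono lk N(2) in auto)
      with main have main': "(1 - C * (40000 * \<eta>)) * (qp x (n - N) * qprod x a n * qprod x b (a + b) * card (partitions n))
         \<le> card (frames n k l l')" unfolding A2 by linarith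
      \<comment> \<open>The rectangle has sides \<open>l k - k\<close> and \<open>l' k - k\<close>;
        returning to \<open>l k\<close> and \<open>l' k\<close> multiplies q^a and q^b by exp(-k x),
        and exp(k x) <= 1 + 2 \<sigma> x makes the change in the exponent O(\<sigma>^2 x).\<close>
      have ex: "qp x j / x * (1 + 2 * qp x j) \<le> qp x (j + k) / x + 14 * (\<sigma> * x) * (qp x (j + k) / x)"
        if "qp x j \<le> 2 * (\<sigma> * x)" for j
      proof -
        define v where "v = \<sigma> * x"
        have v: "0 \<le> v" "v \<le> 1 / 200" using \<sigma>(1) x(1) \<sigma>x2 by (auto simp: v_def)
        have "qp x j / x * (1 + 2 * qp x j) = qp x (j + k) / x * (exp (real k * x) * (1 + 2 * qp x j))"
          using qa[of j] by simp
        also have "\<dots> \<le> qp x (j + k) / x * ((1 + 2 * v) * (1 + 4 * v))"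
          using that e1 q0[of "j + k"] qp_pos[of x j] v unfolding v_def[symmetric]
          by (intro mult_left_mono mult_mono) auto
        also have "(1 + 2 * v) * (1 + 4 * v) \<le> 1 + 14 * v"
          using v mult_left_mono[of v 1 v] by (simp add: algebra_simps)
        then have "qp x (j + k) / x * ((1 + 2 * v) * (1 + 4 * v)) \<le> qp x (j + k) / x * (1 + 14 * v)"
          using q0[of "j + k"] by (intro mult_left_mono) auto
        finally show ?thesis by (simp add: v_def algebra_simps)
      qed
      have "exp (- u - 14 * \<sigma>\<^sup>2 * x) \<le> exp (- (qp x a / x * (1 + 2 * qp x a))) * exp (- (qp x b / x * (1 + 2 * qp x b)))"
      proof -
        have "qp x a / x * (1 + 2 * qp x a) + qp x b / x * (1 + 2 * qp x b) \<le> u + 14 * (\<sigma> * x) * u"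
          using ex[OF qa3(1)] ex[OF qa3(2)] unfolding u_def la by (simp add: algebra_simps)
        also have "14 * (\<sigma> * x) * u \<le> 14 * (\<sigma> * x) * \<sigma>"
          using u \<sigma> x(1) by (intro mult_left_mono) auto
        finally show ?thesis unfolding exp_add[symmetric] by (simp add: power2_eq_square algebra_simps)
      qed
      also have "\<dots> \<le> qprod x a n * qprod x b (a + b)"
        using qprod_ge[OF x(1) an half(1)] qprod_ge[OF x(1) le_add2[of b a] half(2)] qprod_pos[OF x(1), of a n]
        by (intro mult_mono) auto
      finally have pr: "exp (- u - 14 * \<sigma>\<^sup>2 * x) \<le> qprod x a n * qprod x b (a + b)" .
      \<comment> \<open>The corner makes n - N smaller than \<Sigma> by k^2, which acts in the
        favourable direction.\<close>
      have qN: "qp x \<Sigma> \<le> qp x (n - N)" using N(3) x(1) by (intro qp_antimono) auto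
      \<comment> \<open>The factor exp(2 k x), which matches the cells of the model, costs 2 k x <=
        2 \<sigma>^2 x in the exponent; 30 covers this and the 14 from the rectangle.\<close>
      have "(1 - 30 * (\<sigma>\<^sup>2 * x)) * (exp (2 * real k * x) * exp (- u)) \<le> exp (- u - 14 * \<sigma>\<^sup>2 * x)"
      proof -
        have "(1 - 30 * (\<sigma>\<^sup>2 * x)) * (exp (2 * real k * x) * exp (- u))
            \<le> exp (- (30 * (\<sigma>\<^sup>2 * x))) * (exp (2 * real k * x) * exp (- u))"
          using exp_ge_add_one_self[of "- (30 * (\<sigma>\<^sup>2 * x))"] by (intro mult_right_mono) auto
        also have "\<dots> = exp (- (30 * (\<sigma>\<^sup>2 * x)) + (2 * real k * x + - u))"
          by (simp only: exp_add)
        also have "\<dots> \<le> exp (- u - 14 * \<sigma>\<^sup>2 * x)"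
        proof -
          have "real k * x \<le> \<sigma>\<^sup>2 * x" using \<sigma>(2) \<sigma>2 x(1) by (intro mult_right_mono) auto
          moreover have "0 \<le> \<sigma>\<^sup>2 * x" using x(1) by simp
          ultimately have "- (30 * (\<sigma>\<^sup>2 * x)) + (2 * (real k * x) + - u) \<le> - u - 14 * (\<sigma>\<^sup>2 * x)" by linarith
          then show ?thesis by (simp add: mult.assoc)
        qed
        finally show ?thesis .
      qed
      with pr have pr2: "(1 - 30 * (\<sigma>\<^sup>2 * x)) * (exp (2 * real k * x) * exp (- u)) \<le> qprod x a n * qprod x b (a + b)"
        by linarith
      have W_eq: "W = qp x \<Sigma> * (exp (2 * real k * x) * exp (- u)) * card (partitions n)"
      proof -
        have "exp (- u) = exp (- (qp x (l k) / x)) * exp (- (qp x (l' k) / x))"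
          by (simp add: u_def flip: exp_add)
        then show ?thesis by (simp add: W_def)
      qed
      have \<sigma>\<eta>: "\<sigma>\<^sup>2 * x \<le> \<eta>"
        using mult_left_mono[of 1 "L\<^sup>2" "\<sigma>\<^sup>2 * x"] one_le_power[OF L1, of 2] x(1) by (simp add: \<eta>_def)
      have "(1 - K * \<eta>) * W \<le> (1 - C * (40000 * \<eta>)) * (1 - 30 * (\<sigma>\<^sup>2 * x)) * W"
      proof (rule mult_right_mono[OF _ W0])
        have "0 \<le> C * (40000 * \<eta>) * (30 * (\<sigma>\<^sup>2 * x))" using C \<eta>0 x(1) by simp
        then have "1 - C * (40000 * \<eta>) - 30 * (\<sigma>\<^sup>2 * x) \<le> (1 - C * (40000 * \<eta>)) * (1 - 30 * (\<sigma>\<^sup>2 * x))"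
          by (simp add: algebra_simps)
        moreover have "C * (40000 * \<eta>) + 30 * (\<sigma>\<^sup>2 * x) \<le> K * \<eta>"
        proof -
          have "K * \<eta> = C * (40000 * \<eta>) + 40030 * \<eta>" by (simp add: K_def algebra_simps)
          moreover have "30 * (\<sigma>\<^sup>2 * x) \<le> 40030 * \<eta>" using \<sigma>\<eta> \<eta>0 by linarith
          ultimately show ?thesis by linarith
        qed
        ultimately show "1 - K * \<eta> \<le> (1 - C * (40000 * \<eta>)) * (1 - 30 * (\<sigma>\<^sup>2 * x))" by linarith
      qed
      also have "\<dots> = (1 - C * (40000 * \<eta>)) * (qp x \<Sigma> * ((1 - 30 * (\<sigma>\<^sup>2 * x)) * (exp (2 * real k * x) * exp (- u))) * card (partitions n))"
        unfolding W_eq by (simp only: mult_ac)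
      also have "\<dots> \<le> (1 - C * (40000 * \<eta>)) * (qp x (n - N) * qprod x a n * qprod x b (a + b) * card (partitions n))"
      proof (rule mult_left_mono)
        have "qp x \<Sigma> * ((1 - 30 * (\<sigma>\<^sup>2 * x)) * (exp (2 * real k * x) * exp (- u)))
            \<le> qp x (n - N) * (qprod x a n * qprod x b (a + b))"
          using qN pr2 qp_pos[of x] qprod_pos[OF x(1)]
          by (intro order_trans[OF mult_left_mono[OF pr2] mult_right_mono[OF qN]])
             (auto intro!: mult_nonneg_nonneg less_imp_le)
        then have "qp x \<Sigma> * ((1 - 30 * (\<sigma>\<^sup>2 * x)) * (exp (2 * real k * x) * exp (- u))) * card (partitions n)
            \<le> qp x (n - N) * (qprod x a n * qprod x b (a + b)) * card (partitions n)"
          by (rule mult_right_mono) simp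
        then show "qp x \<Sigma> * ((1 - 30 * (\<sigma>\<^sup>2 * x)) * (exp (2 * real k * x) * exp (- u))) * card (partitions n)
            \<le> qp x (n - N) * qprod x a n * qprod x b (a + b) * card (partitions n)"
          by (simp only: mult.assoc)
        have "C * (40000 * \<eta>) \<le> K * \<eta>" using mult_right_mono[OF K(2) \<eta>0] by simp
        then show "0 \<le> 1 - C * (40000 * \<eta>)" using \<eta>1 by linarith
      qed
      also note main'
      finally show ?thesis .
    qed
    then show "(1 - K * ((real k + qp x (l k) / x + qp x (l' k) / x)\<^sup>2 * x * (ln (1 / x))\<^sup>2)) *
       (exp (2 * real k * x) * qp x ((\<Sum>j=1..k. l j) + (\<Sum>j=1..k. l' j))
         * exp (- (qp x (l k) / x)) * exp (- (qp x (l' k) / x)) * card (partitions n))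
     \<le> card (frames n k l l')"
      by (simp only: \<eta>_def \<sigma>_def L_def W_def \<Sigma>_def)
  qed
qed

section \<open>Partial sums of exponential variables\<close>

abbreviation expo :: "real measure" where
  "expo \<equiv> density lborel (exponential_density 1)"

lemma prob_space_expo: "prob_space expo"
  by (rule prob_space_exponential_density) simp

text \<open>A shift by s >= 0 multiplies the density by e^s on the shifted support, and that support
  is smaller.\<close>

lemma expo_shift_le:
  fixes h :: "real \<Rightarrow> ennreal"
  assumes [measurable]: "h \<in> borel_measurable borel" and s: "0 \<le> s"
  shows "(\<integral>\<^sup>+e. h (s + e) \<partial>expo) \<le> ennreal (exp s) * (\<integral>\<^sup>+u. h u \<partial>expo)"
proof -
  have "(\<integral>\<^sup>+e. h (s + e) \<partial>expo) = (\<integral>\<^sup>+e. ennreal (exponential_density 1 e) * h (s + e) \<partial>lborel)"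
    by (subst nn_integral_density) auto
  also have "\<dots> = (\<integral>\<^sup>+u. ennreal (exponential_density 1 (u - s)) * h u \<partial>lborel)"
    by (subst nn_integral_real_affine[of "\<lambda>u. ennreal (exponential_density 1 (u - s)) * h u" 1 s]) auto
  also have "\<dots> \<le> (\<integral>\<^sup>+u. ennreal (exp s) * (ennreal (exponential_density 1 u) * h u) \<partial>lborel)"
  proof (rule nn_integral_mono)
    fix u :: real
    have "exponential_density 1 (u - s) \<le> exp s * exponential_density 1 u"
      using s by (auto simp: exponential_density_def simp flip: exp_add)
    then have "ennreal (exponential_density 1 (u - s)) \<le> ennreal (exp s) * ennreal (exponential_density 1 u)"
      by (simp add: ennreal_mult'[symmetric] ennreal_leI)
    then show "ennreal (exponential_density 1 (u - s)) * h u \<le> ennreal (exp s) * (ennreal (exponential_density 1 u) * h u)"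
      by (simp add: mult.assoc[symmetric] mult_right_mono)
  qed
  also have "\<dots> = ennreal (exp s) * (\<integral>\<^sup>+u. ennreal (exponential_density 1 u) * h u \<partial>lborel)"
    by (rule nn_integral_cmult) measurable
  also have "(\<integral>\<^sup>+u. ennreal (exponential_density 1 u) * h u \<partial>lborel) = (\<integral>\<^sup>+u. h u \<partial>expo)"
    by (subst nn_integral_density) auto
  finally show ?thesis .
qed

text \<open>The partial sums have joint density \<open>exp (- s\<^sub>m)\<close> on \<open>0 < s\<^sub>1 < \<dots> < s\<^sub>m\<close>.\<close>

lemma nn_integral_partial_sums_le:
  fixes C :: "nat \<Rightarrow> real set" and h :: "real \<Rightarrow> ennreal"
  assumes C [measurable]: "\<And>j. C j \<in> sets borel" and "h \<in> borel_measurable borel"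
  shows "(\<integral>\<^sup>+w. h (\<Sum>i=1..Suc m. w i) * (\<Prod>j=1..m. indicator (C j) (\<Sum>i=1..j. w i)) \<partial>PiM {1..Suc m} (\<lambda>_. expo))
    \<le> (\<Prod>j=1..m. emeasure lborel (C j)) * (\<integral>\<^sup>+u. h u \<partial>expo)"
  using assms(2)
proof (induction m arbitrary: h)
  interpret E: prob_space expo by (rule prob_space_expo)
  interpret product_sigma_finite "\<lambda>_ :: nat. expo" by standard
  case 0
  note [measurable] = 0
  have "(\<integral>\<^sup>+w. h (w 1) \<partial>PiM {1 :: nat} (\<lambda>_. expo)) = (\<integral>\<^sup>+u. h u \<partial>expo)"
    by (rule product_nn_integral_singleton) measurable
  then show ?case by simp
next
  interpret E: prob_space expo by (rule prob_space_expo)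
  interpret product_sigma_finite "\<lambda>_ :: nat. expo" by standard
  case (Suc m)
  note [measurable] = Suc.prems
  \<comment> \<open>The last variable is integrated out; what remains has the same form with
    \<open>h'\<close> at the partial sum of order m + 1, which is why h is arbitrary in the
    induction.\<close>
  define h' where "h' = (\<lambda>s. indicator (C (Suc m)) s * (\<integral>\<^sup>+y. h (s + y) \<partial>expo))"
  have h' [measurable]: "h' \<in> borel_measurable borel"
    unfolding h'_def by measurable
  let ?f = "\<lambda>w. h (\<Sum>i=1..Suc (Suc m). w i) * (\<Prod>j=1..Suc m. indicator (C j) (\<Sum>i=1..j. w i))"
  have eq: "{1..Suc (Suc m)} = insert (Suc (Suc m)) {1..Suc m}" by auto
  have f: "?f \<in> borel_measurable (PiM (insert (Suc (Suc m)) {1..Suc m}) (\<lambda>_. expo))"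
    unfolding eq[symmetric] by measurable
  have "(\<integral>\<^sup>+w. ?f w \<partial>PiM {1..Suc (Suc m)} (\<lambda>_. expo))
      = (\<integral>\<^sup>+w. (\<integral>\<^sup>+y. ?f (w(Suc (Suc m) := y)) \<partial>expo) \<partial>PiM {1..Suc m} (\<lambda>_. expo))"
    unfolding eq by (rule product_nn_integral_insert[OF _ _ f[unfolded eq]]) auto
  also have "\<dots> = (\<integral>\<^sup>+w. h' (\<Sum>i=1..Suc m. w i) * (\<Prod>j=1..m. indicator (C j) (\<Sum>i=1..j. w i)) \<partial>PiM {1..Suc m} (\<lambda>_. expo))"
  proof (rule nn_integral_cong)
    fix w :: "nat \<Rightarrow> real"
    define S where "S = (\<Sum>i=1..Suc m. w i)"
    define P :: ennreal where "P = (\<Prod>j=1..m. indicator (C j) (\<Sum>i=1..j. w i))"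
    have low: "(\<Sum>i=1..j. (w(Suc (Suc m) := y)) i) = (\<Sum>i=1..j. w i)" if "j \<le> Suc m" for j y
      using that by (intro sum.cong) auto
    have "?f (w(Suc (Suc m) := y)) = h (S + y) * (P * indicator (C (Suc m)) S)" for y
    proof -
      have "(\<Sum>i=1..Suc (Suc m). (w(Suc (Suc m) := y)) i) = S + y"
        unfolding S_def using low[of "Suc m" y] by (simp add: sum.cl_ivl_Suc)
      moreover have "(\<Prod>j=1..Suc m. indicator (C j) (\<Sum>i=1..j. (w(Suc (Suc m) := y)) i))
          = (\<Prod>j=1..Suc m. indicator (C j) (\<Sum>i=1..j. w i) :: ennreal)"
        using low by (intro prod.cong arg_cong[where f = "indicator _"]) auto
      moreover have "(\<Prod>j=1..Suc m. indicator (C j) (\<Sum>i=1..j. w i) :: ennreal) = P * indicator (C (Suc m)) S"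
        by (simp add: P_def S_def)
      ultimately show ?thesis by simp
    qed
    then have "(\<integral>\<^sup>+y. ?f (w(Suc (Suc m) := y)) \<partial>expo) = (\<integral>\<^sup>+y. h (S + y) * (P * indicator (C (Suc m)) S) \<partial>expo)"
      by simp
    also have "\<dots> = (\<integral>\<^sup>+y. h (S + y) \<partial>expo) * (P * indicator (C (Suc m)) S)"
      by (rule nn_integral_multc) measurable
    also have "\<dots> = h' S * P" by (simp add: h'_def mult_ac)
    finally show "(\<integral>\<^sup>+y. ?f (w(Suc (Suc m) := y)) \<partial>expo)
        = h' (\<Sum>i=1..Suc m. w i) * (\<Prod>j=1..m. indicator (C j) (\<Sum>i=1..j. w i))"
      by (simp only: S_def P_def)
  qed
  also have "\<dots> \<le> (\<Prod>j=1..m. emeasure lborel (C j)) * (\<integral>\<^sup>+u. h' u \<partial>expo)"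
    by (rule Suc.IH[OF h'])
  also have "(\<integral>\<^sup>+u. h' u \<partial>expo) \<le> emeasure lborel (C (Suc m)) * (\<integral>\<^sup>+u. h u \<partial>expo)"
  proof -
    let ?H = "\<integral>\<^sup>+u. h u \<partial>expo"
    have "(\<integral>\<^sup>+u. h' u \<partial>expo) = (\<integral>\<^sup>+u. ennreal (exponential_density 1 u) * h' u \<partial>lborel)"
      by (subst nn_integral_density) auto
    also have "\<dots> \<le> (\<integral>\<^sup>+u. ?H * indicator (C (Suc m)) u \<partial>lborel)"
    proof (rule nn_integral_mono)
      fix u :: real
      show "ennreal (exponential_density 1 u) * h' u \<le> ?H * indicator (C (Suc m)) u"
      proof (cases "0 \<le> u")
        case True
        \<comment> \<open>The factor e^u of the shift cancels the density at u, so that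
          \<open>C (Suc m)\<close> is measured by Lebesgue measure while the exponential weight
          passes to the next partial sum.\<close>
        have "ennreal (exponential_density 1 u) * (\<integral>\<^sup>+y. h (u + y) \<partial>expo)
            \<le> ennreal (exp (- u)) * (ennreal (exp u) * ?H)"
          using expo_shift_le[OF Suc.prems True] True
          by (intro mult_mono) (auto simp: exponential_density_def)
        also have "\<dots> = ?H"
          by (simp add: mult.assoc[symmetric] ennreal_mult'[symmetric] flip: exp_add)
        finally show ?thesis
          by (simp add: h'_def split: split_indicator)
      next
        case False
        then show ?thesis by (simp add: exponential_density_def)
      qed
    qed
    also have "\<dots> = ?H * emeasure lborel (C (Suc m))"
      by (rule nn_integral_cmult_indicator) measurable
    finally show ?thesis by (simp add: mult.commute)
  qed
  finally show ?case by (simp add: mult.assoc mult_left_mono)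
qed

context prob_space
begin

text \<open>By independence the joint law is the product measure, where the event is a product of
  indicators in the partial sums; all constraints but the last are then measured by Lebesgue
  measure.\<close>

lemma partial_sums_prob_le:
  fixes E :: "nat \<Rightarrow> 'a \<Rightarrow> real"
  assumes ind: "indep_vars (\<lambda>_. borel) E {1..Suc m}"
    and dist: "\<And>i. i \<in> {1..Suc m} \<Longrightarrow> distributed M lborel (E i) (exponential_density 1)"
    and C [measurable]: "\<And>j. C j \<in> sets borel"
  shows "emeasure M {\<omega>\<in>space M. \<forall>j\<in>{1..Suc m}. (\<Sum>i=1..j. E i \<omega>) \<in> C j}
     \<le> (\<Prod>j=1..m. emeasure lborel (C j)) * emeasure expo (C (Suc m))"
proof -
  interpret E: prob_space expo by (rule prob_space_expo)
  have E [measurable]: "E i \<in> borel_measurable M" if "i \<in> {1..Suc m}" for i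
    using ind that by (auto simp: indep_vars_def)
  have "distr M (PiM {1..Suc m} (\<lambda>_. borel)) (\<lambda>\<omega>. \<lambda>i\<in>{1..Suc m}. E i \<omega>) = PiM {1..Suc m} (\<lambda>i. distr M borel (E i))"
    using ind by (subst (asm) indep_vars_iff_distr_eq_PiM') (use E in auto)
  also have "\<dots> = PiM {1..Suc m} (\<lambda>_. expo)"
  proof (rule PiM_cong)
    fix i assume i: "i \<in> {1..Suc m}"
    have "distr M borel (E i) = distr M lborel (E i)" by (rule distr_cong) auto
    also have "\<dots> = expo" using dist[OF i] by (simp add: distributed_def)
    finally show "distr M borel (E i) = expo" .
  qed simp
  finally have D: "PiM {1..Suc m} (\<lambda>_. expo) = distr M (PiM {1..Suc m} (\<lambda>_. borel)) (\<lambda>\<omega>. \<lambda>i\<in>{1..Suc m}. E i \<omega>)" ..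
  let ?g = "\<lambda>w. indicator (C (Suc m)) (\<Sum>i=1..Suc m. w i) * (\<Prod>j=1..m. indicator (C j) (\<Sum>i=1..j. w i)) :: ennreal"
  have g: "?g \<in> borel_measurable (PiM {1..Suc m} (\<lambda>_. borel))" by measurable
  have meas: "{\<omega>\<in>space M. \<forall>j\<in>{1..Suc m}. (\<Sum>i=1..j. E i \<omega>) \<in> C j} \<in> sets M"
  proof -
    have "(\<lambda>\<omega>. \<Sum>i=1..j. E i \<omega>) \<in> borel_measurable M" if "j \<in> {1..Suc m}" for j
      using that by (intro borel_measurable_sum E) auto
    then show ?thesis by (intro sets.sets_Collect_finite_All) (auto intro: measurable_sets_Collect)
  qed
  have "emeasure M {\<omega>\<in>space M. \<forall>j\<in>{1..Suc m}. (\<Sum>i=1..j. E i \<omega>) \<in> C j}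
      = (\<integral>\<^sup>+\<omega>. indicator {\<omega>\<in>space M. \<forall>j\<in>{1..Suc m}. (\<Sum>i=1..j. E i \<omega>) \<in> C j} \<omega> \<partial>M)"
    using meas by simp
  also have "\<dots> = (\<integral>\<^sup>+\<omega>. ?g (\<lambda>i\<in>{1..Suc m}. E i \<omega>) \<partial>M)"
  proof (rule nn_integral_cong)
    fix \<omega> assume \<omega>: "\<omega> \<in> space M"
    have low: "(\<Sum>i=1..j. (\<lambda>i\<in>{1..Suc m}. E i \<omega>) i) = (\<Sum>i=1..j. E i \<omega>)" if "j \<le> Suc m" for j
      using that by (intro sum.cong) auto
    have "?g (\<lambda>i\<in>{1..Suc m}. E i \<omega>) = indicator (C (Suc m)) (\<Sum>i=1..Suc m. E i \<omega>) * (\<Prod>j=1..m. indicator (C j) (\<Sum>i=1..j. E i \<omega>))"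
      using low by (intro arg_cong2[where f = "(*)"] prod.cong arg_cong[where f = "indicator _"]) auto
    also have "\<dots> = (\<Prod>j=1..Suc m. indicator (C j) (\<Sum>i=1..j. E i \<omega>))" by (simp add: mult.commute)
    also have "\<dots> = indicator {\<omega>\<in>space M. \<forall>j\<in>{1..Suc m}. (\<Sum>i=1..j. E i \<omega>) \<in> C j} \<omega>"
    proof (cases "\<forall>j\<in>{1..Suc m}. (\<Sum>i=1..j. E i \<omega>) \<in> C j")
      case True
      with \<omega> show ?thesis by (simp add: prod.neutral del: prod.cl_ivl_Suc)
    next
      case False
      then obtain j where "j \<in> {1..Suc m}" "(\<Sum>i=1..j. E i \<omega>) \<notin> C j" by blast
      then have "(\<Prod>j=1..Suc m. indicator (C j) (\<Sum>i=1..j. E i \<omega>) :: ennreal) = 0"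
        by (intro prod_zero bexI[of _ j]) auto
      with False show ?thesis by (auto split: split_indicator simp del: prod.cl_ivl_Suc)
    qed
    finally show "indicator {\<omega>\<in>space M. \<forall>j\<in>{1..Suc m}. (\<Sum>i=1..j. E i \<omega>) \<in> C j} \<omega> = ?g (\<lambda>i\<in>{1..Suc m}. E i \<omega>)" ..
  qed
  also have "\<dots> = (\<integral>\<^sup>+w. ?g w \<partial>PiM {1..Suc m} (\<lambda>_. expo))"
    unfolding D by (rule nn_integral_distr[symmetric]) (rule measurable_restrict[OF E], assumption, simp only: measurable_distr_eq1, rule g)
  also have "\<dots> \<le> (\<Prod>j=1..m. emeasure lborel (C j)) * (\<integral>\<^sup>+u. indicator (C (Suc m)) u \<partial>expo)"
    by (rule nn_integral_partial_sums_le) auto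
  finally show ?thesis by simp
qed

end

section \<open>Cells of the rounded logarithms\<close>

lemma emeasure_expo_interval_le:
  assumes a: "0 \<le> a" "a \<le> b"
  shows "emeasure expo {a..<b} \<le> ennreal ((b - a) * exp (- a))"
proof -
  have "emeasure expo {a..<b} = (\<integral>\<^sup>+u. ennreal (exponential_density 1 u) * indicator {a..<b} u \<partial>lborel)"
    by (rule emeasure_density) auto
  also have "\<dots> \<le> (\<integral>\<^sup>+u. ennreal (exp (- a)) * indicator {a..<b} u \<partial>lborel)"
    using a by (intro nn_integral_mono) (auto simp: exponential_density_def split: split_indicator)
  also have "\<dots> = ennreal (exp (- a)) * emeasure lborel {a..<b}"
    by (rule nn_integral_cmult_indicator) auto
  also have "\<dots> = ennreal ((b - a) * exp (- a))"
    using a by (simp add: ennreal_mult'[symmetric] mult.commute)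
  finally show ?thesis .
qed

text \<open>Rounding up to m means m - 1 < y <= m for y = ln(1/(x S)) / x; solved for S this is an
  interval whose ends have ratio e^x.\<close>

lemma ceiling_log_cell:
  assumes x: "0 < (x::real)" and S: "0 < S" and m: "\<lceil>1 / x * ln (1 / x / S)\<rceil> = m"
  shows "exp (- (x * real_of_int m)) / x \<le> S" "S < exp (- (x * real_of_int m)) / x * exp x"
proof -
  define y where "y = 1 / x * ln (1 / x / S)"
  have y: "y \<le> real_of_int m" "real_of_int m - 1 < y" using m unfolding y_def by linarith+
  have "exp (x * y) = 1 / x / S" using x S by (simp add: y_def)
  then have S_eq: "S = exp (- (x * y)) / x" using x S by (simp add: exp_minus field_simps)
  have "x * y \<le> x * real_of_int m" using y x by simp
  then show "exp (- (x * real_of_int m)) / x \<le> S" unfolding S_eq using x by (simp add: divide_right_mono)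
  have "x * (real_of_int m - 1) < x * y" using y x by simp
  then have "- (x * y) < - (x * real_of_int m) + x" by (simp add: algebra_simps)
  then have "exp (- (x * y)) < exp (- (x * real_of_int m)) * exp x" by (simp flip: exp_add)
  then show "S < exp (- (x * real_of_int m)) / x * exp x" unfolding S_eq using x by (simp add: divide_strict_right_mono)
qed

lemma tuple_eq_iff:
  "length v = k \<Longrightarrow> tuple k f = v \<longleftrightarrow> (\<forall>j\<in>{1..k}. f j = v ! (j - 1))"
proof -
  assume v: "length v = k"
  have "tuple k f = v \<longleftrightarrow> (\<forall>i<k. f (Suc i) = v ! i)"
    using v by (auto simp: tuple_def list_eq_iff_nth_eq simp del: upt_Suc)
  also have "\<dots> \<longleftrightarrow> (\<forall>j\<in>{1..k}. f j = v ! (j - 1))"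
  proof safe
    fix j assume "\<forall>i<k. f (Suc i) = v ! i" "j \<in> {1..k}"
    then show "f j = v ! (j - 1)" by (cases j) auto
  next
    fix i assume "\<forall>j\<in>{1..k}. f j = v ! (j - 1)" "i < k"
    then show "f (Suc i) = v ! i" by (auto dest: bspec[of _ _ "Suc i"])
  qed
  finally show ?thesis .
qed

context prob_space
begin

lemma AE_expo_pos:
  assumes E: "E \<in> borel_measurable M" and gt: "prob {\<omega>\<in>space M. E \<omega> > (0::real)} = 1"
  shows "AE \<omega> in M. 0 < E \<omega>"
  using gt E by (subst (asm) prob_Collect_eq_1) auto

lemma distributed_expoI:
  assumes E [measurable]: "E \<in> borel_measurable M"
    and gt: "\<And>x. 0 \<le> x \<Longrightarrow> prob {\<omega>\<in>space M. E \<omega> > x} = exp (- x)"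
  shows "distributed M lborel E (exponential_density 1)"
proof -
  have "prob {\<omega>\<in>space M. E \<omega> \<le> a} = 1 - exp (- a * 1)" if "0 \<le> a" for a
  proof -
    have "{\<omega>\<in>space M. E \<omega> \<le> a} = space M - {\<omega>\<in>space M. E \<omega> > a}" by auto
    then show ?thesis using gt[OF that] by (simp add: prob_compl)
  qed
  then show ?thesis
    by (intro exponential_distributedI) (auto simp: emeasure_eq_measure ennreal_minus simp flip: ennreal_1)
qed

text \<open>The cell of S_j has length at most e^x e^(-x v_j), because e^x - 1 <= x e^x cancels the
  1/x in its left end; the density e^(-S_k) is largest at the left end of the last cell. Ignoring
  the order of the partial sums can only enlarge the bound.\<close>

lemma model_tuple_prob_le:
  assumes x: "0 < x" "sqrt (real n) / c_const = 1 / x" and k: "1 \<le> k" and v: "length v = k"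
    and ind: "indep_vars (\<lambda>_. borel) E {1..k}"
    and gt: "\<And>i x. i \<in> {1..k} \<Longrightarrow> 0 \<le> x \<Longrightarrow> prob {\<omega>\<in>space M. E i \<omega> > x} = exp (- x)"
  shows "prob {\<omega>\<in>space M. model_tuple k n (\<lambda>i. E i \<omega>) = v}
    \<le> exp (real k * x) * exp (- (x * real_of_int (sum_list v))) * exp (- (exp (- (x * real_of_int (v ! (k - 1)))) / x))"
proof -
  obtain m where m: "k = Suc m" using k by (cases k) auto
  have E: "E i \<in> borel_measurable M" if "i \<in> {1..k}" for i
    using ind that by (auto simp: indep_vars_def)
  define \<alpha> where "\<alpha> = (\<lambda>j. exp (- (x * real_of_int (v ! (j - 1)))) / x)"
  define C where "C = (\<lambda>j. {\<alpha> j..<\<alpha> j * exp x})"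
  have \<alpha>: "0 < \<alpha> j" for j using x by (simp add: \<alpha>_def)
  have \<alpha>x: "\<alpha> j \<le> \<alpha> j * exp x" for j using \<alpha>[of j] x by simp
  have len: "\<alpha> j * exp x - \<alpha> j \<le> exp x * exp (- (x * real_of_int (v ! (j - 1))))" for j
  proof -
    have "1 - x \<le> exp (- x)" using exp_ge_add_one_self[of "- x"] by linarith
    then have "(1 - x) * exp x \<le> exp (- x) * exp x" by (rule mult_right_mono) simp
    then have "exp x - 1 \<le> x * exp x" by (simp add: algebra_simps flip: exp_add)
    then have "\<alpha> j * (exp x - 1) \<le> \<alpha> j * (x * exp x)" using \<alpha>[of j] by (intro mult_left_mono) auto
    also have "\<dots> = exp x * exp (- (x * real_of_int (v ! (j - 1))))" using x by (simp add: \<alpha>_def)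
    finally show ?thesis by (simp add: algebra_simps)
  qed
  have dist: "distributed M lborel (E i) (exponential_density 1)" if "i \<in> {1..k}" for i
    by (rule distributed_expoI[OF E[OF that] gt[OF that]])
  have "AE \<omega> in M. \<forall>i\<in>{1..k}. 0 < E i \<omega>"
  proof (rule AE_finite_allI)
    fix i assume "i \<in> {1..k}"
    then show "AE \<omega> in M. 0 < E i \<omega>" using gt[of i 0] by (intro AE_expo_pos E) auto
  qed simp
  then have AE: "AE \<omega> in M. \<omega> \<in> {\<omega>\<in>space M. model_tuple k n (\<lambda>i. E i \<omega>) = v} \<longrightarrow>
     \<omega> \<in> {\<omega>\<in>space M. \<forall>j\<in>{1..k}. (\<Sum>i=1..j. E i \<omega>) \<in> C j}"
  proof (eventually_elim, safe)
    fix \<omega> j assume pos: "\<forall>i\<in>{1..k}. 0 < E i \<omega>" and eq: "v = model_tuple k n (\<lambda>i. E i \<omega>)" and j: "j \<in> {1..k}"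
    have S: "0 < (\<Sum>i=1..j. E i \<omega>)" using pos j by (intro sum_pos) auto
    have "model_part n (\<lambda>i. E i \<omega>) j = v ! (j - 1)"
      using eq tuple_eq_iff[OF v] j unfolding model_tuple_def by metis
    then have "\<lceil>1 / x * ln (1 / x / (\<Sum>i=1..j. E i \<omega>))\<rceil> = v ! (j - 1)"
      by (simp add: model_part_def x(2))
    from ceiling_log_cell[OF x(1) S this] show "(\<Sum>i=1..j. E i \<omega>) \<in> C j"
      by (simp add: C_def \<alpha>_def)
  qed
  have meas: "{\<omega>\<in>space M. \<forall>j\<in>{1..k}. (\<Sum>i=1..j. E i \<omega>) \<in> C j} \<in> sets M"
  proof -
    have "(\<lambda>\<omega>. \<Sum>i=1..j. E i \<omega>) \<in> borel_measurable M" if "j \<in> {1..k}" for j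
      using that by (intro borel_measurable_sum E) auto
    then show ?thesis by (intro sets.sets_Collect_finite_All) (auto intro: measurable_sets_Collect simp: C_def)
  qed
  have "emeasure M {\<omega>\<in>space M. model_tuple k n (\<lambda>i. E i \<omega>) = v}
      \<le> emeasure M {\<omega>\<in>space M. \<forall>j\<in>{1..k}. (\<Sum>i=1..j. E i \<omega>) \<in> C j}"
    by (rule emeasure_mono_AE[OF AE meas])
  also have "\<dots> \<le> (\<Prod>j=1..m. emeasure lborel (C j)) * emeasure expo (C (Suc m))"
    unfolding m by (rule partial_sums_prob_le) (use ind dist in \<open>auto simp: m C_def\<close>)
  also have "\<dots> \<le> (\<Prod>j=1..m. ennreal (exp x * exp (- (x * real_of_int (v ! (j - 1))))))
      * ennreal (exp x * exp (- (x * real_of_int (v ! (Suc m - 1)))) * exp (- \<alpha> (Suc m)))"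
  proof (rule mult_mono)
    show "(\<Prod>j=1..m. emeasure lborel (C j)) \<le> (\<Prod>j=1..m. ennreal (exp x * exp (- (x * real_of_int (v ! (j - 1))))))"
    proof -
      have "(\<Prod>j\<in>J. emeasure lborel (C j)) \<le> (\<Prod>j\<in>J. ennreal (exp x * exp (- (x * real_of_int (v ! (j - 1))))))" if "finite J" for J
        using that
      proof induction
        case (insert j J)
        have "emeasure lborel (C j) \<le> ennreal (exp x * exp (- (x * real_of_int (v ! (j - 1)))))"
          using len[of j] \<alpha>x[of j] by (auto simp: C_def intro!: ennreal_leI)
        with insert show ?case by (simp add: mult_mono del: of_int_mult)
      qed simp
      then show ?thesis by simp
    qed
    have "emeasure expo (C (Suc m)) \<le> ennreal ((\<alpha> (Suc m) * exp x - \<alpha> (Suc m)) * exp (- \<alpha> (Suc m)))"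
      unfolding C_def using \<alpha>[of "Suc m"] \<alpha>x by (intro emeasure_expo_interval_le) auto
    also have "\<dots> \<le> ennreal (exp x * exp (- (x * real_of_int (v ! (Suc m - 1)))) * exp (- \<alpha> (Suc m)))"
      using len[of "Suc m"] by (intro ennreal_leI mult_right_mono) auto
    finally show "emeasure expo (C (Suc m)) \<le> ennreal (exp x * exp (- (x * real_of_int (v ! (Suc m - 1)))) * exp (- \<alpha> (Suc m)))" .
  qed auto
  also have "\<dots> = ennreal ((\<Prod>j=1..m. exp x * exp (- (x * real_of_int (v ! (j - 1)))))
      * (exp x * exp (- (x * real_of_int (v ! (Suc m - 1)))) * exp (- \<alpha> (Suc m))))"
    by (subst prod_ennreal, simp) (rule ennreal_mult[symmetric]; intro prod_nonneg mult_nonneg_nonneg; simp)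
  also have "(\<Prod>j=1..m. exp x * exp (- (x * real_of_int (v ! (j - 1)))))
      * (exp x * exp (- (x * real_of_int (v ! (Suc m - 1)))) * exp (- \<alpha> (Suc m)))
      = (\<Prod>j=1..k. exp x * exp (- (x * real_of_int (v ! (j - 1))))) * exp (- \<alpha> k)"
    by (simp add: m)
  also have "(\<Prod>j=1..k. exp x * exp (- (x * real_of_int (v ! (j - 1)))))
      = exp (real k * x) * exp (- (x * real_of_int (sum_list v)))"
  proof -
    have "(\<Sum>j=1..k. real_of_int (v ! (j - 1))) = real_of_int (sum_list v)"
    proof -
      have "(\<Sum>j=1..k. real_of_int (v ! (j - 1))) = (\<Sum>j<k. real_of_int (v ! j))"
        by (rule sum.reindex_bij_witness[of _ Suc "\<lambda>j. j - 1"]) auto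
      then show ?thesis using v by (simp add: sum_list_sum_nth atLeast0LessThan)
    qed
    moreover have "(\<Prod>j=1..k. exp x * exp (- (x * real_of_int (v ! (j - 1)))))
        = exp (\<Sum>j=1..k. x + - (x * real_of_int (v ! (j - 1))))"
      by (simp only: exp_sum[OF finite_atLeastAtMost] exp_add)
    moreover have "(\<Sum>j=1..k. x + - (x * real_of_int (v ! (j - 1)))) = real k * x + - (x * (\<Sum>j=1..k. real_of_int (v ! (j - 1))))"
      by (simp add: sum_subtractf sum_distrib_left)
    ultimately show ?thesis by (simp only: exp_add)
  qed
  finally have "ennreal (prob {\<omega>\<in>space M. model_tuple k n (\<lambda>i. E i \<omega>) = v})
      \<le> ennreal (exp (real k * x) * exp (- (x * real_of_int (sum_list v))) * exp (- \<alpha> k))"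
    by (simp add: emeasure_eq_measure)
  then show ?thesis by (simp add: \<alpha>_def)
qed

end

section \<open>Comparison of the two distributions\<close>

text \<open>The values for which a point bound is available; L will be 3 ln(1/x) / x.\<close>

definition good_tuples :: "nat \<Rightarrow> real \<Rightarrow> int list set" where
  "good_tuples k L = {v. length v = k \<and> sorted_wrt (\<ge>) v \<and> (\<forall>a\<in>set v. 0 \<le> a \<and> real_of_int a \<le> L)}"

text \<open>The left end of the cell of S_k that belongs to v, hence a lower bound for S_k.\<close>

definition last_weight :: "real \<Rightarrow> nat \<Rightarrow> int list \<Rightarrow> real" where
  "last_weight x k v = exp (- (x * real_of_int (v ! (k - 1)))) / x"

definition error_weight :: "real \<Rightarrow> nat \<Rightarrow> int list \<Rightarrow> int list \<Rightarrow> real" where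
  "error_weight x k v w = (real k + last_weight x k v + last_weight x k w)\<^sup>2 * x * (ln (1 / x))\<^sup>2"

text \<open>The bound of \<open>model_tuple_prob_le\<close> for the probability that the model tuple
  is v.\<close>

definition model_weight :: "real \<Rightarrow> nat \<Rightarrow> int list \<Rightarrow> real" where
  "model_weight x k v = exp (real k * x) * exp (- (x * real_of_int (sum_list v))) * exp (- last_weight x k v)"

lemma finite_good_tuples: "finite (good_tuples k L)"
proof (rule finite_subset)
  show "good_tuples k L \<subseteq> {v. set v \<subseteq> {0..\<lfloor>L\<rfloor>} \<and> length v = k}"
    by (auto simp: good_tuples_def le_floor_iff)
qed (simp add: finite_lists_length_eq)

lemma model_weight_pos: "0 < model_weight x k v"
  by (simp add: model_weight_def)

lemma sum_nth_tuple: "length v = k \<Longrightarrow> (\<Sum>j=1..k. f (v ! (j - 1))) = (\<Sum>a\<leftarrow>v. f a)" for f :: "'a \<Rightarrow> 'b :: comm_monoid_add"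
proof -
  assume v: "length v = k"
  have "(\<Sum>j=1..k. f (v ! (j - 1))) = (\<Sum>j<k. f (v ! j))"
    by (rule sum.reindex_bij_witness[of _ Suc "\<lambda>j. j - 1"]) auto
  also have "\<dots> = (\<Sum>a\<leftarrow>v. f a)" using v by (simp add: sum_list_sum_nth atLeast0LessThan)
  finally show ?thesis .
qed

text \<open>\<open>card_frames_ge\<close> in terms of integer lists. The constant is raised to at
  least 1 so that \<open>model_close\<close> can bound exceptional events by the same variable as
  the error.\<close>

lemma partition_prob_ge:
  "\<exists>x0 K. 0 < x0 \<and> 1 \<le> K \<and> (\<forall>n x k v w. saddle n x \<longrightarrow> x \<le> x0 \<longrightarrow> 1 \<le> k \<longrightarrow>
     v \<in> good_tuples k (3 * ln (1 / x) / x) \<longrightarrow> w \<in> good_tuples k (3 * ln (1 / x) / x) \<longrightarrow>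
     (1 - K * error_weight x k v w) * (model_weight x k v * model_weight x k w)
       \<le> measure_pmf.prob (random_partition n) {xs. part_tuple k xs = v \<and> dual_tuple k xs = w})"
proof -
  obtain x1 K where x1: "0 < x1" and K: "0 < K" and ge: "\<And>n x k l l'. saddle n x \<Longrightarrow> x \<le> x1 \<Longrightarrow> 1 \<le> k \<Longrightarrow>
     (\<forall>i j. 1 \<le> i \<longrightarrow> i \<le> j \<longrightarrow> j \<le> k \<longrightarrow> l j \<le> l i \<and> l' j \<le> l' i) \<Longrightarrow>
     real (l 1) \<le> 3 * ln (1 / x) / x \<Longrightarrow> real (l' 1) \<le> 3 * ln (1 / x) / x \<Longrightarrow>
     (1 - K * ((real k + qp x (l k) / x + qp x (l' k) / x)\<^sup>2 * x * (ln (1 / x))\<^sup>2)) *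
       (exp (2 * real k * x) * qp x ((\<Sum>j=1..k. l j) + (\<Sum>j=1..k. l' j))
         * exp (- (qp x (l k) / x)) * exp (- (qp x (l' k) / x)) * card (partitions n))
     \<le> card (frames n k l l')"
    using card_frames_ge by blast
  show ?thesis
  proof (rule exI[of _ x1], rule exI[of _ "max 1 K"], intro conjI allI impI)
    show "0 < x1" "1 \<le> max 1 K" using x1 by auto
    fix n k :: nat and x :: real and v w :: "int list"
    assume s: "saddle n x" and xle: "x \<le> x1" and k: "1 \<le> k"
      and v: "v \<in> good_tuples k (3 * ln (1 / x) / x)" and w: "w \<in> good_tuples k (3 * ln (1 / x) / x)"
    note x = saddleD[OF s]
    define f where "f = (\<lambda>(u :: int list) j. nat (u ! (j - 1)))"
    have f: "int (f u j) = u ! (j - 1)" "f u j \<le> f u i" "real (f u 1) \<le> 3 * ln (1 / x) / x"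
      if u: "u \<in> good_tuples k (3 * ln (1 / x) / x)" and ij: "1 \<le> i" "i \<le> j" "j \<le> k" for u i j
    proof -
      have len: "length u = k" using u by (simp add: good_tuples_def)
      have mem: "u ! (m - 1) \<in> set u" if "1 \<le> m" "m \<le> k" for m using that len by auto
      show "int (f u j) = u ! (j - 1)" using mem[of j] ij u by (auto simp: f_def good_tuples_def)
      have "u ! (j - 1) \<le> u ! (i - 1)"
      proof (cases "i = j")
        case False
        then show ?thesis using u ij len sorted_wrt_nth_less[of "(\<ge>)" u "i - 1" "j - 1"]
          by (auto simp: good_tuples_def)
      qed simp
      then show "f u j \<le> f u i" by (simp add: f_def nat_mono)
      have "real_of_int (u ! (1 - 1)) \<le> 3 * ln (1 / x) / x" "0 \<le> u ! (1 - 1)"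
        using mem[of 1] k u by (auto simp: good_tuples_def)
      then show "real (f u 1) \<le> 3 * ln (1 / x) / x" by (simp add: f_def)
    qed
    have sum: "real (\<Sum>j=1..k. f u j) = real_of_int (sum_list u)" if u: "u \<in> good_tuples k (3 * ln (1 / x) / x)" for u
    proof -
      have "int (\<Sum>j=1..k. f u j) = (\<Sum>j=1..k. u ! (j - 1))"
        unfolding of_nat_sum by (rule sum.cong) (use f[OF u] in auto)
      also have "\<dots> = sum_list u"
        using sum_nth_tuple[of u k "\<lambda>a. a"] u by (simp add: good_tuples_def)
      finally show ?thesis by (metis of_int_of_nat_eq)
    qed
    have last: "qp x (f u k) / x = last_weight x k u" if u: "u \<in> good_tuples k (3 * ln (1 / x) / x)" for u
    proof -
      have "real (f u k) = real_of_int (u ! (k - 1))" using f(1)[OF u, of k k] k by (metis of_int_of_nat_eq order_refl)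
      then show ?thesis by (simp add: qp_def last_weight_def)
    qed
    have frames: "partitions n \<inter> {xs. part_tuple k xs = v \<and> dual_tuple k xs = w} = frames n k (f v) (f w)"
    proof -
      have len: "length v = k" "length w = k" using v w by (auto simp: good_tuples_def)
      have "part_tuple k xs = v \<longleftrightarrow> (\<forall>j\<in>{1..k}. part xs j = f v j)" for xs
        unfolding part_tuple_def tuple_eq_iff[OF len(1)]
        using f(1)[OF v, of j j for j] by (metis atLeastAtMost_iff of_nat_eq_iff order_refl)
      moreover have "dual_tuple k xs = w \<longleftrightarrow> (\<forall>j\<in>{1..k}. dual_part xs j = f w j)" for xs
        unfolding dual_tuple_def tuple_eq_iff[OF len(2)]
        using f(1)[OF w, of j j for j] by (metis atLeastAtMost_iff of_nat_eq_iff order_refl)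
      ultimately show ?thesis by (auto simp: frames_def)
    qed
    have cp: "0 < real (card (partitions n))"
      using finite_partitions partitions_nonempty by (simp add: card_gt_0_iff)
    have prob: "measure_pmf.prob (random_partition n) {xs. part_tuple k xs = v \<and> dual_tuple k xs = w}
        = card (frames n k (f v) (f w)) / card (partitions n)"
      unfolding random_partition_def by (simp add: measure_pmf_of_set finite_partitions partitions_nonempty frames)
    have "(1 - K * error_weight x k v w) * (model_weight x k v * model_weight x k w * card (partitions n))
        = (1 - K * ((real k + qp x (f v k) / x + qp x (f w k) / x)\<^sup>2 * x * (ln (1 / x))\<^sup>2)) *
       (exp (2 * real k * x) * qp x ((\<Sum>j=1..k. f v j) + (\<Sum>j=1..k. f w j))
         * exp (- (qp x (f v k) / x)) * exp (- (qp x (f w k) / x)) * card (partitions n))"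
    proof -
      have "qp x ((\<Sum>j=1..k. f v j) + (\<Sum>j=1..k. f w j)) = exp (- (x * real_of_int (sum_list v))) * exp (- (x * real_of_int (sum_list w)))"
        by (simp only: qp_add) (simp only: qp_def sum[OF v] sum[OF w])
      moreover have "exp (2 * real k * x) = exp (real k * x) * exp (real k * x)" by (simp flip: exp_add)
      ultimately show ?thesis
        unfolding error_weight_def model_weight_def last[OF v] last[OF w] by (simp only: mult_ac)
    qed
    also have "\<dots> \<le> card (frames n k (f v) (f w))"
    proof (rule ge[OF s xle k])
      show "real (f v 1) \<le> 3 * ln (1 / x) / x" by (rule f(3)[OF v, of 1 1]) (use k in auto)
      show "real (f w 1) \<le> 3 * ln (1 / x) / x" by (rule f(3)[OF w, of 1 1]) (use k in auto)
      show "\<forall>i j. 1 \<le> i \<longrightarrow> i \<le> j \<longrightarrow> j \<le> k \<longrightarrow> f v j \<le> f v i \<and> f w j \<le> f w i"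
        using f(2)[OF v] f(2)[OF w] by blast
    qed
    finally have "(1 - K * error_weight x k v w) * (model_weight x k v * model_weight x k w)
        \<le> measure_pmf.prob (random_partition n) {xs. part_tuple k xs = v \<and> dual_tuple k xs = w}"
      unfolding prob using cp by (simp add: pos_le_divide_eq mult.assoc)
    moreover have "(1 - max 1 K * error_weight x k v w) * (model_weight x k v * model_weight x k w)
        \<le> (1 - K * error_weight x k v w) * (model_weight x k v * model_weight x k w)"
    proof -
      have "0 \<le> error_weight x k v w" using x(1) by (simp add: error_weight_def)
      then have "K * error_weight x k v w \<le> max 1 K * error_weight x k v w" by (intro mult_right_mono) auto
      then show ?thesis
        using model_weight_pos[of x k v] model_weight_pos[of x k w] by (intro mult_right_mono) auto
    qed
    ultimately show "(1 - max 1 K * error_weight x k v w) * (model_weight x k v * model_weight x k w)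
       \<le> measure_pmf.prob (random_partition n) {xs. part_tuple k xs = v \<and> dual_tuple k xs = w}"
      by linarith
  qed
qed

section \<open>Measurability and exceptional values of the model\<close>

lemma measurable_model_tuple:
  assumes "\<And>i. i \<in> {1..k} \<Longrightarrow> (\<lambda>\<omega>. g i \<omega>) \<in> borel_measurable N"
  shows "(\<lambda>\<omega>. model_tuple k n (\<lambda>i. g i \<omega>)) \<in> N \<rightarrow>\<^sub>M count_space UNIV"
  unfolding measurable_count_space_eq2_countable
proof (intro conjI ballI)
  have part: "(\<lambda>\<omega>. model_part n (\<lambda>i. g i \<omega>) j) \<in> N \<rightarrow>\<^sub>M count_space UNIV" if "j \<in> {1..k}" for j
  proof -
    have [measurable]: "(\<lambda>\<omega>. \<Sum>i=1..j. g i \<omega>) \<in> borel_measurable N"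
      using that by (intro borel_measurable_sum assms) auto
    show ?thesis unfolding model_part_def by measurable
  qed
  fix v :: "int list"
  have "(\<lambda>\<omega>. model_tuple k n (\<lambda>i. g i \<omega>)) -` {v} \<inter> space N
      = (if length v = k then {\<omega>\<in>space N. \<forall>j\<in>{1..k}. model_part n (\<lambda>i. g i \<omega>) j = v ! (j - 1)} else {})"
    by (auto simp: model_tuple_def tuple_eq_iff) (auto simp: tuple_def simp del: upt_Suc)
  also have "\<dots> \<in> sets N"
  proof -
    have "{\<omega>\<in>space N. model_part n (\<lambda>i. g i \<omega>) j = c} \<in> sets N" if "j \<in> {1..k}" for j c
      using measurable_sets[OF part[OF that], of "{c}"] by (simp add: vimage_def Int_def conj_commute)
    then show ?thesis by (auto intro!: sets.sets_Collect_finite_All)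
  qed
  finally show "(\<lambda>\<omega>. model_tuple k n (\<lambda>i. g i \<omega>)) -` {v} \<inter> space N \<in> sets N" .
qed simp

lemma measurable_model_pair:
  assumes "\<And>i. i \<in> {1..k} \<Longrightarrow> (\<lambda>\<omega>. g i \<omega>) \<in> borel_measurable N" "\<And>i. i \<in> {1..k} \<Longrightarrow> (\<lambda>\<omega>. h i \<omega>) \<in> borel_measurable N"
  shows "(\<lambda>\<omega>. (model_tuple k n (\<lambda>i. g i \<omega>), model_tuple k n (\<lambda>i. h i \<omega>))) \<in> N \<rightarrow>\<^sub>M count_space UNIV"
proof -
  have "(\<lambda>\<omega>. (model_tuple k n (\<lambda>i. g i \<omega>), model_tuple k n (\<lambda>i. h i \<omega>)))
      \<in> N \<rightarrow>\<^sub>M count_space UNIV \<Otimes>\<^sub>M count_space UNIV"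
    using assms by (intro measurable_Pair measurable_model_tuple)
  then show ?thesis by (simp add: pair_measure_countable)
qed

lemma sorted_model_tuple:
  assumes x: "0 < x" "sqrt (real n) / c_const = 1 / x" and pos: "\<And>i. i \<in> {1..k} \<Longrightarrow> 0 < e i"
  shows "sorted_wrt (\<ge>) (model_tuple k n e)"
proof -
  have "model_part n e j \<le> model_part n e i" if ij: "1 \<le> i" "i \<le> j" "j \<le> k" for i j
  proof -
    have S: "0 < (\<Sum>m=1..i. e m)" using pos ij by (intro sum_pos) auto
    have "(\<Sum>m=1..i. e m) \<le> (\<Sum>m=1..j. e m)" using pos ij by (intro sum_mono2) (auto intro: less_imp_le)
    then have "1 / x / (\<Sum>m=1..j. e m) \<le> 1 / x / (\<Sum>m=1..i. e m)"
      using S x(1) by (intro divide_left_mono) auto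
    then have "ln (1 / x / (\<Sum>m=1..j. e m)) \<le> ln (1 / x / (\<Sum>m=1..i. e m))"
      using S x(1) \<open>(\<Sum>m=1..i. e m) \<le> (\<Sum>m=1..j. e m)\<close> by (intro ln_mono) auto
    then have "1 / x * ln (1 / x / (\<Sum>m=1..j. e m)) \<le> 1 / x * ln (1 / x / (\<Sum>m=1..i. e m))"
      using x(1) by (intro mult_left_mono) auto
    then show ?thesis unfolding model_part_def x(2) by (rule ceiling_mono)
  qed
  then show ?thesis
    by (auto simp: model_tuple_def tuple_def sorted_wrt_iff_nth_less simp del: upt_Suc)
qed

text \<open>The two alternatives correspond to a large first entry and to a negative last entry.\<close>

lemma model_tuple_bad:
  assumes x: "0 < x" "x \<le> 1 / 2" "sqrt (real n) / c_const = 1 / x" and k: "1 \<le> k"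
    and pos: "\<And>i. i \<in> {1..k} \<Longrightarrow> 0 < e i"
    and bad: "model_tuple k n e \<notin> good_tuples k (3 * ln (1 / x) / x)"
  shows "e 1 \<le> 2 * x\<^sup>2 \<or> 1 / x \<le> (\<Sum>i=1..k. e i)"
proof (rule ccontr)
  assume "\<not> ?thesis"
  then have e1: "2 * x\<^sup>2 < e 1" and Sk: "(\<Sum>i=1..k. e i) < 1 / x" by auto
  have "model_tuple k n e \<in> good_tuples k (3 * ln (1 / x) / x)"
    unfolding good_tuples_def
  proof safe
    show "length (model_tuple k n e) = k" by (simp add: model_tuple_def tuple_def)
    show "sorted_wrt (\<ge>) (model_tuple k n e)" by (rule sorted_model_tuple[OF x(1,3) pos])
    fix a assume "a \<in> set (model_tuple k n e)"
    then have "a \<in> model_part n e ` {1..k}"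
      by (simp add: model_tuple_def tuple_def atLeastLessThanSuc_atLeastAtMost del: upt_Suc)
    then obtain j where j: "j \<in> {1..k}" and a: "a = model_part n e j" by blast
    define S where "S = (\<Sum>i=1..j. e i)"
    have S1: "e 1 \<le> S" unfolding S_def using pos j by (intro member_le_sum) (auto intro: less_imp_le)
    have S2: "S \<le> (\<Sum>i=1..k. e i)" unfolding S_def using pos j by (intro sum_mono2) (auto intro: less_imp_le)
    have S0: "0 < S" using pos[of 1] k S1 by simp
    define y where "y = 1 / x * ln (1 / x / S)"
    have a: "a = \<lceil>y\<rceil>" by (simp add: a model_part_def x(3) y_def S_def)
    have "S < 1 / x" using S2 Sk by linarith
    then have "1 < 1 / x / S" using S0 x(1) by (simp add: field_simps)
    then have "0 < y" unfolding y_def using x(1) by (intro mult_pos_pos ln_gt_zero) auto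
    then show "0 \<le> a" unfolding a by linarith
    \<comment> \<open>The 2 in 2 x^2 dominates e^x, which lowers the logarithm by x and so pays for
      the 1 that rounding up may add.\<close>
    have "exp x \<le> 2" using real_exp_bound_lemma[of x] x by linarith
    then have "x\<^sup>2 * exp x \<le> x\<^sup>2 * 2" by (intro mult_left_mono) auto
    then have "x\<^sup>2 * exp x \<le> S" using e1 S1 by linarith
    then have "1 / x / S \<le> 1 / x / (x\<^sup>2 * exp x)" using x(1) S0 by (intro divide_left_mono) auto
    also have "\<dots> = (1 / x) ^ 3 * exp (- x)"
      by (simp add: power2_eq_square power3_eq_cube exp_minus field_simps)
    finally have "ln (1 / x / S) \<le> ln ((1 / x) ^ 3 * exp (- x))"
      using S0 x(1) by (intro ln_mono) auto
    also have "\<dots> = 3 * ln (1 / x) - x"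
      using x(1) by (simp add: ln_mult ln_realpow)
    finally have "1 / x * ln (1 / x / S) \<le> 1 / x * (3 * ln (1 / x) - x)"
      using x(1) by (intro mult_left_mono) auto
    also have "\<dots> = 3 * ln (1 / x) / x - 1" using x(1) by (simp add: field_simps)
    finally have "y \<le> 3 * ln (1 / x) / x - 1" by (simp add: y_def)
    then show "real_of_int a \<le> 3 * ln (1 / x) / x" unfolding a by linarith
  qed
  with bad show False by simp
qed

lemma last_weight_model_le:
  assumes x: "0 < x" "sqrt (real n) / c_const = 1 / x" and k: "1 \<le> k"
    and pos: "\<And>i. i \<in> {1..k} \<Longrightarrow> 0 < e i"
  shows "last_weight x k (model_tuple k n e) \<le> (\<Sum>i=1..k. e i)"
proof -
  have S: "0 < (\<Sum>i=1..k. e i)" using pos k by (intro sum_pos) auto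
  have "model_tuple k n e ! (k - 1) = \<lceil>1 / x * ln (1 / x / (\<Sum>i=1..k. e i))\<rceil>"
    using k by (simp add: model_tuple_def tuple_def model_part_def x(2) del: upt_Suc)
  from ceiling_log_cell(1)[OF x(1) S this[symmetric]] show ?thesis
    by (simp add: last_weight_def)
qed

context prob_space
begin

text \<open>\<open>U\<close> is an integrable majorant of the relative error along the model. It
  enters twice: its expectation bounds the sum of the point errors over the good pairs and, by
  Markov's inequality, the probability that a partial sum is too large. The event that a first
  variable is small adds 2 x^2 for each family.\<close>

lemma model_close:
  fixes E E' :: "nat \<Rightarrow> 'a \<Rightarrow> real"
  assumes x: "saddle n x" "sqrt (real n) / c_const = 1 / x" "1 \<le> ln (1 / x)" and k: "1 \<le> k" and K: "1 \<le> K"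
    and ge: "\<And>v w. v \<in> good_tuples k (3 * ln (1 / x) / x) \<Longrightarrow> w \<in> good_tuples k (3 * ln (1 / x) / x) \<Longrightarrow>
     (1 - K * error_weight x k v w) * (model_weight x k v * model_weight x k w)
       \<le> measure_pmf.prob (random_partition n) {xs. part_tuple k xs = v \<and> dual_tuple k xs = w}"
    and ind: "indep_vars (\<lambda>_. borel) E {1..k}" "indep_vars (\<lambda>_. borel) E' {1..k}"
    and gt: "\<And>i x. i \<in> {1..k} \<Longrightarrow> 0 \<le> x \<Longrightarrow> prob {\<omega>\<in>space M. E i \<omega> > x} = exp (- x)"
     "\<And>i x. i \<in> {1..k} \<Longrightarrow> 0 \<le> x \<Longrightarrow> prob {\<omega>\<in>space M. E' i \<omega> > x} = exp (- x)"
    and indep: "\<And>B1 B2. prob {\<omega>\<in>space M. model_tuple k n (\<lambda>i. E i \<omega>) \<in> B1 \<and> model_tuple k n (\<lambda>i. E' i \<omega>) \<in> B2}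
      = prob {\<omega>\<in>space M. model_tuple k n (\<lambda>i. E i \<omega>) \<in> B1} * prob {\<omega>\<in>space M. model_tuple k n (\<lambda>i. E' i \<omega>) \<in> B2}"
  shows "\<bar>measure_pmf.prob (random_partition n) {xs. (part_tuple k xs, dual_tuple k xs) \<in> A}
      - prob {\<omega>\<in>space M. (model_tuple k n (\<lambda>i. E i \<omega>), model_tuple k n (\<lambda>i. E' i \<omega>)) \<in> A}\<bar>
     \<le> 30 * K * (real k)\<^sup>2 * x * (ln (1 / x))\<^sup>2 + 4 * x\<^sup>2"
proof -
  note xs = saddleD[OF x(1)]
  define L where "L = ln (1 / x)"
  define Y where "Y = (\<lambda>\<omega>. model_tuple k n (\<lambda>i. E i \<omega>))"
  define Y' where "Y' = (\<lambda>\<omega>. model_tuple k n (\<lambda>i. E' i \<omega>))"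
  define p where "p = (\<lambda>A. measure_pmf.prob (random_partition n) {xs. (part_tuple k xs, dual_tuple k xs) \<in> A})"
  define q where "q = (\<lambda>A. prob {\<omega>\<in>space M. (Y \<omega>, Y' \<omega>) \<in> A})"
  define Q where "Q = (\<lambda>\<omega>. \<Sum>i=1..k. E i \<omega> ^ 2)"
  define Q' where "Q' = (\<lambda>\<omega>. \<Sum>i=1..k. E' i \<omega> ^ 2)"
  \<comment> \<open>A bound for (k + S_k + S'_k)^2 by Cauchy-Schwarz; its expectation is 3 k^2 + 6
    k^2 + 6 k^2, as the squared variables have mean 2.\<close>
  define V where "V = (\<lambda>\<omega>. 3 * (real k)\<^sup>2 + 3 * real k * Q \<omega> + 3 * real k * Q' \<omega>)"
  define U where "U = (\<lambda>\<omega>. K * x * L\<^sup>2 * V \<omega>)"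
  define G where "G = good_tuples k (3 * ln (1 / x) / x)"
  have E: "E i \<in> borel_measurable M" "E' i \<in> borel_measurable M" if "i \<in> {1..k}" for i
    using ind that by (auto simp: indep_vars_def)
  have dist: "distributed M lborel (E i) (exponential_density 1)" "distributed M lborel (E' i) (exponential_density 1)"
    if "i \<in> {1..k}" for i
    using E[OF that] gt(1)[OF that] gt(2)[OF that] by (auto intro!: distributed_expoI)
  have sq: "integrable M (\<lambda>\<omega>. E i \<omega> ^ 2)" "expectation (\<lambda>\<omega>. E i \<omega> ^ 2) = 2"
    "integrable M (\<lambda>\<omega>. E' i \<omega> ^ 2)" "expectation (\<lambda>\<omega>. E' i \<omega> ^ 2) = 2" if "i \<in> {1..k}" for i
    using erlang_ith_moment_integrable[OF _ dist(1)[OF that], of 2] erlang_ith_moment[OF _ dist(1)[OF that], of 2]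
      erlang_ith_moment_integrable[OF _ dist(2)[OF that], of 2] erlang_ith_moment[OF _ dist(2)[OF that], of 2]
    by (auto simp: fact_numeral)
  have Q: "integrable M Q" "integrable M Q'" "expectation Q = 2 * real k" "expectation Q' = 2 * real k"
    unfolding Q_def Q'_def using sq
    by (auto simp: Bochner_Integration.integral_sum intro!: Bochner_Integration.integrable_sum)
  have V_int: "integrable M V" unfolding V_def using Q by simp
  have V_exp: "expectation V = 15 * (real k)\<^sup>2"
    unfolding V_def using Q by (simp add: prob_space power2_eq_square)
  have U_int: "integrable M U" unfolding U_def using V_int by simp
  have U_exp: "expectation U = 15 * K * (real k)\<^sup>2 * x * L\<^sup>2" unfolding U_def using V_exp by simp
  have U_nonneg: "0 \<le> U \<omega>" for \<omega>
    unfolding U_def V_def Q_def Q'_def using K xs(1) by (auto intro!: mult_nonneg_nonneg add_nonneg_nonneg sum_nonneg)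
  have Y [measurable]: "Y \<in> M \<rightarrow>\<^sub>M count_space UNIV" "Y' \<in> M \<rightarrow>\<^sub>M count_space UNIV"
    unfolding Y_def Y'_def using E by (auto intro!: measurable_model_tuple)
  have YY: "(\<lambda>\<omega>. (Y \<omega>, Y' \<omega>)) \<in> M \<rightarrow>\<^sub>M count_space UNIV"
    unfolding Y_def Y'_def using E by (rule measurable_model_pair)
  have ev: "{\<omega>\<in>space M. (Y \<omega>, Y' \<omega>) \<in> A} \<in> sets M" for A
    using measurable_sets[OF YY, of A] by (simp add: vimage_def Int_def conj_commute)
  have AE_pos: "AE \<omega> in M. \<forall>i\<in>{1..k}. 0 < E i \<omega> \<and> 0 < E' i \<omega>"
  proof (rule AE_finite_allI)
    fix i assume i: "i \<in> {1..k}"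
    have "AE \<omega> in M. 0 < E i \<omega>" "AE \<omega> in M. 0 < E' i \<omega>"
      using gt(1)[OF i, of 0] gt(2)[OF i, of 0] E[OF i] by (auto intro!: AE_expo_pos)
    then show "AE \<omega> in M. 0 < E i \<omega> \<and> 0 < E' i \<omega>" by simp
  qed simp
  have S_le: "(\<Sum>i=1..k. e i)\<^sup>2 \<le> real k * (\<Sum>i=1..k. e i ^ 2)" for e :: "nat \<Rightarrow> real"
    using sum_squared_le_sum_of_squares[of e "{1..k}"] by (simp add: mult.commute)
  have V_ge: "(real k + (\<Sum>i=1..k. E i \<omega>) + (\<Sum>i=1..k. E' i \<omega>))\<^sup>2 \<le> V \<omega>" for \<omega>
  proof -
    have three: "(a + b + c)\<^sup>2 \<le> 3 * a\<^sup>2 + 3 * b\<^sup>2 + 3 * c\<^sup>2" for a b c :: real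
    proof -
      have "0 \<le> (a - b)\<^sup>2 + (b - c)\<^sup>2 + (a - c)\<^sup>2" by simp
      then show ?thesis by (simp add: power2_eq_square algebra_simps)
    qed
    show ?thesis
      unfolding V_def Q_def Q'_def using three[of "real k" "\<Sum>i=1..k. E i \<omega>" "\<Sum>i=1..k. E' i \<omega>"]
        S_le[of "\<lambda>i. E i \<omega>"] S_le[of "\<lambda>i. E' i \<omega>"] by linarith
  qed
  have U_ge: "AE \<omega> in M. K * error_weight x k (Y \<omega>) (Y' \<omega>) \<le> U \<omega>"
    using AE_pos
  proof eventually_elim
    case (elim \<omega>)
    have l: "last_weight x k (Y \<omega>) \<le> (\<Sum>i=1..k. E i \<omega>)" "last_weight x k (Y' \<omega>) \<le> (\<Sum>i=1..k. E' i \<omega>)"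
      unfolding Y_def Y'_def by (rule last_weight_model_le[OF xs(1) x(2) k], use elim in simp)+
    have l0: "0 \<le> last_weight x k v" for v using xs(1) by (simp add: last_weight_def)
    have "(real k + last_weight x k (Y \<omega>) + last_weight x k (Y' \<omega>))\<^sup>2 \<le> (real k + (\<Sum>i=1..k. E i \<omega>) + (\<Sum>i=1..k. E' i \<omega>))\<^sup>2"
      using l l0[of "Y \<omega>"] l0[of "Y' \<omega>"] by (intro power_mono) auto
    also have "\<dots> \<le> V \<omega>" by (rule V_ge)
    finally have "(real k + last_weight x k (Y \<omega>) + last_weight x k (Y' \<omega>))\<^sup>2 * (K * x * L\<^sup>2) \<le> V \<omega> * (K * x * L\<^sup>2)"
      using K xs(1) by (intro mult_right_mono) auto
    then show ?case by (simp add: U_def error_weight_def L_def mult_ac)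
  qed
  have bad: "q (- (G \<times> G)) \<le> 4 * x\<^sup>2 + expectation U"
  proof -
    let ?B1 = "{\<omega>\<in>space M. E 1 \<omega> \<le> 2 * x\<^sup>2}" and ?B2 = "{\<omega>\<in>space M. E' 1 \<omega> \<le> 2 * x\<^sup>2}" and ?B3 = "{\<omega>\<in>space M. 1 \<le> U \<omega>}"
    have 1: "1 \<in> {1..k}" using k by simp
    note [measurable] = E[OF 1] borel_measurable_integrable[OF U_int]
    have small: "prob {\<omega>\<in>space M. X \<omega> \<le> 2 * x\<^sup>2} \<le> 2 * x\<^sup>2"
      if "distributed M lborel X (exponential_density 1)" for X
    proof -
      have "prob {\<omega>\<in>space M. X \<omega> \<le> 2 * x\<^sup>2} = 1 - exp (- (2 * x\<^sup>2) * 1)"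
        by (rule exponential_distributedD_le[OF that]) auto
      also have "\<dots> \<le> 2 * x\<^sup>2" using exp_ge_add_one_self[of "- (2 * x\<^sup>2)"] by simp
      finally show ?thesis .
    qed
    have "AE \<omega> in M. \<omega> \<in> {\<omega>\<in>space M. (Y \<omega>, Y' \<omega>) \<in> - (G \<times> G)} \<longrightarrow> \<omega> \<in> ?B1 \<union> ?B2 \<union> ?B3"
      using AE_pos
    proof eventually_elim
      case (elim \<omega>)
      note pos = elim
      show ?case
      proof (rule impI)
        assume \<omega>: "\<omega> \<in> {\<omega>\<in>space M. (Y \<omega>, Y' \<omega>) \<in> - (G \<times> G)}"
        have Sp: "0 \<le> (\<Sum>i=1..k. E i \<omega>)" "0 \<le> (\<Sum>i=1..k. E' i \<omega>)" using pos by (auto intro!: sum_nonneg simp: less_imp_le)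
        \<comment> \<open>A partial sum of size 1/x makes x V >= 1/x >= 1, and K L^2 >= 1 keeps U >=
          1.\<close>
        have big: "1 \<le> U \<omega>" if "1 / x \<le> (\<Sum>i=1..k. E i \<omega>) \<or> 1 / x \<le> (\<Sum>i=1..k. E' i \<omega>)"
        proof -
          have "1 / x \<le> real k + (\<Sum>i=1..k. E i \<omega>) + (\<Sum>i=1..k. E' i \<omega>)" using that Sp by auto
          then have "(1 / x)\<^sup>2 \<le> (real k + (\<Sum>i=1..k. E i \<omega>) + (\<Sum>i=1..k. E' i \<omega>))\<^sup>2"
            using xs(1) by (intro power_mono) auto
          with V_ge[of \<omega>] have Vx: "(1 / x)\<^sup>2 \<le> V \<omega>" by linarith
          have "1 \<le> 1 / x" using xs(1,3) by simp
          also have "1 / x = x * (1 / x)\<^sup>2" using xs(1) by (simp add: power2_eq_square)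
          also have "\<dots> \<le> x * V \<omega>" using Vx xs(1) by (intro mult_left_mono) auto
          finally have xV: "1 \<le> x * V \<omega>" .
          have "1 * 1 \<le> K * L\<^sup>2" using K x(3) by (intro mult_mono) (auto simp: L_def one_le_power)
          then have "1 * 1 \<le> (K * L\<^sup>2) * (x * V \<omega>)" using xV by (intro mult_mono) auto
          then show ?thesis by (simp add: U_def mult_ac)
        qed
        from \<omega> have "Y \<omega> \<notin> G \<or> Y' \<omega> \<notin> G" by auto
        then show "\<omega> \<in> ?B1 \<union> ?B2 \<union> ?B3"
        proof
          assume "Y \<omega> \<notin> G"
          then have "E 1 \<omega> \<le> 2 * x\<^sup>2 \<or> 1 / x \<le> (\<Sum>i=1..k. E i \<omega>)"
            unfolding Y_def G_def using pos by (intro model_tuple_bad[OF xs(1,3) x(2) k]) auto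
          with big \<omega> show ?thesis by auto
        next
          assume "Y' \<omega> \<notin> G"
          then have "E' 1 \<omega> \<le> 2 * x\<^sup>2 \<or> 1 / x \<le> (\<Sum>i=1..k. E' i \<omega>)"
            unfolding Y'_def G_def using pos by (intro model_tuple_bad[OF xs(1,3) x(2) k]) auto
          with big \<omega> show ?thesis by auto
        qed
      qed
    qed
    then have "q (- (G \<times> G)) \<le> prob (?B1 \<union> ?B2 \<union> ?B3)"
      unfolding q_def by (intro finite_measure_mono_AE) measurable
    also have "\<dots> \<le> prob (?B1 \<union> ?B2) + prob ?B3"
      by (rule measure_Un_le) measurable
    also have "prob (?B1 \<union> ?B2) \<le> prob ?B1 + prob ?B2"
      by (rule measure_Un_le) measurable
    also have "prob ?B3 \<le> expectation U / 1"
      by (rule integral_Markov_inequality_measure[OF U_int]) (use U_nonneg in auto)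
    finally show ?thesis using small[OF dist(1)[OF 1]] small[OF dist(2)[OF 1]] by simp
  qed
  \<comment> \<open>If the relative error exceeds 1 the inequality is trivial, as p is nonnegative;
    otherwise the upper bound for q and the lower bound for p share the weight W.\<close>
  have point: "q {y} - p {y} \<le> K * error_weight x k (fst y) (snd y) * q {y}" if y: "y \<in> G \<times> G" for y
  proof -
    obtain v w where yvw: "y = (v, w)" "v \<in> G" "w \<in> G" using y by auto
    define W where "W = model_weight x k v * model_weight x k w"
    define \<epsilon> where "\<epsilon> = K * error_weight x k v w"
    have "q {y} = prob {\<omega>\<in>space M. Y \<omega> \<in> {v} \<and> Y' \<omega> \<in> {w}}" by (simp add: q_def yvw)
    also have "\<dots> = prob {\<omega>\<in>space M. Y \<omega> = v} * prob {\<omega>\<in>space M. Y' \<omega> = w}"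
      unfolding Y_def Y'_def indep by simp
    also have "\<dots> \<le> W"
      unfolding W_def model_weight_def last_weight_def Y_def Y'_def
      by (intro mult_mono model_tuple_prob_le xs(1) x(2) k ind gt) (use yvw in \<open>auto simp: G_def good_tuples_def\<close>)
    finally have qW: "q {y} \<le> W" .
    have q0: "0 \<le> q {y}" "0 \<le> p {y}" by (simp_all add: q_def p_def)
    have pW: "(1 - \<epsilon>) * W \<le> p {y}"
      using ge[of v w] yvw by (simp add: p_def W_def \<epsilon>_def G_def)
    have "(1 - \<epsilon>) * q {y} \<le> p {y}"
    proof (cases "\<epsilon> \<le> 1")
      case True
      then have "(1 - \<epsilon>) * q {y} \<le> (1 - \<epsilon>) * W" using qW by (intro mult_left_mono) auto
      with pW show ?thesis by linarith
    next
      case False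
      then have "(1 - \<epsilon>) * q {y} \<le> 0" using q0 by (intro mult_nonpos_nonneg) auto
      with q0 show ?thesis by linarith
    qed
    then show ?thesis by (simp add: yvw \<epsilon>_def algebra_simps)
  qed
  have finG: "finite (G \<times> G)" by (simp add: G_def finite_good_tuples)
  \<comment> \<open>The weighted sum is the expectation of the error at the random pair, restricted
    to good pairs, and \<open>U\<close> dominates it almost surely.\<close>
  have err: "(\<Sum>y\<in>G \<times> G. K * error_weight x k (fst y) (snd y) * q {y}) \<le> expectation U"
  proof -
    have ind_int: "integrable M (\<lambda>\<omega>. indicator {\<omega>\<in>space M. (Y \<omega>, Y' \<omega>) \<in> {y}} \<omega> :: real)" for y
      using ev[of "{y}"] by (intro integrable_real_indicator) (auto simp: emeasure_eq_measure)
    have "(\<Sum>y\<in>G \<times> G. K * error_weight x k (fst y) (snd y) * q {y})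
        = (\<Sum>y\<in>G \<times> G. expectation (\<lambda>\<omega>. K * error_weight x k (fst y) (snd y) * indicator {\<omega>\<in>space M. (Y \<omega>, Y' \<omega>) \<in> {y}} \<omega>))"
      unfolding q_def using ev[of "{y}" for y] by (intro sum.cong) (auto simp: Bochner_Integration.integral_mult_right_zero)
    also have "\<dots> = expectation (\<lambda>\<omega>. \<Sum>y\<in>G \<times> G. K * error_weight x k (fst y) (snd y) * indicator {\<omega>\<in>space M. (Y \<omega>, Y' \<omega>) \<in> {y}} \<omega>)"
      by (rule Bochner_Integration.integral_sum[symmetric]) (intro Bochner_Integration.integrable_mult_right ind_int)
    also have "\<dots> \<le> expectation U"
    proof (rule integral_mono_AE[OF _ U_int])
      show "integrable M (\<lambda>\<omega>. \<Sum>y\<in>G \<times> G. K * error_weight x k (fst y) (snd y) * indicator {\<omega>\<in>space M. (Y \<omega>, Y' \<omega>) \<in> {y}} \<omega>)"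
        by (intro Bochner_Integration.integrable_sum Bochner_Integration.integrable_mult_right ind_int)
      show "AE \<omega> in M. (\<Sum>y\<in>G \<times> G. K * error_weight x k (fst y) (snd y) * indicator {\<omega>\<in>space M. (Y \<omega>, Y' \<omega>) \<in> {y}} \<omega>) \<le> U \<omega>"
        using U_ge
      proof eventually_elim
        case (elim \<omega>)
        have "(\<Sum>y\<in>G \<times> G. K * error_weight x k (fst y) (snd y) * indicator {\<omega>\<in>space M. (Y \<omega>, Y' \<omega>) \<in> {y}} \<omega>)
            \<le> (\<Sum>y\<in>G \<times> G. if y = (Y \<omega>, Y' \<omega>) then K * error_weight x k (Y \<omega>) (Y' \<omega>) else 0)"
          using K xs(1) by (intro sum_mono) (auto split: split_indicator simp: error_weight_def)
        also have "\<dots> \<le> U \<omega>" using elim U_nonneg[of \<omega>] finG by (simp add: sum.delta')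
        finally show ?case .
      qed
    qed
    finally show ?thesis .
  qed
  have q_sum: "q (B \<inter> (G \<times> G)) = (\<Sum>y\<in>B \<inter> (G \<times> G). q {y})" for B
  proof -
    have "{\<omega>\<in>space M. (Y \<omega>, Y' \<omega>) \<in> B \<inter> (G \<times> G)} = (\<Union>y\<in>B \<inter> (G \<times> G). {\<omega>\<in>space M. (Y \<omega>, Y' \<omega>) \<in> {y}})"
      by auto
    then show ?thesis
      unfolding q_def using finG ev
      by (simp only:) (rule finite_measure_finite_Union, auto simp: disjoint_family_on_def)
  qed
  have p_sum: "p (B \<inter> (G \<times> G)) = (\<Sum>y\<in>B \<inter> (G \<times> G). p {y})" for B
  proof -
    have "{xs. (part_tuple k xs, dual_tuple k xs) \<in> B \<inter> (G \<times> G)}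
        = (\<Union>y\<in>B \<inter> (G \<times> G). {xs. (part_tuple k xs, dual_tuple k xs) \<in> {y}})"
      by auto
    then show ?thesis
      unfolding p_def using finG
      by (simp only:) (rule measure_pmf.finite_measure_finite_Union, auto simp: disjoint_family_on_def)
  qed
  have one_sided: "q B - p B \<le> 30 * K * (real k)\<^sup>2 * x * L\<^sup>2 + 4 * x\<^sup>2" for B
  proof -
    have "q B \<le> prob ({\<omega>\<in>space M. (Y \<omega>, Y' \<omega>) \<in> B \<inter> (G \<times> G)} \<union> {\<omega>\<in>space M. (Y \<omega>, Y' \<omega>) \<in> - (G \<times> G)})"
      unfolding q_def by (intro finite_measure_mono sets.Un ev) auto
    also have "\<dots> \<le> q (B \<inter> (G \<times> G)) + q (- (G \<times> G))"
      unfolding q_def by (intro measure_Un_le ev)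
    finally have 1: "q B \<le> q (B \<inter> (G \<times> G)) + q (- (G \<times> G))" .
    have 2: "p (B \<inter> (G \<times> G)) \<le> p B"
      unfolding p_def by (intro measure_pmf.finite_measure_mono) auto
    have "q (B \<inter> (G \<times> G)) - p (B \<inter> (G \<times> G)) = (\<Sum>y\<in>B \<inter> (G \<times> G). q {y} - p {y})"
      unfolding q_sum p_sum by (rule sum_subtractf[symmetric])
    also have "\<dots> \<le> (\<Sum>y\<in>B \<inter> (G \<times> G). K * error_weight x k (fst y) (snd y) * q {y})"
      using point by (intro sum_mono) auto
    also have "\<dots> \<le> (\<Sum>y\<in>G \<times> G. K * error_weight x k (fst y) (snd y) * q {y})"
      using finG K xs(1) by (intro sum_mono2) (auto simp: error_weight_def q_def intro!: mult_nonneg_nonneg)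
    also note err
    finally show ?thesis using 1 2 bad U_exp by simp
  qed
  have compl: "p (- B) = 1 - p B" "q (- B) = 1 - q B" for B
  proof -
    have "{xs. (part_tuple k xs, dual_tuple k xs) \<in> - B} = - {xs. (part_tuple k xs, dual_tuple k xs) \<in> B}" by auto
    then show "p (- B) = 1 - p B"
      unfolding p_def using measure_pmf.prob_compl[of "{xs. (part_tuple k xs, dual_tuple k xs) \<in> B}" "random_partition n"]
      by (simp add: Compl_eq_Diff_UNIV)
    have "{\<omega>\<in>space M. (Y \<omega>, Y' \<omega>) \<in> - B} = space M - {\<omega>\<in>space M. (Y \<omega>, Y' \<omega>) \<in> B}" by auto
    then show "q (- B) = 1 - q B" unfolding q_def using ev[of B] by (simp add: prob_compl)
  qed
  \<comment> \<open>On the complement the difference changes sign, so the one-sided bound for all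
    sets bounds the absolute value.\<close>
  have "\<bar>p A - q A\<bar> \<le> 30 * K * (real k)\<^sup>2 * x * L\<^sup>2 + 4 * x\<^sup>2"
    using one_sided[of A] one_sided[of "- A"] compl[of A] by (simp add: abs_le_iff)
  then show ?thesis by (simp only: p_def q_def Y_def Y'_def L_def)
qed

end

section \<open>The error rate\<close>

context prob_space
begin

text \<open>With f = \<open>Inl\<close> and f = \<open>Inr\<close>, the independence of either
  family is read off from that of the joint family.\<close>

lemma indep_vars_reindex:
  assumes inj: "inj_on f I" and ind: "indep_vars M' X (f ` I)"
  shows "indep_vars (\<lambda>i. M' (f i)) (\<lambda>i. X (f i)) I"
proof -
  define F where "F = (\<lambda>i. {X i -` A \<inter> space M |A. A \<in> sets (M' i)})"
  have F: "indep_sets F (f ` I)" and rv: "\<And>i. i \<in> I \<Longrightarrow> random_variable (M' (f i)) (X (f i))"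
    using ind by (auto simp: indep_vars_def2 F_def)
  have "indep_sets (\<lambda>i. F (f i)) I"
    unfolding indep_sets_def
  proof (intro conjI ballI allI impI)
    fix i assume "i \<in> I"
    then show "F (f i) \<subseteq> events" using F by (auto simp: indep_sets_def)
  next
    fix J A assume J: "J \<subseteq> I" "J \<noteq> {}" "finite J" and A: "A \<in> (\<Pi> j\<in>J. F (f j))"
    define A' where "A' = (\<lambda>i. A (the_inv_into J f i))"
    have injJ: "inj_on f J" using inj J(1) by (rule inj_on_subset)
    have A': "A' (f j) = A j" if "j \<in> J" for j
      using that by (simp add: A'_def the_inv_into_f_f[OF injJ])
    have "prob (\<Inter>i\<in>f ` J. A' i) = (\<Prod>i\<in>f ` J. prob (A' i))"
    proof -
      have "A' \<in> Pi (f ` J) F" using A A' by auto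
      moreover have "f ` J \<subseteq> f ` I" "f ` J \<noteq> {}" "finite (f ` J)" using J by auto
      ultimately show ?thesis using F unfolding indep_sets_def by blast
    qed
    moreover have "(\<Inter>i\<in>f ` J. A' i) = (\<Inter>j\<in>J. A j)" using A' by auto
    moreover have "(\<Prod>i\<in>f ` J. prob (A' i)) = (\<Prod>j\<in>J. prob (A j))"
      by (subst prod.reindex[OF injJ]) (use A' in auto)
    ultimately show "prob (\<Inter>j\<in>J. A j) = (\<Prod>j\<in>J. prob (A j))" by simp
  qed
  with rv show ?thesis by (simp add: indep_vars_def2 F_def)
qed

text \<open>Mutual independence over the disjoint sum of the index sets gives two independent
  blocks, and each tuple is a measurable function of its own block.\<close>

lemma indep_model_tuples:
  assumes ind: "indep_vars (\<lambda>_. borel) (case_sum X X') ({1..k} <+> {1..k})"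
  shows "indep_vars (\<lambda>_. borel) X {1..k}" "indep_vars (\<lambda>_. borel) X' {1..k}"
    "prob {\<omega>\<in>space M. model_tuple k n (\<lambda>i. X i \<omega>) \<in> B1 \<and> model_tuple k n (\<lambda>i. X' i \<omega>) \<in> B2}
      = prob {\<omega>\<in>space M. model_tuple k n (\<lambda>i. X i \<omega>) \<in> B1} * prob {\<omega>\<in>space M. model_tuple k n (\<lambda>i. X' i \<omega>) \<in> B2}"
proof -
  let ?A = "Inl ` {1..k} :: (nat + nat) set" and ?B = "Inr ` {1..k} :: (nat + nat) set"
  have sub: "?A \<subseteq> {1..k} <+> {1..k}" "?B \<subseteq> {1..k} <+> {1..k}" by auto
  show "indep_vars (\<lambda>_. borel) X {1..k}"
    using indep_vars_reindex[OF inj_on_subset[OF inj_Inl subset_UNIV] indep_vars_subset[OF ind sub(1)]] by simp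
  show "indep_vars (\<lambda>_. borel) X' {1..k}"
    using indep_vars_reindex[OF inj_on_subset[OF inj_Inr subset_UNIV] indep_vars_subset[OF ind sub(2)]] by simp
  define F where "F = (\<lambda>f :: nat + nat \<Rightarrow> real. model_tuple k n (\<lambda>i. f (Inl i)))"
  define F' where "F' = (\<lambda>f :: nat + nat \<Rightarrow> real. model_tuple k n (\<lambda>i. f (Inr i)))"
  have F: "F \<in> PiM ?A (\<lambda>_. borel) \<rightarrow>\<^sub>M count_space UNIV" "F' \<in> PiM ?B (\<lambda>_. borel) \<rightarrow>\<^sub>M count_space UNIV"
    unfolding F_def F'_def by (rule measurable_model_tuple, rule measurable_component_singleton, simp)+
  have "indep_var (PiM ?A (\<lambda>_. borel)) (\<lambda>\<omega>. \<lambda>i\<in>?A. case_sum X X' i \<omega>) (PiM ?B (\<lambda>_. borel)) (\<lambda>\<omega>. \<lambda>i\<in>?B. case_sum X X' i \<omega>)"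
    by (rule indep_var_restrict[OF ind _ sub]) auto
  from indep_var_compose[OF this F]
  have iv: "indep_var (count_space UNIV) (F \<circ> (\<lambda>\<omega>. \<lambda>i\<in>?A. case_sum X X' i \<omega>)) (count_space UNIV) (F' \<circ> (\<lambda>\<omega>. \<lambda>i\<in>?B. case_sum X X' i \<omega>))" .
  \<comment> \<open>Restricting the variables to a block does not change the tuple, which reads only
    the indices 1..k.\<close>
  have cong: "model_tuple k n e = model_tuple k n e'" if "\<And>i. i \<in> {1..k} \<Longrightarrow> e i = e' i" for e e' :: "nat \<Rightarrow> real"
  proof -
    have "model_part n e j = model_part n e' j" if "j \<in> {1..k}" for j
    proof -
      have "(\<Sum>i=1..j. e i) = (\<Sum>i=1..j. e' i)"
        using that \<open>\<And>i. i \<in> {1..k} \<Longrightarrow> e i = e' i\<close> by (intro sum.cong) auto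
      then show ?thesis by (simp add: model_part_def)
    qed
    then show ?thesis by (auto simp: model_tuple_def tuple_def simp del: upt_Suc)
  qed
  have eq: "F \<circ> (\<lambda>\<omega>. \<lambda>i\<in>?A. case_sum X X' i \<omega>) = (\<lambda>\<omega>. model_tuple k n (\<lambda>i. X i \<omega>))"
    "F' \<circ> (\<lambda>\<omega>. \<lambda>i\<in>?B. case_sum X X' i \<omega>) = (\<lambda>\<omega>. model_tuple k n (\<lambda>i. X' i \<omega>))"
    unfolding F_def F'_def comp_def by (rule ext, rule cong, simp)+
  from indep_varD[OF iv[unfolded eq], of B1 B2]
  show "prob {\<omega>\<in>space M. model_tuple k n (\<lambda>i. X i \<omega>) \<in> B1 \<and> model_tuple k n (\<lambda>i. X' i \<omega>) \<in> B2}
      = prob {\<omega>\<in>space M. model_tuple k n (\<lambda>i. X i \<omega>) \<in> B1} * prob {\<omega>\<in>space M. model_tuple k n (\<lambda>i. X' i \<omega>) \<in> B2}"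
    by (simp add: vimage_def Int_def conj_commute)
qed

end

section \<open>From the saddle parameter to n\<close>

lemma c_const_bounds: "1 \<le> c_const" "c_const \<le> 2" "c_const\<^sup>2 = pi\<^sup>2 / 6"
proof -
  show sq: "c_const\<^sup>2 = pi\<^sup>2 / 6" by (simp add: c_const_def power_divide)
  have c0: "0 \<le> c_const" by (simp add: c_const_def)
  show "1 \<le> c_const" by (rule power2_le_imp_le[OF _ c0]) (use sq pi_squared_bounds in simp)
  show "c_const \<le> 2" by (rule power2_le_imp_le) (use sq pi_squared_bounds in simp_all)
qed

lemma num_parts_bounds:
  assumes "0 \<le> \<gamma>" "1 \<le> n"
  shows "1 \<le> num_parts \<gamma> n" "(real (num_parts \<gamma> n))\<^sup>2 \<le> real n powr (2 * \<gamma>)"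
proof -
  have ge: "1 \<le> real n powr \<gamma>" using assms by (intro ge_one_powr_ge_zero) auto
  then show "1 \<le> num_parts \<gamma> n" by (simp add: num_parts_def le_nat_floor)
  have "real (num_parts \<gamma> n) \<le> real n powr \<gamma>" using ge by (simp add: num_parts_def)
  then have "(real (num_parts \<gamma> n))\<^sup>2 \<le> (real n powr \<gamma>)\<^sup>2" by (intro power_mono) auto
  also have "\<dots> = real n powr (2 * \<gamma>)" by (simp add: power2_eq_square flip: powr_add)
  finally show "(real (num_parts \<gamma> n))\<^sup>2 \<le> real n powr (2 * \<gamma>)" .
qed

text \<open>k^2 x <= 2 n^(2 \<gamma> - 1/2), ln(1/x) <= ln n, and x^2 has order 1/n, which is at
  most n^(2 \<gamma> - 1/2) for \<gamma> >= 0. As n >= 3 gives ln n >= 1, lower powers of the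
  logarithm are bounded by the cube.\<close>

lemma error_rate:
  assumes \<gamma>: "0 \<le> \<gamma>" and n: "3 \<le> n" and K: "0 \<le> K" and x: "x = c_const / sqrt (real n)" "1 \<le> ln (1 / x)"
  shows "30 * K * (real (num_parts \<gamma> n))\<^sup>2 * x * (ln (1 / x))\<^sup>2 + 4 * x\<^sup>2
    \<le> (60 * K + 16) * (real n powr (2 * \<gamma> - 1 / 2) * ln (real n) ^ 3)"
proof -
  define r where "r = real n powr (2 * \<gamma> - 1 / 2)"
  have n0: "0 < real n" "1 \<le> real n" using n by auto
  have half: "1 / sqrt (real n) = real n powr (- (1 / 2))"
    using n0 by (simp add: powr_minus powr_half_sqrt inverse_eq_divide)
  have x_le: "x \<le> 2 * real n powr (- (1 / 2))"
    unfolding x half[symmetric] using c_const_bounds(2) by (simp add: divide_right_mono)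
  have x0: "0 < x" using c_const_bounds(1) n0 by (simp add: x)
  have ln1: "1 \<le> ln (real n)"
  proof -
    have "exp 1 \<le> real n" using exp_le n by linarith
    then show ?thesis using n0 by (simp add: ln_ge_iff)
  qed
  have L: "ln (1 / x) \<le> ln (real n)"
  proof (rule ln_mono)
    have "sqrt (real n) \<le> real n"
      using n0 by (intro real_le_lsqrt) (auto simp: power2_eq_square)
    then have "sqrt (real n) / c_const \<le> real n / 1" using c_const_bounds(1) n0 by (intro frac_le) auto
    then show "1 / x \<le> real n" by (simp add: x)
  qed (use x0 n0 in auto)
  have r: "real n powr (2 * \<gamma>) * real n powr (- (1 / 2)) = r"
    by (simp add: r_def flip: powr_add)
  have r0: "0 \<le> r" by (simp add: r_def)
  have ln3: "(ln (real n))\<^sup>2 \<le> ln (real n) ^ 3" "1 \<le> ln (real n) ^ 3"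
    using ln1 by (auto intro: power_increasing one_le_power)
  have "(real (num_parts \<gamma> n))\<^sup>2 * x \<le> real n powr (2 * \<gamma>) * (2 * real n powr (- (1 / 2)))"
    using num_parts_bounds(2)[OF \<gamma>, of n] n x_le x0 by (intro mult_mono) auto
  also have "\<dots> = 2 * r" using r by (simp add: mult_ac)
  finally have kx: "(real (num_parts \<gamma> n))\<^sup>2 * x \<le> 2 * r" .
  have "(real (num_parts \<gamma> n))\<^sup>2 * x * (ln (1 / x))\<^sup>2 \<le> 2 * r * (ln (real n))\<^sup>2"
    by (rule mult_mono[OF kx power_mono[OF L]]) (use x(2) r0 in auto)
  also have "\<dots> \<le> 2 * r * ln (real n) ^ 3" using ln3 r0 by (intro mult_left_mono) auto
  finally have "30 * K * ((real (num_parts \<gamma> n))\<^sup>2 * x * (ln (1 / x))\<^sup>2) \<le> 30 * K * (2 * r * ln (real n) ^ 3)"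
    using K by (intro mult_left_mono) auto
  moreover have "4 * x\<^sup>2 \<le> 16 * (r * ln (real n) ^ 3)"
  proof -
    have "x\<^sup>2 \<le> (2 * real n powr (- (1 / 2)))\<^sup>2" using x_le x0 by (intro power_mono) auto
    also have "\<dots> = 4 * real n powr (- 1)" by (simp add: power_mult_distrib power2_eq_square flip: powr_add)
    also have "\<dots> \<le> 4 * r" unfolding r_def using n0 \<gamma> by (intro mult_left_mono powr_mono) auto
    also have "r \<le> r * ln (real n) ^ 3" using mult_left_mono[OF ln3(2) r0] by simp
    finally show ?thesis by simp
  qed
  ultimately show ?thesis unfolding r_def[symmetric] by (simp add: algebra_simps)
qed

theorem theorem2p6:
  fixes \<gamma> :: real
    and M :: "nat \<Rightarrow> 's measure"
    and E E' :: "nat \<Rightarrow> nat \<Rightarrow> 's \<Rightarrow> real"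
  defines "k \<equiv> num_parts \<gamma>"
  assumes "\<gamma> < 1 / 4"
    and "\<And>n. prob_space (M n)"
    and "\<And>n. prob_space.indep_vars (M n) (\<lambda>_. borel) (case_sum (E n) (E' n))
               ({1..k n} <+> {1..k n})"
    and "\<And>n i x. i \<in> {1..k n} \<Longrightarrow> 0 \<le> x \<Longrightarrow>
               measure (M n) {\<omega> \<in> space (M n). E n i \<omega> > x} = exp (- x)"
    and "\<And>n i x. i \<in> {1..k n} \<Longrightarrow> 0 \<le> x \<Longrightarrow>
               measure (M n) {\<omega> \<in> space (M n). E' n i \<omega> > x} = exp (- x)"
  shows "(\<lambda>n. tv_dist
             (measure_pmf (map_pmf (\<lambda>xs. (part_tuple (k n) xs, dual_tuple (k n) xs))
                (random_partition n)))
             (distr (M n) (count_space UNIV)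
                (\<lambda>\<omega>. (model_tuple (k n) n (\<lambda>i. E n i \<omega>), model_tuple (k n) n (\<lambda>i. E' n i \<omega>)))))
           \<in> O(\<lambda>n. real n powr (2 * \<gamma> - 1 / 2) * ln (real n) ^ 3)
       \<and> (\<lambda>n. MAX A\<in>Pow (decr_tuples (k n) n \<times> decr_tuples (k n) n).
             \<bar>measure_pmf.prob (random_partition n)
                {xs. (part_tuple (k n) xs, dual_tuple (k n) xs) \<in> A}
              - measure (M n) {\<omega> \<in> space (M n).
                  (model_tuple (k n) n (\<lambda>i. E n i \<omega>), model_tuple (k n) n (\<lambda>i. E' n i \<omega>)) \<in> A}\<bar>)
           \<in> O(\<lambda>n. real n powr (2 * \<gamma> - 1 / 2) * ln (real n) ^ 3)
       \<and> (\<exists>C. \<forall>\<^sub>F n in sequentially.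
            \<forall>B\<^sub>1 B\<^sub>2. B\<^sub>1 \<subseteq> decr_tuples (k n) n \<longrightarrow> B\<^sub>2 \<subseteq> decr_tuples (k n) n \<longrightarrow>
              \<bar>measure_pmf.prob (random_partition n)
                 {xs. part_tuple (k n) xs \<in> B\<^sub>1 \<and> dual_tuple (k n) xs \<in> B\<^sub>2}
               - measure_pmf.prob (random_partition n) {xs. part_tuple (k n) xs \<in> B\<^sub>1}
                 * measure_pmf.prob (random_partition n) {xs. dual_tuple (k n) xs \<in> B\<^sub>2}\<bar>
              \<le> C * (real n powr (2 * \<gamma> - 1 / 2) * ln (real n) ^ 3))"
proof -
  define R where "R = (\<lambda>n. real n powr (2 * \<gamma> - 1 / 2) * ln (real n) ^ 3)"
  define p where "p = (\<lambda>n A. measure_pmf.prob (random_partition n) {xs. (part_tuple (k n) xs, dual_tuple (k n) xs) \<in> A})"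
  define q where "q = (\<lambda>n A. measure (M n) {\<omega> \<in> space (M n).
     (model_tuple (k n) n (\<lambda>i. E n i \<omega>), model_tuple (k n) n (\<lambda>i. E' n i \<omega>)) \<in> A})"
  note M = assms(3) and ind = assms(4) and gt = assms(5,6)
  have ind': "prob_space.indep_vars (M n) (\<lambda>_. borel) (E n) {1..k n}" "prob_space.indep_vars (M n) (\<lambda>_. borel) (E' n) {1..k n}"
    "measure (M n) {\<omega>\<in>space (M n). model_tuple (k n) n (\<lambda>i. E n i \<omega>) \<in> B1 \<and> model_tuple (k n) n (\<lambda>i. E' n i \<omega>) \<in> B2}
      = measure (M n) {\<omega>\<in>space (M n). model_tuple (k n) n (\<lambda>i. E n i \<omega>) \<in> B1}
        * measure (M n) {\<omega>\<in>space (M n). model_tuple (k n) n (\<lambda>i. E' n i \<omega>) \<in> B2}" for n B1 B2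
    by (rule prob_space.indep_model_tuples[OF M ind])+
  have meas: "E n i \<in> borel_measurable (M n)" "E' n i \<in> borel_measurable (M n)" if "i \<in> {1..k n}" for n i
    using ind'(1,2)[of n] that by (auto simp: prob_space.indep_vars_def[OF M])
  have R_nonneg: "0 \<le> R n" if "1 \<le> n" for n using that by (simp add: R_def)
  \<comment> \<open>The estimate is uniform over all sets A, not only over sets of decreasing
    nonnegative tuples; the three claims are read off from it.\<close>
  have "\<exists>C\<ge>0. \<forall>\<^sub>F n in sequentially. \<forall>A. \<bar>p n A - q n A\<bar> \<le> C * R n"
  proof (cases "0 \<le> \<gamma>")
    case True
    obtain x0 K where x0: "0 < x0" and K: "1 \<le> K" and ge: "\<And>n x k v w. saddle n x \<Longrightarrow> x \<le> x0 \<Longrightarrow> 1 \<le> k \<Longrightarrow>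
     v \<in> good_tuples k (3 * ln (1 / x) / x) \<Longrightarrow> w \<in> good_tuples k (3 * ln (1 / x) / x) \<Longrightarrow>
     (1 - K * error_weight x k v w) * (model_weight x k v * model_weight x k w)
       \<le> measure_pmf.prob (random_partition n) {xs. part_tuple k xs = v \<and> dual_tuple k xs = w}"
      using partition_prob_ge by blast
    define m where "m = min x0 (1 / 100)"
    have m: "0 < m" "m \<le> x0" "m \<le> 1 / 100" using x0 by (auto simp: m_def)
    have "\<forall>\<^sub>F n in sequentially. (c_const / m)\<^sup>2 \<le> real n"
      using filterlim_real_sequentially by (simp add: filterlim_at_top)
    then have "\<forall>\<^sub>F n in sequentially. \<forall>A. \<bar>p n A - q n A\<bar> \<le> (60 * K + 16) * R n"
      using eventually_ge_at_top[of 3]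
    proof eventually_elim
      case (elim n)
      define x where "x = c_const / sqrt (real n)"
      have c: "0 < c_const" using c_const_bounds(1) by linarith
      have n0: "0 < real n" using elim by simp
      have "c_const / m \<le> sqrt (real n)" using elim by (intro real_le_rsqrt) auto
      then have xm: "x \<le> m" using m(1) n0 by (simp add: x_def field_simps)
      have xpos: "0 < x" using c n0 by (simp add: x_def)
      have "saddle n x"
        unfolding saddle_def
      proof (intro conjI xpos)
        show "x \<le> 1 / 100" using xm m(3) by linarith
        show "real n * x\<^sup>2 = pi\<^sup>2 / 6" using n0 c_const_bounds(3) by (simp add: x_def power_divide)
      qed
      moreover have "sqrt (real n) / c_const = 1 / x" by (simp add: x_def)
      moreover have L: "1 \<le> ln (1 / x)"
      proof -
        have "100 \<le> 1 / x" using xpos xm m(3) by (simp add: field_simps)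
        then have "exp 1 \<le> 1 / x" using exp_le by linarith
        then show ?thesis using xpos by (simp add: ln_ge_iff)
      qed
      moreover have "1 \<le> k n" unfolding k_def using elim True by (intro num_parts_bounds) auto
      ultimately have "\<bar>p n A - q n A\<bar> \<le> 30 * K * (real (k n))\<^sup>2 * x * (ln (1 / x))\<^sup>2 + 4 * x\<^sup>2" for A
        unfolding p_def q_def using xm m(2)
        by (intro prob_space.model_close[OF M] K ge gt ind') auto
      moreover have "30 * K * (real (k n))\<^sup>2 * x * (ln (1 / x))\<^sup>2 + 4 * x\<^sup>2 \<le> (60 * K + 16) * R n"
        unfolding R_def k_def using K elim L by (intro error_rate True) (auto simp: x_def)
      ultimately show ?case by (meson order_trans)
    qed
    then show ?thesis using K by (intro exI[of _ "60 * K + 16"]) auto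
  next
    \<comment> \<open>For negative \<gamma> and n >= 2 there are no recorded parts: all tuples are
      empty, so both probabilities are 1 or both are 0.\<close>
    case False
    have "\<forall>\<^sub>F n in sequentially. \<forall>A. \<bar>p n A - q n A\<bar> \<le> 0 * R n"
      using eventually_ge_at_top[of 2]
    proof eventually_elim
      case (elim n)
      have "real n powr \<gamma> < 1" using False elim by (simp add: powr_less_one)
      then have "\<lfloor>real n powr \<gamma>\<rfloor> \<le> 0" by linarith
      then have "k n = 0" by (simp add: k_def num_parts_def)
      then show ?case
        using prob_space.prob_space[OF M]
        by (auto simp: p_def q_def part_tuple_def dual_tuple_def model_tuple_def tuple_def)
    qed
    then show ?thesis by blast
  qed
  then obtain C where C: "0 \<le> C" and close: "\<forall>\<^sub>F n in sequentially. \<forall>A. \<bar>p n A - q n A\<bar> \<le> C * R n"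
    by blast
  have 1: "(\<lambda>n. tv_dist
             (measure_pmf (map_pmf (\<lambda>xs. (part_tuple (k n) xs, dual_tuple (k n) xs))
                (random_partition n)))
             (distr (M n) (count_space UNIV)
                (\<lambda>\<omega>. (model_tuple (k n) n (\<lambda>i. E n i \<omega>), model_tuple (k n) n (\<lambda>i. E' n i \<omega>))))) \<in> O(R)"
  proof (rule bigoI)
    have tv: "tv_dist
             (measure_pmf (map_pmf (\<lambda>xs. (part_tuple (k n) xs, dual_tuple (k n) xs))
                (random_partition n)))
             (distr (M n) (count_space UNIV)
                (\<lambda>\<omega>. (model_tuple (k n) n (\<lambda>i. E n i \<omega>), model_tuple (k n) n (\<lambda>i. E' n i \<omega>))))
        = (SUP A. \<bar>p n A - q n A\<bar>)" for n
    proof -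
      have "measure (distr (M n) (count_space UNIV)
          (\<lambda>\<omega>. (model_tuple (k n) n (\<lambda>i. E n i \<omega>), model_tuple (k n) n (\<lambda>i. E' n i \<omega>)))) A = q n A" for A
        using meas by (subst measure_distr[OF measurable_model_pair])
          (auto simp: q_def intro!: arg_cong[where f = "measure (M n)"])
      then show ?thesis
        unfolding tv_dist_def by (simp add: p_def vimage_def)
    qed
    show "\<forall>\<^sub>F n in sequentially. norm (tv_dist
             (measure_pmf (map_pmf (\<lambda>xs. (part_tuple (k n) xs, dual_tuple (k n) xs))
                (random_partition n)))
             (distr (M n) (count_space UNIV)
                (\<lambda>\<omega>. (model_tuple (k n) n (\<lambda>i. E n i \<omega>), model_tuple (k n) n (\<lambda>i. E' n i \<omega>))))) \<le> C * norm (R n)"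
      using close eventually_ge_at_top[of 1]
    proof eventually_elim
      case (elim n)
      have "(SUP A. \<bar>p n A - q n A\<bar>) \<le> C * R n" using elim by (intro cSUP_least) auto
      \<comment> \<open>Any single set shows that the supremum is nonnegative, so that it equals its
        norm.\<close>
      moreover have "\<bar>p n {} - q n {}\<bar> \<le> (SUP A. \<bar>p n A - q n A\<bar>)"
        using elim by (intro cSUP_upper bdd_aboveI2[where M = "C * R n"]) auto
      ultimately show ?case unfolding tv using R_nonneg[of n] elim by simp
    qed
  qed
  have 2: "(\<lambda>n. MAX A\<in>Pow (decr_tuples (k n) n \<times> decr_tuples (k n) n). \<bar>p n A - q n A\<bar>) \<in> O(R)"
  proof (rule bigoI)
    show "\<forall>\<^sub>F n in sequentially. norm (MAX A\<in>Pow (decr_tuples (k n) n \<times> decr_tuples (k n) n). \<bar>p n A - q n A\<bar>) \<le> C * norm (R n)"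
      using close eventually_ge_at_top[of 1]
    proof eventually_elim
      case (elim n)
      let ?S = "(\<lambda>A. \<bar>p n A - q n A\<bar>) ` Pow (decr_tuples (k n) n \<times> decr_tuples (k n) n)"
      have fin: "finite ?S" by (simp add: finite_decr_tuples)
      have "Max ?S \<in> ?S" using fin by (intro Max_in) auto
      then have "0 \<le> Max ?S" "Max ?S \<le> C * R n" using elim by auto
      then show ?case using R_nonneg[of n] elim by simp
    qed
  qed
  have 3: "\<forall>\<^sub>F n in sequentially. \<forall>B\<^sub>1 B\<^sub>2.
      \<bar>measure_pmf.prob (random_partition n) {xs. part_tuple (k n) xs \<in> B\<^sub>1 \<and> dual_tuple (k n) xs \<in> B\<^sub>2}
       - measure_pmf.prob (random_partition n) {xs. part_tuple (k n) xs \<in> B\<^sub>1}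
         * measure_pmf.prob (random_partition n) {xs. dual_tuple (k n) xs \<in> B\<^sub>2}\<bar> \<le> 3 * C * R n"
    using close
  proof (eventually_elim, intro allI)
    fix n B\<^sub>1 B\<^sub>2 assume close: "\<forall>A. \<bar>p n A - q n A\<bar> \<le> C * R n"
    interpret prob_space "M n" by (rule M)
    define a where "a = p n (B\<^sub>1 \<times> UNIV)"
    define b where "b = p n (UNIV \<times> B\<^sub>2)"
    define a' where "a' = q n (B\<^sub>1 \<times> UNIV)"
    define b' where "b' = q n (UNIV \<times> B\<^sub>2)"
    have q12: "q n (B\<^sub>1 \<times> B\<^sub>2) = a' * b'"
      using ind'(3)[of n B\<^sub>1 B\<^sub>2] by (simp add: q_def a'_def b'_def)
    have b01: "0 \<le> b" "b \<le> 1" by (auto simp: b_def p_def)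
    have a01: "0 \<le> a'" "a' \<le> 1" by (auto simp: a'_def q_def)
    have ab: "\<bar>a' - a\<bar> \<le> C * R n" "\<bar>b' - b\<bar> \<le> C * R n"
      using close by (auto simp: a_def a'_def b_def b'_def abs_minus_commute)
    \<comment> \<open>The model splits exactly; exchanging its two marginals for those of the
      partition costs one error each, and the joint probability a third.\<close>
    have "a' * b' - a * b = a' * (b' - b) + (a' - a) * b" by (simp add: algebra_simps)
    then have "\<bar>a' * b' - a * b\<bar> \<le> \<bar>a'\<bar> * \<bar>b' - b\<bar> + \<bar>a' - a\<bar> * \<bar>b\<bar>"
      by (metis abs_mult abs_triangle_ineq)
    also have "\<dots> \<le> 1 * \<bar>b' - b\<bar> + \<bar>a' - a\<bar> * 1"
      using a01 b01 by (intro add_mono mult_right_mono mult_left_mono) auto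
    finally have "\<bar>a' * b' - a * b\<bar> \<le> 2 * (C * R n)" using ab by simp
    moreover have "\<bar>p n (B\<^sub>1 \<times> B\<^sub>2) - a' * b'\<bar> \<le> C * R n"
      using spec[OF close, of "B\<^sub>1 \<times> B\<^sub>2"] unfolding q12 .
    moreover have "\<bar>u - w\<bar> \<le> \<bar>v - w\<bar> + \<bar>u - v\<bar>" for u v w :: real by simp
    ultimately have "\<bar>p n (B\<^sub>1 \<times> B\<^sub>2) - a * b\<bar> \<le> 2 * (C * R n) + C * R n"
      by (meson add_mono order_trans)
    then have "\<bar>p n (B\<^sub>1 \<times> B\<^sub>2) - a * b\<bar> \<le> 3 * C * R n" by simp
    then show "\<bar>measure_pmf.prob (random_partition n) {xs. part_tuple (k n) xs \<in> B\<^sub>1 \<and> dual_tuple (k n) xs \<in> B\<^sub>2}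
       - measure_pmf.prob (random_partition n) {xs. part_tuple (k n) xs \<in> B\<^sub>1}
         * measure_pmf.prob (random_partition n) {xs. dual_tuple (k n) xs \<in> B\<^sub>2}\<bar> \<le> 3 * C * R n"
      by (simp add: p_def a_def b_def)
  qed
  have 3: "\<exists>C. \<forall>\<^sub>F n in sequentially.
            \<forall>B\<^sub>1 B\<^sub>2. B\<^sub>1 \<subseteq> decr_tuples (k n) n \<longrightarrow> B\<^sub>2 \<subseteq> decr_tuples (k n) n \<longrightarrow>
              \<bar>measure_pmf.prob (random_partition n)
                 {xs. part_tuple (k n) xs \<in> B\<^sub>1 \<and> dual_tuple (k n) xs \<in> B\<^sub>2}
               - measure_pmf.prob (random_partition n) {xs. part_tuple (k n) xs \<in> B\<^sub>1}
                 * measure_pmf.prob (random_partition n) {xs. dual_tuple (k n) xs \<in> B\<^sub>2}\<bar>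
              \<le> C * R n"
    by (rule exI[of _ "3 * C"], rule eventually_mono[OF 3]) blast
  show ?thesis
    using 1 2 3 unfolding R_def p_def q_def by blast
qed

end
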